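(* Let $(\mathrm{id},\phi):(A,\mathcal K)\to(A,\mathcal H)$ be a morphism of commutative Hopf algebroids. Assume that $\mathrm Q(\mathcal H)$ and $\mathrm Q(\mathcal K)$ are finitely generated and projective $A$-modules. The following assertions are equivalent: (a) $\mathrm Q(\phi):\mathrm Q(\mathcal K)\to\mathrm Q(\mathcal H)$ is split-injective (as a map of $A$-modules). (b) $\mathscr L(\phi):\mathscr L(\mathcal H)\to\mathscr L(\mathcal K)$ is surjective. (c) $\mathrm{Der}_\Bbbk^{\,s}(\phi,-):\mathrm{Der}_\Bbbk^{\,s}(\mathcal H,-)\to\mathrm{Der}_\Bbbk^{\,s}(\mathcal K,\phi_*(-))$ is surjective on each component. (d) $\mathrm{Der}_\Bbbk^{\,s}(\phi,\mathcal H):\mathrm{Der}_\Bbbk^{\,s}(\mathcal H,\mathcal H)\to\mathrm{Der}_\Bbbk^{\,s}(\mathcal K,\mathcal H)$ is surjective. (e) The map $\mathcal H\otimes_{\mathcal K}\Omega_A^s(\mathcal K)\to\Omega_A^s(\mathcal H)$, $h\otimes_{\mathcal K}w\mapsto h\,\Omega_A^s(\phi)(w)$, is split-injective (as a map of $\mathcal H$-modules).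
   Context: $\Bbbk$ is a field and $A$ a commutative $\Bbbk$-algebra. A commutative Hopf algebroid $(A,\mathcal H)$ over $\Bbbk$ consists of commutative $\Bbbk$-algebras with algebra maps $s,t:A\to\mathcal H$, $\Delta:\mathcal H\to\mathcal H\otimes_A\mathcal H$ ($u\mapsto u_1\otimes_Au_2$), $\varepsilon:\mathcal H\to A$, $\mathcal S:\mathcal H\to\mathcal H$, where $\mathcal H$ is the $A$-bimodule ${}_s\mathcal H_t$ (left via $s$, right via $t$), $\Delta,\varepsilon$ are $A$-bilinear, coassociative and counital, $\mathcal Ss=t$, $\mathcal St=s$, $\mathcal S^2=\mathrm{id}$, $\mathcal S(h_1)h_2=t(\varepsilon(h))$, $h_1\mathcal S(h_2)=s(\varepsilon(h))$. A morphism $(\mathrm{id},\phi):(A,\mathcal K)\to(A,\mathcal H)$ is an algebra map $\phi:\mathcal K\to\mathcal H$ commuting with all structure maps; $\phi_*$ denotes restriction of scalars from $\mathcal H$-modules to $\mathcal K$-modules. For an $\mathcal H$-module $M$, $\mathrm{Der}_\Bbbk^{\,s}(\mathcal H,M)$ is the $\mathcal H$-module of $\Bbbk$-linear derivations $\delta:\mathcal H\to M$, $\delta(uv)=u\delta(v)+v\delta(u)$, with $\delta\circ s=0$. The component of $\mathrm{Der}_\Bbbk^{\,s}(\phi,-)$ at an $\mathcal H$-module $M$ is $\mathrm{Der}_\Bbbk^{\,s}(\mathcal H,M)\to\mathrm{Der}_\Bbbk^{\,s}(\mathcal K,\phi_*(M))$, $\delta\mapsto\delta\circ\phi$; in (d),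 $\mathrm{Der}_\Bbbk^{\,s}(\mathcal K,\mathcal H)$ means $\mathrm{Der}_\Bbbk^{\,s}(\mathcal K,\phi_*(\mathcal H))$. $\mathscr L(\mathcal H)=\mathrm{Der}_\Bbbk^{\,s}(\mathcal H,A_\varepsilon)$, where $A_\varepsilon$ is $A$ as an $\mathcal H$-module via $\varepsilon$, and $\mathscr L(\phi)(\delta)=\delta\circ\phi$. Let $\mathcal I=\ker\varepsilon$ and $\mathrm Q(\mathcal H)={}_s(\mathcal I/\mathcal I^2)$, i.e. $\mathcal I/\mathcal I^2$ as an $A$-module via $s$; let $\pi^s_{\mathcal H}:\mathcal H\to\mathrm Q(\mathcal H)$, $u\mapsto(u-s(\varepsilon(u)))+\mathcal I^2$. $\mathrm Q(\phi)$ is the unique $A$-module map with $\mathrm Q(\phi)\circ\pi^s_{\mathcal K}=\pi^s_{\mathcal H}\circ\phi$. $\Omega_A^s(\mathcal H)$ is the Kähler module of $\mathcal H$ as an $A$-algebra via $s$; up to canonical isomorphism $\Omega_A^s(\mathcal H)={}_s\mathcal H_t\otimes_A\mathrm Q(\mathcal H)$ (with $\mathcal H$ acting on the left tensor factor), with universal derivation $u\mapsto u_1\otimes_A\pi^s_{\mathcal H}(u_2)$. $\Omega_A^s(\phi):\Omega_A^s(\mathcal K)\to\Omega_A^s(\mathcal H)$ is the map corresponding to $\phi\otimes_A\mathrm Q(\phi)$. *)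

theory Defs
  imports "HOL-Algebra.Module" "HOL-Algebra.QuotRing" "HOL-Algebra.Ideal_Product" "HOL-Algebra.Free_Abelian_Groups"
begin

section \<open>Modules and algebras\<close>

text \<open>
  The same ring or module record with another action: restriction of scalars, a ring as a module
  over another ring, and the two one-sided structures of a bimodule are all of this form.
\<close>

definition with_smult :: "('r \<Rightarrow> 'm \<Rightarrow> 'm) \<Rightarrow> ('m, 'z) ring_scheme \<Rightarrow> ('r, 'm) module"
  where "with_smult act M =
    \<lparr>carrier = carrier M, monoid.mult = monoid.mult M, one = one M, ring.zero = ring.zero M, ring.add = ring.add M, smult = act\<rparr>"

definition restrict_scalars :: "('r \<Rightarrow> 's) \<Rightarrow> ('s, 'm, 'z) module_scheme \<Rightarrow> ('r, 'm) module"
  where "restrict_scalars f M = with_smult (\<lambda>r x. f r \<odot>\<^bsub>M\<^esub> x) M"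

definition ring_via :: "('r \<Rightarrow> 'b) \<Rightarrow> ('b, 'z) ring_scheme \<Rightarrow> ('r, 'b) module"
  where "ring_via f B = with_smult (\<lambda>r x. f r \<otimes>\<^bsub>B\<^esub> x) B"

definition mod_hom ::
    "('r, 'w) ring_scheme \<Rightarrow> ('r, 'm, 'y) module_scheme \<Rightarrow> ('r, 'n, 'z) module_scheme \<Rightarrow> ('m \<Rightarrow> 'n) set"
  where "mod_hom R M N = {f \<in> carrier M \<rightarrow> carrier N.
    (\<forall>x\<in>carrier M. \<forall>y\<in>carrier M. f (x \<oplus>\<^bsub>M\<^esub> y) = f x \<oplus>\<^bsub>N\<^esub> f y) \<and>
    (\<forall>r\<in>carrier R. \<forall>x\<in>carrier M. f (r \<odot>\<^bsub>M\<^esub> x) = r \<odot>\<^bsub>N\<^esub> f x)}"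

definition alg_hom ::
    "('r, 'w) ring_scheme \<Rightarrow> ('r, 'm, 'y) module_scheme \<Rightarrow> ('r, 'n, 'z) module_scheme \<Rightarrow> ('m \<Rightarrow> 'n) set"
  where "alg_hom R M N = {f \<in> ring_hom M N.
    \<forall>r\<in>carrier R. \<forall>x\<in>carrier M. f (r \<odot>\<^bsub>M\<^esub> x) = r \<odot>\<^bsub>N\<^esub> f x}"

definition split_injective ::
    "('r, 'w) ring_scheme \<Rightarrow> ('r, 'm, 'y) module_scheme \<Rightarrow> ('r, 'n, 'z) module_scheme \<Rightarrow> ('m \<Rightarrow> 'n) \<Rightarrow> bool"
  where "split_injective R M N f \<longleftrightarrow>
    f \<in> mod_hom R M N \<and> (\<exists>g\<in>mod_hom R N M. \<forall>x\<in>carrier M. g (f x) = x)"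

definition finitely_generated :: "('r, 'w) ring_scheme \<Rightarrow> ('r, 'm, 'z) module_scheme \<Rightarrow> bool"
  where "finitely_generated R M \<longleftrightarrow>
    (\<exists>X. finite X \<and> X \<subseteq> carrier M \<and>
      (\<forall>x\<in>carrier M. \<exists>c\<in>X \<rightarrow> carrier R. x = (\<Oplus>\<^bsub>M\<^esub>g\<in>X. c g \<odot>\<^bsub>M\<^esub> g)))"

definition free_module :: "('r, 'w) ring_scheme \<Rightarrow> 'i set \<Rightarrow> ('r, 'i \<Rightarrow> 'r) module"
  where "free_module R S =
    \<lparr>carrier = {f. (\<forall>i\<in>S. f i \<in> carrier R) \<and> (\<forall>i. i \<notin> S \<longrightarrow> f i = \<zero>\<^bsub>R\<^esub>) \<and> finite {i. f i \<noteq> \<zero>\<^bsub>R\<^esub>}},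
     monoid.mult = undefined, one = undefined, ring.zero = (\<lambda>_. \<zero>\<^bsub>R\<^esub>),
     ring.add = (\<lambda>f g i. f i \<oplus>\<^bsub>R\<^esub> g i), smult = (\<lambda>r f i. r \<otimes>\<^bsub>R\<^esub> f i)\<rparr>"

text \<open>
  Projective means direct summand of a free module. Bases drawn from the element type of the
  module suffice: if the module is a summand of any free module, then it is a summand of the free
  module on its own carrier.
\<close>

definition projective :: "('r, 'w) ring_scheme \<Rightarrow> ('r, 'm, 'z) module_scheme \<Rightarrow> bool"
  where "projective R M \<longleftrightarrow> module R M \<and>
    (\<exists>S :: 'm set. \<exists>i\<in>mod_hom R M (free_module R S). \<exists>p\<in>mod_hom R (free_module R S) M.
      \<forall>x\<in>carrier M. p (i x) = x)"


section \<open>Abelian groups given by generators and relations\<close>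

definition pres_rel :: "'x set \<Rightarrow> ('x \<Rightarrow>\<^sub>0 int) set \<Rightarrow> ('x \<Rightarrow>\<^sub>0 int) set"
  where "pres_rel S rels = generate (free_Abelian_group S) rels"

definition pres_group :: "'x set \<Rightarrow> ('x \<Rightarrow>\<^sub>0 int) set \<Rightarrow> ('x \<Rightarrow>\<^sub>0 int) set monoid"
  where "pres_group S rels = free_Abelian_group S Mod pres_rel S rels"

definition pres_gen :: "'x set \<Rightarrow> ('x \<Rightarrow>\<^sub>0 int) set \<Rightarrow> 'x \<Rightarrow> ('x \<Rightarrow>\<^sub>0 int) set"
  where "pres_gen S rels x = pres_rel S rels #>\<^bsub>free_Abelian_group S\<^esub> frag_of x"

text \<open>
  The homomorphism from such a group to \<open>G\<close> with prescribed values on the generators. It is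
  meaningful only if these values respect the relations; then all elements of the coset \<open>X\<close>
  have the same image.
\<close>

definition pres_lift :: "('g, 'z) monoid_scheme \<Rightarrow> ('x \<Rightarrow> 'g) \<Rightarrow> ('x \<Rightarrow>\<^sub>0 int) set \<Rightarrow> 'g"
  where "pres_lift G f X = the_elem
    ((\<lambda>c. \<Otimes>\<^bsub>G\<^esub>x\<in>Poly_Mapping.keys c. f x [^]\<^bsub>G\<^esub> Poly_Mapping.lookup c x) ` X)"


section \<open>Tensor products\<close>

definition tensor_rels ::
    "('r, 'w) ring_scheme \<Rightarrow> ('r, 'm, 'y) module_scheme \<Rightarrow> ('r, 'n, 'z) module_scheme \<Rightarrow> ('m \<times> 'n \<Rightarrow>\<^sub>0 int) set"
  where "tensor_rels R M N =
    {frag_of (x \<oplus>\<^bsub>M\<^esub> x', y) - frag_of (x, y) - frag_of (x', y) | x x' y.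
       x \<in> carrier M \<and> x' \<in> carrier M \<and> y \<in> carrier N} \<union>
    {frag_of (x, y \<oplus>\<^bsub>N\<^esub> y') - frag_of (x, y) - frag_of (x, y') | x y y'.
       x \<in> carrier M \<and> y \<in> carrier N \<and> y' \<in> carrier N} \<union>
    {frag_of (r \<odot>\<^bsub>M\<^esub> x, y) - frag_of (x, r \<odot>\<^bsub>N\<^esub> y) | r x y.
       r \<in> carrier R \<and> x \<in> carrier M \<and> y \<in> carrier N}"

definition tens ::
    "('r, 'w) ring_scheme \<Rightarrow> ('r, 'm, 'y) module_scheme \<Rightarrow> ('r, 'n, 'z) module_scheme \<Rightarrow>
     'm \<Rightarrow> 'n \<Rightarrow> ('m \<times> 'n \<Rightarrow>\<^sub>0 int) set"
  where "tens R M N x y = pres_gen (carrier M \<times> carrier N) (tensor_rels R M N) (x, y)"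

text \<open>
  The fields \<open>mult\<close> and \<open>one\<close> (componentwise multiplication) are meaningful when both factors
  are \<open>R\<close>-algebras, and junk otherwise.
\<close>

definition tensor ::
    "('r, 'w) ring_scheme \<Rightarrow> ('r, 'm, 'y) module_scheme \<Rightarrow> ('r, 'n, 'z) module_scheme \<Rightarrow>
     ('r, ('m \<times> 'n \<Rightarrow>\<^sub>0 int) set) module"
  where "tensor R M N =
    (let G = pres_group (carrier M \<times> carrier N) (tensor_rels R M N) in
     \<lparr>carrier = carrier G,
      monoid.mult = (\<lambda>X Y. pres_lift G
        (\<lambda>(x, y). pres_lift G (\<lambda>(x', y'). tens R M N (x \<otimes>\<^bsub>M\<^esub> x') (y \<otimes>\<^bsub>N\<^esub> y')) Y) X),
      one = tens R M N \<one>\<^bsub>M\<^esub> \<one>\<^bsub>N\<^esub>,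
      ring.zero = one G,
      ring.add = monoid.mult G,
      smult = (\<lambda>r. pres_lift G (\<lambda>(x, y). tens R M N (r \<odot>\<^bsub>M\<^esub> x) y))\<rparr>)"

text \<open>The additive map from a tensor product to \<open>P\<close> with \<open>x \<otimes> y \<mapsto> f x y\<close>, for balanced \<open>f\<close>.\<close>

definition tensor_lift ::
    "('p, 'z) ring_scheme \<Rightarrow> ('m \<Rightarrow> 'n \<Rightarrow> 'p) \<Rightarrow> ('m \<times> 'n \<Rightarrow>\<^sub>0 int) set \<Rightarrow> 'p"
  where "tensor_lift P f = pres_lift (add_monoid P) (\<lambda>(x, y). f x y)"

text \<open>\<open>f \<otimes> g\<close>, with values in \<open>M \<otimes>\<^sub>R N\<close>; the source need not be a tensor product over the same ring.\<close>

definition tensor_map ::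
    "('r, 'w) ring_scheme \<Rightarrow> ('r, 'm, 'y) module_scheme \<Rightarrow> ('r, 'n, 'z) module_scheme \<Rightarrow>
     ('a \<Rightarrow> 'm) \<Rightarrow> ('b \<Rightarrow> 'n) \<Rightarrow> ('a \<times> 'b \<Rightarrow>\<^sub>0 int) set \<Rightarrow> ('m \<times> 'n \<Rightarrow>\<^sub>0 int) set"
  where "tensor_map R M N f g = tensor_lift (tensor R M N) (\<lambda>x y. tens R M N (f x) (g y))"

text \<open>\<open>B \<otimes>\<^sub>R N\<close> for a ring map \<open>f : R \<rightarrow> B\<close>, as a \<open>B\<close>-module through the left factor.\<close>

definition extend_scalars ::
    "('r, 'w) ring_scheme \<Rightarrow> ('b, 'y) ring_scheme \<Rightarrow> ('r \<Rightarrow> 'b) \<Rightarrow> ('r, 'n, 'z) module_scheme \<Rightarrow>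
     ('b, ('b \<times> 'n \<Rightarrow>\<^sub>0 int) set) module"
  where "extend_scalars R B f N =
    with_smult (\<lambda>b. tensor_map R (ring_via f B) N (\<lambda>x. b \<otimes>\<^bsub>B\<^esub> x) (\<lambda>y. y)) (tensor R (ring_via f B) N)"


section \<open>Kaehler differentials\<close>

text \<open>The generator \<open>(u, v)\<close> stands for \<open>u dv\<close>.\<close>

definition kaehler_rels ::
    "('r, 'w) ring_scheme \<Rightarrow> ('r, 'b, 'z) module_scheme \<Rightarrow> ('b \<times> 'b \<Rightarrow>\<^sub>0 int) set"
  where "kaehler_rels R B =
    {frag_of (u \<oplus>\<^bsub>B\<^esub> u', v) - frag_of (u, v) - frag_of (u', v) | u u' v.
       u \<in> carrier B \<and> u' \<in> carrier B \<and> v \<in> carrier B} \<union>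
    {frag_of (u, v \<oplus>\<^bsub>B\<^esub> v') - frag_of (u, v) - frag_of (u, v') | u v v'.
       u \<in> carrier B \<and> v \<in> carrier B \<and> v' \<in> carrier B} \<union>
    {frag_of (u, r \<odot>\<^bsub>B\<^esub> v) - frag_of (r \<odot>\<^bsub>B\<^esub> u, v) | r u v.
       r \<in> carrier R \<and> u \<in> carrier B \<and> v \<in> carrier B} \<union>
    {frag_of (u, v \<otimes>\<^bsub>B\<^esub> w) - frag_of (u \<otimes>\<^bsub>B\<^esub> v, w) - frag_of (u \<otimes>\<^bsub>B\<^esub> w, v) | u v w.
       u \<in> carrier B \<and> v \<in> carrier B \<and> w \<in> carrier B}"

definition kaehler ::
    "('r, 'w) ring_scheme \<Rightarrow> ('r, 'b, 'z) module_scheme \<Rightarrow> ('b, ('b \<times> 'b \<Rightarrow>\<^sub>0 int) set) module"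
  where "kaehler R B =
    (let S = carrier B \<times> carrier B; G = pres_group S (kaehler_rels R B) in
     \<lparr>carrier = carrier G, monoid.mult = undefined, one = undefined, ring.zero = one G, ring.add = monoid.mult G,
      smult = (\<lambda>b. pres_lift G (\<lambda>(u, v). pres_gen S (kaehler_rels R B) (b \<otimes>\<^bsub>B\<^esub> u, v)))\<rparr>)"


section \<open>Commutative Hopf algebroids\<close>

record ('k, 'a, 'h) hopf_algebroid = "('k, 'h) module" +
  src :: "'a \<Rightarrow> 'h"
  tgt :: "'a \<Rightarrow> 'h"
  comult :: "'h \<Rightarrow> ('h \<times> 'h \<Rightarrow>\<^sub>0 int) set"
  counit :: "'h \<Rightarrow> 'a"
  antipode :: "'h \<Rightarrow> 'h"

definition src_module :: "('k, 'a, 'h, 'z) hopf_algebroid_scheme \<Rightarrow> ('a, 'h) module"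
  where "src_module H = ring_via (src H) H"

definition tgt_module :: "('k, 'a, 'h, 'z) hopf_algebroid_scheme \<Rightarrow> ('a, 'h) module"
  where "tgt_module H = ring_via (tgt H) H"

text \<open>
  \<open>\<H> \<otimes>\<^sub>A \<H>\<close> for the bimodule structure with left action through \<open>s\<close> and right action through
  \<open>t\<close>: the relation is \<open>u t(a) \<otimes> v = u \<otimes> s(a) v\<close>. The outer actions are
  \<open>a (u \<otimes> v) = s(a) u \<otimes> v\<close> and \<open>(u \<otimes> v) a = u \<otimes> v t(a)\<close>.
\<close>

definition tensor2 ::
    "('a, 'w) ring_scheme \<Rightarrow> ('k, 'a, 'h, 'z) hopf_algebroid_scheme \<Rightarrow> ('a, ('h \<times> 'h \<Rightarrow>\<^sub>0 int) set) module"
  where "tensor2 A H = tensor A (tgt_module H) (src_module H)"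

definition tensor2_left ::
    "('a, 'w) ring_scheme \<Rightarrow> ('k, 'a, 'h, 'z) hopf_algebroid_scheme \<Rightarrow> ('a, ('h \<times> 'h \<Rightarrow>\<^sub>0 int) set) module"
  where "tensor2_left A H = with_smult
    (\<lambda>a. tensor_map A (tgt_module H) (src_module H) (\<lambda>u. src H a \<otimes>\<^bsub>H\<^esub> u) (\<lambda>v. v)) (tensor2 A H)"

definition tensor2_right ::
    "('a, 'w) ring_scheme \<Rightarrow> ('k, 'a, 'h, 'z) hopf_algebroid_scheme \<Rightarrow> ('a, ('h \<times> 'h \<Rightarrow>\<^sub>0 int) set) module"
  where "tensor2_right A H = with_smult
    (\<lambda>a. tensor_map A (tgt_module H) (src_module H) (\<lambda>u. u) (\<lambda>v. v \<otimes>\<^bsub>H\<^esub> tgt H a)) (tensor2 A H)"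

text \<open>The \<open>k\<close>-algebra structure of \<open>\<H> \<otimes>\<^sub>A \<H>\<close>.\<close>

definition tensor2_base ::
    "('a, 'w) ring_scheme \<Rightarrow> ('k, 'a, 'h, 'z) hopf_algebroid_scheme \<Rightarrow> ('k, ('h \<times> 'h \<Rightarrow>\<^sub>0 int) set) module"
  where "tensor2_base A H = with_smult
    (\<lambda>c. tensor_map A (tgt_module H) (src_module H) (\<lambda>u. c \<odot>\<^bsub>H\<^esub> u) (\<lambda>v. v)) (tensor2 A H)"

text \<open>\<open>(\<H> \<otimes>\<^sub>A \<H>) \<otimes>\<^sub>A \<H> \<rightarrow> \<H> \<otimes>\<^sub>A (\<H> \<otimes>\<^sub>A \<H>)\<close>\<close>

definition tensor3_assoc ::
    "('a, 'w) ring_scheme \<Rightarrow> ('k, 'a, 'h, 'z) hopf_algebroid_scheme \<Rightarrow>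
     (('h \<times> 'h \<Rightarrow>\<^sub>0 int) set \<times> 'h \<Rightarrow>\<^sub>0 int) set \<Rightarrow> ('h \<times> ('h \<times> 'h \<Rightarrow>\<^sub>0 int) set \<Rightarrow>\<^sub>0 int) set"
  where "tensor3_assoc A H =
    (let T = tensor A (tgt_module H) (tensor2_left A H) in
     tensor_lift T (\<lambda>X w. tensor_lift T
       (\<lambda>u v. tens A (tgt_module H) (tensor2_left A H) u (tens A (tgt_module H) (src_module H) v w)) X))"

locale commutative_hopf_algebroid =
  fixes k :: "('k, 'w) ring_scheme"
    and A :: "('k, 'a, 'y) module_scheme"
    and H :: "('k, 'a, 'h, 'z) hopf_algebroid_scheme"
  assumes base_field: "field k"
    and base_algebra: "algebra k A"
    and total_algebra: "algebra k H"
    and src_hom: "src H \<in> alg_hom k A H"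
    and tgt_hom: "tgt H \<in> alg_hom k A H"
    and counit_hom: "counit H \<in> alg_hom k H A"
    and antipode_hom: "antipode H \<in> alg_hom k H H"
    and comult_hom: "comult H \<in> alg_hom k H (tensor2_base A H)"
    and comult_left:
      "\<lbrakk>a \<in> carrier A; u \<in> carrier H\<rbrakk> \<Longrightarrow>
        comult H (src H a \<otimes>\<^bsub>H\<^esub> u) = a \<odot>\<^bsub>tensor2_left A H\<^esub> comult H u"
    and comult_right:
      "\<lbrakk>a \<in> carrier A; u \<in> carrier H\<rbrakk> \<Longrightarrow>
        comult H (u \<otimes>\<^bsub>H\<^esub> tgt H a) = a \<odot>\<^bsub>tensor2_right A H\<^esub> comult H u"
    and counit_left:
      "\<lbrakk>a \<in> carrier A; u \<in> carrier H\<rbrakk> \<Longrightarrow> counit H (src H a \<otimes>\<^bsub>H\<^esub> u) = a \<otimes>\<^bsub>A\<^esub> counit H u"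
    and counit_right:
      "\<lbrakk>a \<in> carrier A; u \<in> carrier H\<rbrakk> \<Longrightarrow> counit H (u \<otimes>\<^bsub>H\<^esub> tgt H a) = counit H u \<otimes>\<^bsub>A\<^esub> a"
    and coassoc:
      "u \<in> carrier H \<Longrightarrow>
        tensor3_assoc A H
          (tensor_map A (tensor2_right A H) (src_module H) (comult H) (\<lambda>v. v) (comult H u)) =
        tensor_map A (tgt_module H) (tensor2_left A H) (\<lambda>v. v) (comult H) (comult H u)"
    and counit_l:
      "u \<in> carrier H \<Longrightarrow> tensor_lift H (\<lambda>v w. src H (counit H v) \<otimes>\<^bsub>H\<^esub> w) (comult H u) = u"
    and counit_r:
      "u \<in> carrier H \<Longrightarrow> tensor_lift H (\<lambda>v w. v \<otimes>\<^bsub>H\<^esub> tgt H (counit H w)) (comult H u) = u"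
    and antipode_src: "a \<in> carrier A \<Longrightarrow> antipode H (src H a) = tgt H a"
    and antipode_tgt: "a \<in> carrier A \<Longrightarrow> antipode H (tgt H a) = src H a"
    and antipode_invol: "u \<in> carrier H \<Longrightarrow> antipode H (antipode H u) = u"
    and antipode_l:
      "u \<in> carrier H \<Longrightarrow>
        tensor_lift H (\<lambda>v w. antipode H v \<otimes>\<^bsub>H\<^esub> w) (comult H u) = tgt H (counit H u)"
    and antipode_r:
      "u \<in> carrier H \<Longrightarrow>
        tensor_lift H (\<lambda>v w. v \<otimes>\<^bsub>H\<^esub> antipode H w) (comult H u) = src H (counit H u)"

text \<open>Morphisms that are the identity on the base algebra.\<close>

definition hopf_algebroid_hom ::
    "('k, 'w) ring_scheme \<Rightarrow> ('k, 'a, 'x) module_scheme \<Rightarrow> ('k, 'a, 'kk, 'y) hopf_algebroid_scheme \<Rightarrow>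
     ('k, 'a, 'h, 'z) hopf_algebroid_scheme \<Rightarrow> ('kk \<Rightarrow> 'h) set"
  where "hopf_algebroid_hom k A K H = {\<phi> \<in> alg_hom k K H.
    (\<forall>a\<in>carrier A. \<phi> (src K a) = src H a) \<and>
    (\<forall>a\<in>carrier A. \<phi> (tgt K a) = tgt H a) \<and>
    (\<forall>u\<in>carrier K. counit H (\<phi> u) = counit K u) \<and>
    (\<forall>u\<in>carrier K. comult H (\<phi> u) = tensor_map A (tgt_module H) (src_module H) \<phi> \<phi> (comult K u)) \<and>
    (\<forall>u\<in>carrier K. antipode H (\<phi> u) = \<phi> (antipode K u))}"


section \<open>Derivations\<close>

text \<open>
  The elements of \<open>carrier H \<rightarrow>\<^sub>E carrier M\<close> are the functions on \<open>carrier H\<close>, so equality of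
  derivations is equality on \<open>carrier H\<close>. The field acts on an \<open>\<H>\<close>-module through \<open>c \<mapsto> c 1\<close>.
\<close>

definition Der_s ::
    "('k, 'w) ring_scheme \<Rightarrow> ('k, 'a, 'y) module_scheme \<Rightarrow> ('k, 'a, 'h, 'z) hopf_algebroid_scheme \<Rightarrow>
     ('h, 'm, 'x) module_scheme \<Rightarrow> ('h \<Rightarrow> 'm) set"
  where "Der_s k A H M = {\<delta> \<in> carrier H \<rightarrow>\<^sub>E carrier M.
    (\<forall>u\<in>carrier H. \<forall>v\<in>carrier H. \<delta> (u \<oplus>\<^bsub>H\<^esub> v) = \<delta> u \<oplus>\<^bsub>M\<^esub> \<delta> v) \<and>
    (\<forall>c\<in>carrier k. \<forall>u\<in>carrier H. \<delta> (c \<odot>\<^bsub>H\<^esub> u) = (c \<odot>\<^bsub>H\<^esub> \<one>\<^bsub>H\<^esub>) \<odot>\<^bsub>M\<^esub> \<delta> u) \<and>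
    (\<forall>u\<in>carrier H. \<forall>v\<in>carrier H. \<delta> (u \<otimes>\<^bsub>H\<^esub> v) = u \<odot>\<^bsub>M\<^esub> \<delta> v \<oplus>\<^bsub>M\<^esub> v \<odot>\<^bsub>M\<^esub> \<delta> u) \<and>
    (\<forall>a\<in>carrier A. \<delta> (src H a) = \<zero>\<^bsub>M\<^esub>)}"

text \<open>
  The component of \<open>Der\<^sup>s(\<phi>, -)\<close> at \<open>M\<close>, \<open>\<delta> \<mapsto> \<delta> \<circ> \<phi>\<close>, is surjective. A formula cannot quantify
  over types, so ``every component'' is rendered by quantifying over the modules whose elements
  are in the type of \<open>\<H>\<close> and over those whose elements are in an arbitrary type (a free type
  variable). The first family contains \<open>\<H>\<close> itself.
\<close>

definition Der_s_surj ::
    "('k, 'w) ring_scheme \<Rightarrow> ('k, 'a, 'x) module_scheme \<Rightarrow> ('k, 'a, 'kk, 'y) hopf_algebroid_scheme \<Rightarrow>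
     ('k, 'a, 'h, 'z) hopf_algebroid_scheme \<Rightarrow> ('kk \<Rightarrow> 'h) \<Rightarrow> ('h, 'm, 'v) module_scheme \<Rightarrow> bool"
  where "Der_s_surj k A K H \<phi> M \<longleftrightarrow>
    (\<lambda>\<delta>. compose (carrier K) \<delta> \<phi>) ` Der_s k A H M = Der_s k A K (restrict_scalars \<phi> M)"

text \<open>\<open>\<L>(\<H>) = Der\<^sup>s(\<H>, A\<^sub>\<epsilon>)\<close>\<close>

definition LR ::
    "('k, 'w) ring_scheme \<Rightarrow> ('k, 'a, 'y) module_scheme \<Rightarrow> ('k, 'a, 'h, 'z) hopf_algebroid_scheme \<Rightarrow>
     ('h \<Rightarrow> 'a) set"
  where "LR k A H = Der_s k A H (ring_via (counit H) A)"

definition LR_map :: "('k, 'a, 'kk, 'y) hopf_algebroid_scheme \<Rightarrow> ('kk \<Rightarrow> 'h) \<Rightarrow> ('h \<Rightarrow> 'a) \<Rightarrow> 'kk \<Rightarrow> 'a"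
  where "LR_map K \<phi> \<delta> = compose (carrier K) \<delta> \<phi>"


section \<open>Indecomposables and differentials of a Hopf algebroid\<close>

definition aug_ideal ::
    "('k, 'a, 'y) module_scheme \<Rightarrow> ('k, 'a, 'h, 'z) hopf_algebroid_scheme \<Rightarrow> 'h set"
  where "aug_ideal A H = a_kernel H A (counit H)"

definition aug_ideal_sq ::
    "('k, 'a, 'y) module_scheme \<Rightarrow> ('k, 'a, 'h, 'z) hopf_algebroid_scheme \<Rightarrow> 'h set"
  where "aug_ideal_sq A H = aug_ideal A H \<cdot>\<^bsub>H\<^esub> aug_ideal A H"

text \<open>\<open>\<I>/\<I>\<^sup>2\<close> as the ideal of \<open>\<H>/\<I>\<^sup>2\<close> formed by the cosets of the elements of \<open>\<I>\<close>.\<close>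

definition Q_module ::
    "('k, 'a, 'y) module_scheme \<Rightarrow> ('k, 'a, 'h, 'z) hopf_algebroid_scheme \<Rightarrow> ('a, 'h set) module"
  where "Q_module A H =
    (let J = aug_ideal_sq A H in
     with_smult (\<lambda>a X. (J +>\<^bsub>H\<^esub> src H a) \<otimes>\<^bsub>H Quot J\<^esub> X)
       ((H Quot J)\<lparr>carrier := (\<lambda>u. J +>\<^bsub>H\<^esub> u) ` aug_ideal A H\<rparr>))"

definition Q_proj ::
    "('k, 'a, 'y) module_scheme \<Rightarrow> ('k, 'a, 'h, 'z) hopf_algebroid_scheme \<Rightarrow> 'h \<Rightarrow> 'h set"
  where "Q_proj A H u = aug_ideal_sq A H +>\<^bsub>H\<^esub> (u \<ominus>\<^bsub>H\<^esub> src H (counit H u))"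

text \<open>Since \<open>\<pi>\<^sup>s\<close> is onto, \<open>Q(\<phi>) \<circ> \<pi>\<^sup>s = \<pi>\<^sup>s \<circ> \<phi>\<close> determines \<open>Q(\<phi>)\<close>.\<close>

definition Q_map ::
    "('k, 'a, 'x) module_scheme \<Rightarrow> ('k, 'a, 'kk, 'y) hopf_algebroid_scheme \<Rightarrow>
     ('k, 'a, 'h, 'z) hopf_algebroid_scheme \<Rightarrow> ('kk \<Rightarrow> 'h) \<Rightarrow> 'kk set \<Rightarrow> 'h set"
  where "Q_map A K H \<phi> X = Q_proj A H (\<phi> (inv_into (carrier K) (Q_proj A K) X))"

definition Omega_s ::
    "('k, 'a, 'y) module_scheme \<Rightarrow> ('k, 'a, 'h, 'z) hopf_algebroid_scheme \<Rightarrow>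
     ('h, ('h \<times> 'h \<Rightarrow>\<^sub>0 int) set) module"
  where "Omega_s A H = kaehler A (src_module H)"

text \<open>\<open>\<^sub>s\<H>\<^sub>t \<otimes>\<^sub>A Q(\<H>)\<close>, with \<open>\<H>\<close> acting on the left factor\<close>

definition tensor_Q ::
    "('k, 'a, 'y) module_scheme \<Rightarrow> ('k, 'a, 'h, 'z) hopf_algebroid_scheme \<Rightarrow>
     ('h, ('h \<times> 'h set \<Rightarrow>\<^sub>0 int) set) module"
  where "tensor_Q A H = extend_scalars A H (tgt H) (Q_module A H)"

text \<open>The canonical isomorphism from \<open>\<Omega>\<^sup>s(\<H>)\<close> to \<open>\<^sub>s\<H>\<^sub>t \<otimes>\<^sub>A Q(\<H>)\<close>, \<open>u dv \<mapsto> u (v\<^sub>1 \<otimes> \<pi>\<^sup>s v\<^sub>2)\<close>.\<close>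

definition Omega_iso ::
    "('k, 'a, 'y) module_scheme \<Rightarrow> ('k, 'a, 'h, 'z) hopf_algebroid_scheme \<Rightarrow>
     ('h \<times> 'h \<Rightarrow>\<^sub>0 int) set \<Rightarrow> ('h \<times> 'h set \<Rightarrow>\<^sub>0 int) set"
  where "Omega_iso A H = pres_lift (add_monoid (tensor_Q A H))
    (\<lambda>(u, v). u \<odot>\<^bsub>tensor_Q A H\<^esub>
      tensor_map A (tgt_module H) (Q_module A H) (\<lambda>w. w) (Q_proj A H) (comult H v))"

text \<open>The map that corresponds to \<open>\<phi> \<otimes>\<^sub>A Q(\<phi>)\<close> under the canonical isomorphisms.\<close>

definition Omega_map ::
    "('k, 'a, 'x) module_scheme \<Rightarrow> ('k, 'a, 'kk, 'y) hopf_algebroid_scheme \<Rightarrow>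
     ('k, 'a, 'h, 'z) hopf_algebroid_scheme \<Rightarrow> ('kk \<Rightarrow> 'h) \<Rightarrow>
     ('kk \<times> 'kk \<Rightarrow>\<^sub>0 int) set \<Rightarrow> ('h \<times> 'h \<Rightarrow>\<^sub>0 int) set"
  where "Omega_map A K H \<phi> w =
    inv_into (carrier (Omega_s A H)) (Omega_iso A H)
      (tensor_map A (tgt_module H) (Q_module A H) \<phi> (Q_map A K H \<phi>) (Omega_iso A K w))"

text \<open>\<open>\<H> \<otimes>\<^sub>\<K> \<Omega>\<^sup>s(\<K>) \<rightarrow> \<Omega>\<^sup>s(\<H>)\<close>, \<open>h \<otimes> w \<mapsto> h \<Omega>\<^sup>s(\<phi>)(w)\<close>\<close>

definition Omega_ext_map ::
    "('k, 'a, 'x) module_scheme \<Rightarrow> ('k, 'a, 'kk, 'y) hopf_algebroid_scheme \<Rightarrow>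
     ('k, 'a, 'h, 'z) hopf_algebroid_scheme \<Rightarrow> ('kk \<Rightarrow> 'h) \<Rightarrow>
     ('h \<times> ('kk \<times> 'kk \<Rightarrow>\<^sub>0 int) set \<Rightarrow>\<^sub>0 int) set \<Rightarrow> ('h \<times> 'h \<Rightarrow>\<^sub>0 int) set"
  where "Omega_ext_map A K H \<phi> =
    tensor_lift (Omega_s A H) (\<lambda>h w. h \<odot>\<^bsub>Omega_s A H\<^esub> Omega_map A K H \<phi> w)"

end

theory Submission
  imports Defs
begin

text \<open>
  The theorem rests on one correspondence. Write \<open>u\<^sub>1 \<otimes> u\<^sub>2\<close> for \<open>\<Delta>(u)\<close> and \<open>\<pi>\<close> for \<open>\<pi>\<^sup>s\<close>. For an
  \<open>\<H>\<close>-module \<open>M\<close>, an \<open>A\<close>-linear map \<open>f : Q(\<H>) \<rightarrow> M\<close>, with \<open>A\<close> acting on \<open>M\<close> through \<open>t\<close>, gives the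
  derivation \<open>\<delta>(u) = u\<^sub>1 f(\<pi> u\<^sub>2)\<close>, which kills \<open>s(A)\<close> (\<open>s_derivation_of_Q_hom\<close>); conversely every
  such \<open>\<delta>\<close> arises from \<open>f(\<pi> u) = S(u\<^sub>1) \<delta>(u\<^sub>2)\<close> (\<open>Q_hom_of_s_derivation\<close>). This is the analogue for
  groupoids of translating a vector field to the units and back. Since \<open>\<phi>\<close> respects \<open>\<Delta>\<close>, composing
  \<open>\<delta>\<close> with \<open>\<phi>\<close> amounts to composing \<open>f\<close> with \<open>Q(\<phi>)\<close>.

  If \<open>g\<close> is a retraction of \<open>Q(\<phi>)\<close>, then a derivation of \<open>\<K>\<close> that corresponds to \<open>f\<close> is therefore the
  restriction of the derivation of \<open>\<H>\<close> that corresponds to \<open>f \<circ> g\<close>. Hence (a) implies (c), and (d) is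
  an instance of (c). For (d) implies (b), observe that \<open>\<L>(\<K>)\<close> consists of the maps \<open>f \<circ> \<pi>\<close> with \<open>f\<close> a
  linear form on \<open>Q(\<K>)\<close>. The derivation \<open>v \<mapsto> \<phi>(v\<^sub>1) t(f(\<pi> v\<^sub>2))\<close> of \<open>\<K>\<close> into \<open>\<H>\<close> lifts by (d), and \<open>\<epsilon>\<close>
  composed with the lift is an element of \<open>\<L>(\<H>)\<close> that restricts to \<open>f \<circ> \<pi>\<close>. Finally (b) says that
  every linear form on \<open>Q(\<K>)\<close> factors through \<open>Q(\<phi>)\<close>; factoring the coordinate forms of a finite dual
  basis of \<open>Q(\<K>)\<close> and recombining them gives a retraction, which is (a).

  For (e), the correspondence for the universal derivation yields a left inverse of the canonical map
  \<open>\<Omega>\<^sup>s(\<H>) \<rightarrow> \<H> \<otimes>\<^sub>A Q(\<H>)\<close> (\<open>Omega_iso_inj\<close>), so that \<open>\<Omega>\<^sup>s(\<phi>)\<close> is the map \<open>u dv \<mapsto> \<phi>(u) d\<phi>(v)\<close>. Derivations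
  are linear maps out of the differentials. If (c) holds, then the derivation \<open>v \<mapsto> 1 \<otimes> dv\<close> of \<open>\<K>\<close> into
  \<open>\<H> \<otimes>\<^sub>\<K> \<Omega>\<^sup>s(\<K>)\<close> extends to \<open>\<H>\<close>, and the linear map on \<open>\<Omega>\<^sup>s(\<H>)\<close> that it defines is a retraction.
  Conversely a retraction extends all derivations of \<open>\<K>\<close>, because it extends the universal one.
\<close>

section \<open>Abelian groups given by generators and relations\<close>

text \<open>
  The homomorphism from the free abelian group that \<open>pres_lift\<close> applies to the members of a coset.
\<close>

definition free_ext :: "('g, 'z) monoid_scheme \<Rightarrow> ('x \<Rightarrow> 'g) \<Rightarrow> ('x \<Rightarrow>\<^sub>0 int) \<Rightarrow> 'g"
  where "free_ext G f c = (\<Otimes>\<^bsub>G\<^esub>x\<in>Poly_Mapping.keys c. f x [^]\<^bsub>G\<^esub> Poly_Mapping.lookup c x)"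

lemma free_ext_hom:
  fixes G (structure)
  assumes "comm_group G" and f: "f \<in> S \<rightarrow> carrier G"
  shows "free_ext G f \<in> hom (free_Abelian_group S) G"
proof -
  interpret comm_group G by fact
  have ext: "free_ext G f c = (\<Otimes>x\<in>T. f x [^] Poly_Mapping.lookup c x)"
    if "Poly_Mapping.keys c \<subseteq> T" "T \<subseteq> S" "finite T" for c T
    unfolding free_ext_def
    by (rule finprod_mono_neutral_cong_left) (use that f in \<open>auto simp: in_keys_iff Pi_iff\<close>)
  show ?thesis
  proof (rule homI)
    fix c assume "c \<in> carrier (free_Abelian_group S)"
    then show "free_ext G f c \<in> carrier G"
      unfolding free_ext_def using f by (auto intro!: finprod_closed int_pow_closed)
  next
    fix c d assume c: "c \<in> carrier (free_Abelian_group S)" and d: "d \<in> carrier (free_Abelian_group S)"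
    let ?T = "Poly_Mapping.keys c \<union> Poly_Mapping.keys d"
    have T: "?T \<subseteq> S" "finite ?T" using c d by auto
    have fT: "f x \<in> carrier G" if "x \<in> ?T" for x using that T f by auto
    have "free_ext G f (c + d) = (\<Otimes>x\<in>?T. f x [^] Poly_Mapping.lookup (c + d) x)"
      by (rule ext) (use T keys_add[of c d] in auto)
    also have "\<dots> = (\<Otimes>x\<in>?T. f x [^] Poly_Mapping.lookup c x \<otimes> f x [^] Poly_Mapping.lookup d x)"
      by (rule finprod_cong') (use fT in \<open>auto simp: lookup_add int_pow_mult\<close>)
    also have "\<dots> = (\<Otimes>x\<in>?T. f x [^] Poly_Mapping.lookup c x) \<otimes> (\<Otimes>x\<in>?T. f x [^] Poly_Mapping.lookup d x)"
      by (rule finprod_multf) (use fT in auto)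
    also have "\<dots> = free_ext G f c \<otimes> free_ext G f d"
      using ext[of c ?T] ext[of d ?T] T by simp
    finally show "free_ext G f (c \<otimes>\<^bsub>free_Abelian_group S\<^esub> d) = free_ext G f c \<otimes> free_ext G f d"
      by simp
  qed
qed

lemma free_ext_frag_of:
  assumes "comm_group G" "f x \<in> carrier G"
  shows "free_ext G f (frag_of x) = f x"
proof -
  interpret comm_group G by fact
  show ?thesis using assms(2) by (simp add: free_ext_def)
qed

lemma free_ext_diff:
  assumes "comm_group G" "f \<in> S \<rightarrow> carrier G" "Poly_Mapping.keys c \<subseteq> S" "Poly_Mapping.keys d \<subseteq> S"
  shows "free_ext G f (c - d) = free_ext G f c \<otimes>\<^bsub>G\<^esub> inv\<^bsub>G\<^esub> free_ext G f d"
proof -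
  interpret group_hom "free_Abelian_group S" G "free_ext G f"
    using free_ext_hom[OF assms(1,2)] assms(1)
    by (simp add: group_hom_def group_hom_axioms_def comm_group.axioms)
  have "free_ext G f (c \<otimes>\<^bsub>free_Abelian_group S\<^esub> inv\<^bsub>free_Abelian_group S\<^esub> d) =
      free_ext G f c \<otimes>\<^bsub>G\<^esub> inv\<^bsub>G\<^esub> free_ext G f d"
    using assms(3,4) G.inv_closed[of d]
    by (subst hom_mult) (simp_all del: inv_free_Abelian_group carrier_free_Abelian_group_iff
        add: carrier_free_Abelian_group_iff[symmetric])
  then show ?thesis using assms(4) by simp
qed

lemma free_ext_rel3:
  fixes G (structure)
  assumes "comm_group G" "f \<in> S \<rightarrow> carrier G" "a \<in> S" "b \<in> S" "c \<in> S"
    "f a = f b \<otimes>\<^bsub>G\<^esub> f c"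
  shows "free_ext G f (frag_of a - frag_of b - frag_of c) = \<one>\<^bsub>G\<^esub>"
proof -
  interpret comm_group G by fact
  have [simp]: "f b \<in> carrier G" "f c \<in> carrier G" using assms by auto
  have "Poly_Mapping.keys (frag_of a - frag_of b) \<subseteq> S"
    using keys_diff[of "frag_of a" "frag_of b"] assms by auto
  then have "free_ext G f (frag_of a - frag_of b - frag_of c) = f b \<otimes> f c \<otimes> inv f b \<otimes> inv f c"
    using assms by (simp add: free_ext_diff[where S = S] free_ext_frag_of Pi_iff)
  also have "f b \<otimes> f c \<otimes> inv f b = f c"
    using m_comm[of "f b" "f c"] by (simp add: m_assoc)
  finally show ?thesis by simp
qed

lemma free_ext_rel2:
  assumes "comm_group G" "f \<in> S \<rightarrow> carrier G" "a \<in> S" "b \<in> S" "f a = f b"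
  shows "free_ext G f (frag_of a - frag_of b) = \<one>\<^bsub>G\<^esub>"
proof -
  interpret comm_group G by fact
  show ?thesis using assms by (simp add: free_ext_diff[where S = S] free_ext_frag_of Pi_iff)
qed

lemma frag_of_diff_closed:
  "a \<in> S \<Longrightarrow> b \<in> S \<Longrightarrow> frag_of a - frag_of b \<in> carrier (free_Abelian_group S)"
  using keys_diff[of "frag_of a" "frag_of b"] by auto

lemma frag_of_diff2_closed:
  "a \<in> S \<Longrightarrow> b \<in> S \<Longrightarrow> c \<in> S \<Longrightarrow> frag_of a - frag_of b - frag_of c \<in> carrier (free_Abelian_group S)"
  using keys_diff[of "frag_of a - frag_of b" "frag_of c"] keys_diff[of "frag_of a" "frag_of b"] by auto

locale presentation =
  fixes S :: "'x set" and rels :: "('x \<Rightarrow>\<^sub>0 int) set"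
  assumes rels_carrier: "rels \<subseteq> carrier (free_Abelian_group S)"
begin

sublocale F: comm_group "free_Abelian_group S"
  by (rule abelian_free_Abelian_group)

sublocale N: normal "pres_rel S rels" "free_Abelian_group S"
  unfolding pres_rel_def
  using F.generate_is_subgroup[OF rels_carrier] F.normal_iff_subgroup by blast

lemma pres_group_comm_group: "comm_group (pres_group S rels)"
  unfolding pres_group_def by (rule F.abelian_FactGroup) (rule N.subgroup_axioms)

lemma pres_gen_closed: "x \<in> S \<Longrightarrow> pres_gen S rels x \<in> carrier (pres_group S rels)"
  unfolding pres_gen_def pres_group_def FactGroup_def RCOSETS_def by auto

text \<open>
  The relations, and hence the subgroup that they generate, lie in the kernel of \<open>free_ext G f\<close>, so
  this homomorphism is constant on cosets and \<open>the_elem\<close> picks its value.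
\<close>

lemma pres_lift_coset:
  assumes G: "comm_group G" and f: "f \<in> S \<rightarrow> carrier G"
    and rels: "\<And>c. c \<in> rels \<Longrightarrow> free_ext G f c = \<one>\<^bsub>G\<^esub>"
    and c: "c \<in> carrier (free_Abelian_group S)"
  shows "pres_lift G f (pres_rel S rels #>\<^bsub>free_Abelian_group S\<^esub> c) = free_ext G f c"
proof -
  interpret G: comm_group G by fact
  interpret group_hom "free_Abelian_group S" G "free_ext G f"
    using free_ext_hom[OF G f]
    by (simp add: group_hom_def group_hom_axioms_def G.is_group)
  have one: "free_ext G f n = \<one>\<^bsub>G\<^esub>" if "n \<in> pres_rel S rels" for n
  proof -
    have "pres_rel S rels \<subseteq> kernel (free_Abelian_group S) G (free_ext G f)"
      unfolding pres_rel_def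
      by (rule F.generate_subgroup_incl[OF _ subgroup_kernel])
        (use rels rels_carrier in \<open>auto simp: kernel_def simp del: carrier_free_Abelian_group_iff\<close>)
    then show ?thesis using that by (auto simp: kernel_def)
  qed
  have eq: "free_ext G f d = free_ext G f c"
    if "d \<in> pres_rel S rels #>\<^bsub>free_Abelian_group S\<^esub> c" for d
  proof -
    obtain n where n: "n \<in> pres_rel S rels" "d = n \<otimes>\<^bsub>free_Abelian_group S\<^esub> c"
      using \<open>d \<in> _\<close> unfolding r_coset_def by auto
    then have "free_ext G f d = free_ext G f n \<otimes>\<^bsub>G\<^esub> free_ext G f c"
      using hom_mult[OF N.mem_carrier[OF n(1)] c] by simp
    then show ?thesis using one[OF n(1)] c hom_closed[OF c] by simp
  qed
  have "free_ext G f ` (pres_rel S rels #>\<^bsub>free_Abelian_group S\<^esub> c) = {free_ext G f c}"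
    using eq F.rcos_self[OF c N.subgroup_axioms] by blast
  then show ?thesis unfolding pres_lift_def free_ext_def[abs_def] by simp
qed

lemma pres_lift_hom:
  assumes "comm_group G" "f \<in> S \<rightarrow> carrier G" "\<And>c. c \<in> rels \<Longrightarrow> free_ext G f c = \<one>\<^bsub>G\<^esub>"
  shows "pres_lift G f \<in> hom (pres_group S rels) G"
proof (rule homI)
  fix X assume "X \<in> carrier (pres_group S rels)"
  then obtain c where c: "c \<in> carrier (free_Abelian_group S)" "X = pres_rel S rels #>\<^bsub>free_Abelian_group S\<^esub> c"
    unfolding pres_group_def FactGroup_def RCOSETS_def by auto
  show "pres_lift G f X \<in> carrier G"
    using hom_in_carrier[OF free_ext_hom[OF assms(1,2)] c(1)] by (simp add: c(2) pres_lift_coset[OF assms c(1)])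
next
  fix X Y assume "X \<in> carrier (pres_group S rels)" "Y \<in> carrier (pres_group S rels)"
  then obtain c d where c: "c \<in> carrier (free_Abelian_group S)" "X = pres_rel S rels #>\<^bsub>free_Abelian_group S\<^esub> c"
    and d: "d \<in> carrier (free_Abelian_group S)" "Y = pres_rel S rels #>\<^bsub>free_Abelian_group S\<^esub> d"
    unfolding pres_group_def FactGroup_def RCOSETS_def by auto
  have "X \<otimes>\<^bsub>pres_group S rels\<^esub> Y = pres_rel S rels #>\<^bsub>free_Abelian_group S\<^esub> (c \<otimes>\<^bsub>free_Abelian_group S\<^esub> d)"
    unfolding pres_group_def c(2) d(2) using N.rcos_sum[OF c(1) d(1)] by (simp add: FactGroup_def)
  then show "pres_lift G f (X \<otimes>\<^bsub>pres_group S rels\<^esub> Y) = pres_lift G f X \<otimes>\<^bsub>G\<^esub> pres_lift G f Y"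
    using pres_lift_coset[OF assms c(1)] pres_lift_coset[OF assms d(1)]
      pres_lift_coset[OF assms F.m_closed[OF c(1) d(1)]] c d hom_mult[OF free_ext_hom[OF assms(1,2)] c(1) d(1)]
    by simp
qed

lemma pres_lift_gen:
  assumes "comm_group G" "f \<in> S \<rightarrow> carrier G" "\<And>c. c \<in> rels \<Longrightarrow> free_ext G f c = \<one>\<^bsub>G\<^esub>" "x \<in> S"
  shows "pres_lift G f (pres_gen S rels x) = f x"
  unfolding pres_gen_def using assms
  by (subst pres_lift_coset) (auto simp: free_ext_frag_of Pi_iff)

text \<open>
  The quotient map is itself the free extension of the generators. This is why the relations hold
  between the generators of the quotient.
\<close>

lemma pres_gen_free_ext:
  assumes c: "c \<in> carrier (free_Abelian_group S)"
  shows "free_ext (pres_group S rels) (pres_gen S rels) c = pres_rel S rels #>\<^bsub>free_Abelian_group S\<^esub> c"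
proof -
  interpret P: comm_group "pres_group S rels" by (rule pres_group_comm_group)
  have gens: "pres_gen S rels \<in> S \<rightarrow> carrier (pres_group S rels)" using pres_gen_closed by auto
  interpret cos: group_hom "free_Abelian_group S" "pres_group S rels" "\<lambda>c. pres_rel S rels #>\<^bsub>free_Abelian_group S\<^esub> c"
    using N.r_coset_hom_Mod P.is_group by (simp add: group_hom_def group_hom_axioms_def pres_group_def)
  interpret ext: group_hom "free_Abelian_group S" "pres_group S rels" "free_ext (pres_group S rels) (pres_gen S rels)"
    using free_ext_hom[OF pres_group_comm_group gens] by (simp add: group_hom_def group_hom_axioms_def P.is_group)
  have "Poly_Mapping.keys c \<subseteq> S" using c by simp
  then show ?thesis
  proof (rule free_Abelian_group_induct)
    show "free_ext (pres_group S rels) (pres_gen S rels) 0 = pres_rel S rels #>\<^bsub>free_Abelian_group S\<^esub> 0"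
      using ext.hom_one cos.hom_one by simp
  next
    fix x y assume 2: "Poly_Mapping.keys x \<subseteq> S" "Poly_Mapping.keys y \<subseteq> S"
      "free_ext (pres_group S rels) (pres_gen S rels) x = pres_rel S rels #>\<^bsub>free_Abelian_group S\<^esub> x"
      "free_ext (pres_group S rels) (pres_gen S rels) y = pres_rel S rels #>\<^bsub>free_Abelian_group S\<^esub> y"
    have "pres_rel S rels #>\<^bsub>free_Abelian_group S\<^esub> (x - y) =
      pres_rel S rels #>\<^bsub>free_Abelian_group S\<^esub> (x \<otimes>\<^bsub>free_Abelian_group S\<^esub> inv\<^bsub>free_Abelian_group S\<^esub> y)"
      using 2 by simp
    also have "\<dots> = (pres_rel S rels #>\<^bsub>free_Abelian_group S\<^esub> x) \<otimes>\<^bsub>pres_group S rels\<^esub>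
        inv\<^bsub>pres_group S rels\<^esub> (pres_rel S rels #>\<^bsub>free_Abelian_group S\<^esub> y)"
      using 2(1,2) F.inv_closed[of y]
      by (subst cos.hom_mult) (simp_all del: inv_free_Abelian_group carrier_free_Abelian_group_iff
        add: carrier_free_Abelian_group_iff[symmetric])
    finally show "free_ext (pres_group S rels) (pres_gen S rels) (x - y) = pres_rel S rels #>\<^bsub>free_Abelian_group S\<^esub> (x - y)" using 2 by (simp add: free_ext_diff[OF pres_group_comm_group gens])
  next
    fix a assume 3: "a \<in> S"
    then show "free_ext (pres_group S rels) (pres_gen S rels) (frag_of a) =
        pres_rel S rels #>\<^bsub>free_Abelian_group S\<^esub> (frag_of a)"
      using free_ext_frag_of[where x = a and f = "pres_gen S rels", OF pres_group_comm_group pres_gen_closed[OF 3]]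
      by (simp add: pres_gen_def)
  qed
qed

lemma pres_gen_rel:
  assumes "c \<in> rels"
  shows "free_ext (pres_group S rels) (pres_gen S rels) c = \<one>\<^bsub>pres_group S rels\<^esub>"
proof -
  have "c \<in> pres_rel S rels" unfolding pres_rel_def using assms by (rule generate.incl)
  moreover have "c \<in> carrier (free_Abelian_group S)" using assms rels_carrier by blast
  ultimately show ?thesis
    using pres_gen_free_ext F.coset_join2[OF _ N.subgroup_axioms] by (simp add: pres_group_def FactGroup_def)
qed

lemma pres_gen_rel3:
  assumes "frag_of a - frag_of b - frag_of c \<in> rels" "a \<in> S" "b \<in> S" "c \<in> S"
  shows "pres_gen S rels a = pres_gen S rels b \<otimes>\<^bsub>pres_group S rels\<^esub> pres_gen S rels c"
proof -
  interpret P: comm_group "pres_group S rels" by (rule pres_group_comm_group)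
  have gens: "pres_gen S rels \<in> S \<rightarrow> carrier (pres_group S rels)" using pres_gen_closed by auto
  note [simp] = pres_gen_closed
  have "Poly_Mapping.keys (frag_of a - frag_of b) \<subseteq> S"
    using keys_diff[of "frag_of a" "frag_of b"] assms by auto
  then have "pres_gen S rels a \<otimes>\<^bsub>pres_group S rels\<^esub> inv\<^bsub>pres_group S rels\<^esub> pres_gen S rels b
      \<otimes>\<^bsub>pres_group S rels\<^esub> inv\<^bsub>pres_group S rels\<^esub> pres_gen S rels c = \<one>\<^bsub>pres_group S rels\<^esub>"
    using pres_gen_rel[OF assms(1)] assms(2-)
    by (simp add: free_ext_diff[OF P.comm_group_axioms gens] free_ext_frag_of[OF P.comm_group_axioms])
  then have "pres_gen S rels c = pres_gen S rels a \<otimes>\<^bsub>pres_group S rels\<^esub> inv\<^bsub>pres_group S rels\<^esub> pres_gen S rels b"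
    using assms(2-) by (subst (asm) P.inv_solve_right') auto
  then have "pres_gen S rels a = pres_gen S rels c \<otimes>\<^bsub>pres_group S rels\<^esub> pres_gen S rels b"
    using assms(2-) by (subst (asm) P.inv_solve_right) auto
  then show ?thesis using assms(2-) P.m_comm by simp
qed

lemma pres_gen_rel2:
  assumes "frag_of a - frag_of b \<in> rels" "a \<in> S" "b \<in> S"
  shows "pres_gen S rels a = pres_gen S rels b"
proof -
  interpret P: comm_group "pres_group S rels" by (rule pres_group_comm_group)
  have gens: "pres_gen S rels \<in> S \<rightarrow> carrier (pres_group S rels)" using pres_gen_closed by auto
  note [simp] = pres_gen_closed
  have "pres_gen S rels a \<otimes>\<^bsub>pres_group S rels\<^esub> inv\<^bsub>pres_group S rels\<^esub> pres_gen S rels b = \<one>\<^bsub>pres_group S rels\<^esub>"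
    using pres_gen_rel[OF assms(1)] assms(2-)
    by (simp add: free_ext_diff[OF P.comm_group_axioms gens] free_ext_frag_of[OF P.comm_group_axioms])
  then show ?thesis using assms(2-)
    by (simp add: P.inv_solve_right')
qed

text \<open>
  Closure under differences is phrased without subtraction: if \<open>X \<cdot> Y\<close> and \<open>Y\<close> have the property, so
  has \<open>X\<close>. The form suits equations between homomorphisms, where it is cancellation.
\<close>

lemma pres_induct:
  assumes X: "X \<in> carrier (pres_group S rels)"
    and one: "P \<one>\<^bsub>pres_group S rels\<^esub>"
    and gens: "\<And>x. x \<in> S \<Longrightarrow> P (pres_gen S rels x)"
    and diff: "\<And>X Y. \<lbrakk>X \<in> carrier (pres_group S rels); Y \<in> carrier (pres_group S rels);
      P (X \<otimes>\<^bsub>pres_group S rels\<^esub> Y); P Y\<rbrakk> \<Longrightarrow> P X"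
  shows "P X"
proof -
  interpret P: comm_group "pres_group S rels" by (rule pres_group_comm_group)
  let ?c = "\<lambda>c. pres_rel S rels #>\<^bsub>free_Abelian_group S\<^esub> c"
  interpret cos: group_hom "free_Abelian_group S" "pres_group S rels" ?c
    using N.r_coset_hom_Mod P.is_group by (simp add: group_hom_def group_hom_axioms_def pres_group_def)
  obtain c where c: "c \<in> carrier (free_Abelian_group S)" "X = ?c c"
    using X unfolding pres_group_def FactGroup_def RCOSETS_def by auto
  have "Poly_Mapping.keys c \<subseteq> S" using c by simp
  then have "P (?c c)"
  proof (rule free_Abelian_group_induct)
    show "P (?c 0)" using one cos.hom_one by simp
  next
    fix x y assume 2: "Poly_Mapping.keys x \<subseteq> S" "Poly_Mapping.keys y \<subseteq> S" "P (?c x)" "P (?c y)"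
    have xy: "Poly_Mapping.keys (x - y) \<subseteq> S" using keys_diff[of x y] 2 by auto
    have "?c x = ?c (x - y) \<otimes>\<^bsub>pres_group S rels\<^esub> ?c y"
      using cos.hom_mult[of "x - y" y] 2 xy by simp
    then show "P (?c (x - y))"
      using diff[of "?c (x - y)" "?c y"] 2 xy cos.hom_closed[of y] cos.hom_closed[of "x - y"] by simp
  next
    fix a assume "a \<in> S"
    then show "P (?c (frag_of a))" using gens[of a] by (simp add: pres_gen_def)
  qed
  then show ?thesis using c(2) by simp
qed

end

section \<open>Additive maps and modules\<close>

definition add_hom :: "('m, 'y) ring_scheme \<Rightarrow> ('n, 'z) ring_scheme \<Rightarrow> ('m \<Rightarrow> 'n) set"
  where "add_hom M N = {f \<in> carrier M \<rightarrow> carrier N.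
    \<forall>x\<in>carrier M. \<forall>y\<in>carrier M. f (x \<oplus>\<^bsub>M\<^esub> y) = f x \<oplus>\<^bsub>N\<^esub> f y}"

text \<open>
  The smallest set that contains \<open>0\<close> and \<open>G\<close> and is closed under differences is \<open>M\<close>. Only the fields
  \<open>carrier\<close>, \<open>zero\<close> and \<open>add\<close> occur, so the notion does not depend on the record that carries them.
\<close>

definition add_generated :: "('m, 'y) ring_scheme \<Rightarrow> 'm set \<Rightarrow> bool"
  where "add_generated M G \<longleftrightarrow> (\<forall>U. \<zero>\<^bsub>M\<^esub> \<in> U \<longrightarrow> G \<subseteq> U \<longrightarrow>
    (\<forall>x\<in>carrier M. \<forall>y\<in>carrier M. x \<oplus>\<^bsub>M\<^esub> y \<in> U \<longrightarrow> y \<in> U \<longrightarrow> x \<in> U) \<longrightarrow> carrier M \<subseteq> U)"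

lemma add_homI:
  "\<lbrakk>\<And>x. x \<in> carrier M \<Longrightarrow> f x \<in> carrier N;
    \<And>x y. \<lbrakk>x \<in> carrier M; y \<in> carrier M\<rbrakk> \<Longrightarrow> f (x \<oplus>\<^bsub>M\<^esub> y) = f x \<oplus>\<^bsub>N\<^esub> f y\<rbrakk> \<Longrightarrow> f \<in> add_hom M N"
  by (simp add: add_hom_def)

lemma add_hom_closed: "f \<in> add_hom M N \<Longrightarrow> x \<in> carrier M \<Longrightarrow> f x \<in> carrier N"
  and add_hom_add: "f \<in> add_hom M N \<Longrightarrow> x \<in> carrier M \<Longrightarrow> y \<in> carrier M \<Longrightarrow> f (x \<oplus>\<^bsub>M\<^esub> y) = f x \<oplus>\<^bsub>N\<^esub> f y"
  by (auto simp: add_hom_def)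

lemma add_hom_compose:
  "f \<in> add_hom M N \<Longrightarrow> g \<in> add_hom N P \<Longrightarrow> (\<lambda>x. g (f x)) \<in> add_hom M P"
  by (auto simp: add_hom_def Pi_iff)

lemma add_hom_ident: "(\<lambda>x. x) \<in> add_hom M M"
  by (simp add: add_hom_def)

lemma add_hom_sum:
  assumes "abelian_group N" "f \<in> add_hom M N" "g \<in> add_hom M N"
  shows "(\<lambda>x. f x \<oplus>\<^bsub>N\<^esub> g x) \<in> add_hom M N"
proof -
  interpret abelian_group N by fact
  show ?thesis using assms(2,3) by (auto simp: add_hom_def Pi_iff a_ac)
qed

lemma add_hom_zero:
  assumes "abelian_group M" "abelian_group N" "f \<in> add_hom M N"
  shows "f \<zero>\<^bsub>M\<^esub> = \<zero>\<^bsub>N\<^esub>"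
proof -
  interpret M: abelian_group M by fact
  interpret N: abelian_group N by fact
  have "f \<zero>\<^bsub>M\<^esub> \<oplus>\<^bsub>N\<^esub> f \<zero>\<^bsub>M\<^esub> = f \<zero>\<^bsub>M\<^esub> \<oplus>\<^bsub>N\<^esub> \<zero>\<^bsub>N\<^esub>"
    using add_hom_add[OF assms(3) M.zero_closed M.zero_closed] add_hom_closed[OF assms(3) M.zero_closed] by simp
  then show ?thesis using add_hom_closed[OF assms(3) M.zero_closed] by simp
qed

lemma zero_if_idem_add:
  assumes "abelian_group M" "x \<in> carrier M" "x = x \<oplus>\<^bsub>M\<^esub> x"
  shows "x = \<zero>\<^bsub>M\<^esub>"
proof -
  interpret abelian_group M by fact
  show ?thesis using assms(2,3) by (metis add.r_cancel_one')
qed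

lemma add_hom_eqI:
  assumes "abelian_group M" "abelian_group N" "add_generated M G" "f \<in> add_hom M N" "g \<in> add_hom M N"
    "\<And>x. x \<in> G \<Longrightarrow> f x = g x" "x \<in> carrier M"
  shows "f x = g x"
proof -
  interpret M: abelian_group M by fact
  interpret N: abelian_group N by fact
  have "carrier M \<subseteq> {x. f x = g x}"
  proof (rule assms(3)[unfolded add_generated_def, rule_format])
    show "\<zero>\<^bsub>M\<^esub> \<in> {x. f x = g x}" using add_hom_zero[OF assms(1,2,4)] add_hom_zero[OF assms(1,2,5)] by simp
    show "G \<subseteq> {x. f x = g x}" using assms by auto
    fix x y assume xy: "x \<in> carrier M" "y \<in> carrier M" "x \<oplus>\<^bsub>M\<^esub> y \<in> {x. f x = g x}" "y \<in> {x. f x = g x}"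
    then have "f x \<oplus>\<^bsub>N\<^esub> f y = g x \<oplus>\<^bsub>N\<^esub> f y" using assms(4,5) by (simp add: add_hom_add)
    then show "x \<in> {x. f x = g x}" using xy assms(4,5) by (simp add: add_hom_closed)
  qed
  then show ?thesis using assms(7) by auto
qed

lemma abelian_group_cong:
  assumes "abelian_group M" "carrier N = carrier M" "\<zero>\<^bsub>N\<^esub> = \<zero>\<^bsub>M\<^esub>"
    "\<And>x y. x \<in> carrier M \<Longrightarrow> y \<in> carrier M \<Longrightarrow> x \<oplus>\<^bsub>N\<^esub> y = x \<oplus>\<^bsub>M\<^esub> y"
  shows "abelian_group N"
proof -
  interpret M: abelian_group M by fact
  show ?thesis
    by (rule abelian_groupI) (use assms(2-) M.l_neg in \<open>auto simp: M.a_ac\<close>)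
qed

lemma abelian_group_of_comm_group:
  assumes "comm_group G" "carrier N = carrier G" "\<zero>\<^bsub>N\<^esub> = \<one>\<^bsub>G\<^esub>"
    "\<And>x y. x \<in> carrier G \<Longrightarrow> y \<in> carrier G \<Longrightarrow> x \<oplus>\<^bsub>N\<^esub> y = x \<otimes>\<^bsub>G\<^esub> y"
  shows "abelian_group N"
proof -
  interpret G: comm_group G by fact
  show ?thesis
    by (rule abelian_groupI) (use assms(2-) G.l_inv in \<open>auto simp: G.m_ac\<close>)
qed

text \<open>
  Both sides of each module axiom are additive in the module element, so the axioms need to be
  checked on additive generators only. Tensor products and differentials become modules in this way.
\<close>

lemma module_by_generators:
  assumes "cring B" "abelian_group E" "add_generated E G" "G \<subseteq> carrier E"
    and act: "\<And>b. b \<in> carrier B \<Longrightarrow> (\<lambda>x. b \<odot>\<^bsub>E\<^esub> x) \<in> add_hom E E"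
    and l_distr: "\<And>a b x. \<lbrakk>a \<in> carrier B; b \<in> carrier B; x \<in> G\<rbrakk> \<Longrightarrow>
      (a \<oplus>\<^bsub>B\<^esub> b) \<odot>\<^bsub>E\<^esub> x = a \<odot>\<^bsub>E\<^esub> x \<oplus>\<^bsub>E\<^esub> b \<odot>\<^bsub>E\<^esub> x"
    and assoc: "\<And>a b x. \<lbrakk>a \<in> carrier B; b \<in> carrier B; x \<in> G\<rbrakk> \<Longrightarrow>
      (a \<otimes>\<^bsub>B\<^esub> b) \<odot>\<^bsub>E\<^esub> x = a \<odot>\<^bsub>E\<^esub> (b \<odot>\<^bsub>E\<^esub> x)"
    and one: "\<And>x. x \<in> G \<Longrightarrow> \<one>\<^bsub>B\<^esub> \<odot>\<^bsub>E\<^esub> x = x"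
  shows "module B E"
proof -
  interpret B: cring B by fact
  note eqI = add_hom_eqI[OF assms(2) assms(2) assms(3)]
  show ?thesis
  proof (rule moduleI, fact, fact)
    fix a b x assume ab: "a \<in> carrier B" "b \<in> carrier B" and x: "x \<in> carrier E"
    have "(\<lambda>x. (a \<oplus>\<^bsub>B\<^esub> b) \<odot>\<^bsub>E\<^esub> x) \<in> add_hom E E" by (rule act) (use ab in simp)
    moreover have "(\<lambda>x. a \<odot>\<^bsub>E\<^esub> x \<oplus>\<^bsub>E\<^esub> b \<odot>\<^bsub>E\<^esub> x) \<in> add_hom E E"
      by (rule add_hom_sum[OF assms(2) act[OF ab(1)] act[OF ab(2)]])
    ultimately show "(a \<oplus>\<^bsub>B\<^esub> b) \<odot>\<^bsub>E\<^esub> x = a \<odot>\<^bsub>E\<^esub> x \<oplus>\<^bsub>E\<^esub> b \<odot>\<^bsub>E\<^esub> x"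
      by (rule eqI) (rule l_distr[OF ab], assumption, rule x)
  next
    fix a b x assume ab: "a \<in> carrier B" "b \<in> carrier B" and x: "x \<in> carrier E"
    have "(\<lambda>x. (a \<otimes>\<^bsub>B\<^esub> b) \<odot>\<^bsub>E\<^esub> x) \<in> add_hom E E" by (rule act) (use ab in simp)
    moreover have "(\<lambda>x. a \<odot>\<^bsub>E\<^esub> (b \<odot>\<^bsub>E\<^esub> x)) \<in> add_hom E E"
      by (rule add_hom_compose[OF act[OF ab(2)] act[OF ab(1)]])
    ultimately show "(a \<otimes>\<^bsub>B\<^esub> b) \<odot>\<^bsub>E\<^esub> x = a \<odot>\<^bsub>E\<^esub> (b \<odot>\<^bsub>E\<^esub> x)"
      by (rule eqI) (rule assoc[OF ab], assumption, rule x)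
  next
    fix x assume x: "x \<in> carrier E"
    have "(\<lambda>x. \<one>\<^bsub>B\<^esub> \<odot>\<^bsub>E\<^esub> x) \<in> add_hom E E" by (rule act) simp
    then show "\<one>\<^bsub>B\<^esub> \<odot>\<^bsub>E\<^esub> x = x"
      by (rule eqI[OF _ add_hom_ident]) (rule one, assumption, rule x)
  qed (use add_hom_closed[OF act] add_hom_add[OF act] in auto)
qed

lemma mod_hom_add_hom: "f \<in> mod_hom R M N \<Longrightarrow> f \<in> add_hom M N"
  by (simp add: mod_hom_def add_hom_def)

lemma mod_hom_smult: "f \<in> mod_hom R M N \<Longrightarrow> r \<in> carrier R \<Longrightarrow> x \<in> carrier M \<Longrightarrow> f (r \<odot>\<^bsub>M\<^esub> x) = r \<odot>\<^bsub>N\<^esub> f x"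
  by (simp add: mod_hom_def)

lemma mod_homI:
  "f \<in> add_hom M N \<Longrightarrow> (\<And>r x. r \<in> carrier R \<Longrightarrow> x \<in> carrier M \<Longrightarrow> f (r \<odot>\<^bsub>M\<^esub> x) = r \<odot>\<^bsub>N\<^esub> f x) \<Longrightarrow> f \<in> mod_hom R M N"
  by (simp add: mod_hom_def add_hom_def)

lemma mod_hom_compose:
  "f \<in> mod_hom R M N \<Longrightarrow> g \<in> mod_hom R N P \<Longrightarrow> (\<lambda>x. g (f x)) \<in> mod_hom R M P"
  by (auto simp: mod_hom_def Pi_iff)

lemma module_smult_add_hom: "module R M \<Longrightarrow> r \<in> carrier R \<Longrightarrow> (\<lambda>x. r \<odot>\<^bsub>M\<^esub> x) \<in> add_hom M M"
  by (auto intro!: add_homI simp: module.smult_closed module.smult_r_distr)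

lemma mod_hom_by_generators:
  assumes "module R M" "module R N" "add_generated M G" "G \<subseteq> carrier M" "f \<in> add_hom M N"
    "\<And>r x. r \<in> carrier R \<Longrightarrow> x \<in> G \<Longrightarrow> f (r \<odot>\<^bsub>M\<^esub> x) = r \<odot>\<^bsub>N\<^esub> f x"
  shows "f \<in> mod_hom R M N"
proof (rule mod_homI[OF assms(5)])
  fix r x assume r: "r \<in> carrier R" and x: "x \<in> carrier M"
  show "f (r \<odot>\<^bsub>M\<^esub> x) = r \<odot>\<^bsub>N\<^esub> f x"
  proof (rule add_hom_eqI[OF _ _ assms(3), where f = "\<lambda>x. f (r \<odot>\<^bsub>M\<^esub> x)"])
    show "abelian_group M" "abelian_group N" using assms(1,2) by (simp_all add: module_def)
    show "(\<lambda>x. f (r \<odot>\<^bsub>M\<^esub> x)) \<in> add_hom M N"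
      by (rule add_hom_compose[OF module_smult_add_hom assms(5)]) (use assms r in auto)
    show "(\<lambda>x. r \<odot>\<^bsub>N\<^esub> f x) \<in> add_hom M N"
      by (rule add_hom_compose[OF assms(5) module_smult_add_hom]) (use assms r in auto)
  qed (use assms r x in auto)
qed

lemma with_smult_simps [simp]:
  "carrier (with_smult act M) = carrier M"
  "monoid.mult (with_smult act M) = monoid.mult M"
  "one (with_smult act M) = one M"
  "ring.zero (with_smult act M) = ring.zero M"
  "ring.add (with_smult act M) = ring.add M"
  "smult (with_smult act M) = act"
  by (simp_all add: with_smult_def)

lemma restrict_scalars_simps [simp]:
  "carrier (restrict_scalars f M) = carrier M"
  "ring.zero (restrict_scalars f M) = ring.zero M"
  "ring.add (restrict_scalars f M) = ring.add M"
  "smult (restrict_scalars f M) = (\<lambda>r x. f r \<odot>\<^bsub>M\<^esub> x)"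
  by (simp_all add: restrict_scalars_def)

lemma ring_via_simps [simp]:
  "carrier (ring_via f B) = carrier B"
  "monoid.mult (ring_via f B) = monoid.mult B"
  "one (ring_via f B) = one B"
  "ring.zero (ring_via f B) = ring.zero B"
  "ring.add (ring_via f B) = ring.add B"
  "smult (ring_via f B) = (\<lambda>r x. f r \<otimes>\<^bsub>B\<^esub> x)"
  by (simp_all add: ring_via_def)

lemma abelian_group_with_smult: "abelian_group M \<Longrightarrow> abelian_group (with_smult act M)"
  by (erule abelian_group_cong) simp_all

lemma module_restrict_scalars:
  assumes "cring R" "f \<in> ring_hom R B" "module B M"
  shows "module R (restrict_scalars f M)"
proof -
  interpret M: module B M by fact
  show ?thesis
    using assms(2)
    by (intro moduleI assms(1) abelian_group_cong[OF M.abelian_group_axioms])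
      (auto simp: ring_hom_closed ring_hom_add ring_hom_mult ring_hom_one M.smult_l_distr M.smult_r_distr M.smult_assoc1)
qed

lemma module_ring_via:
  assumes "cring R" "f \<in> ring_hom R B" "cring B"
  shows "module R (ring_via f B)"
proof -
  interpret B: cring B by fact
  show ?thesis
    using assms(2)
    by (intro moduleI assms(1) abelian_group_cong[OF B.abelian_group_axioms])
      (auto simp: ring_hom_closed ring_hom_add ring_hom_mult ring_hom_one B.l_distr B.r_distr B.m_assoc)
qed

lemma cring_ring_via:
  assumes "cring B" shows "cring (ring_via f B)"
proof -
  interpret B: cring B by fact
  show ?thesis
    by (intro cringI comm_monoidI abelian_group_cong[OF B.abelian_group_axioms])
      (auto simp: B.m_assoc B.l_distr intro: B.m_comm)
qed

lemma module_cong_ring: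
  assumes "module B M" "cring B'" "carrier B' = carrier B" "ring.add B' = ring.add B"
    "monoid.mult B' = monoid.mult B" "one B' = one B"
  shows "module B' M"
proof -
  interpret M: module B M by fact
  show ?thesis
    by (intro moduleI assms(2) M.abelian_group_axioms)
      (auto simp: assms(3-) M.smult_l_distr M.smult_r_distr M.smult_assoc1)
qed

abbreviation regular :: "('b, 'z) ring_scheme \<Rightarrow> ('b, 'b) module"
  where "regular B \<equiv> ring_via (\<lambda>b. b) B"

lemma module_regular: "cring B \<Longrightarrow> module B (regular B)"
  by (rule module_ring_via) (auto simp: ring_hom_def)

section \<open>Dual bases of finitely generated projective modules\<close>

lemma free_module_simps:
  "carrier (free_module R S) = {f. (\<forall>i\<in>S. f i \<in> carrier R) \<and> (\<forall>i. i \<notin> S \<longrightarrow> f i = \<zero>\<^bsub>R\<^esub>) \<and> finite {i. f i \<noteq> \<zero>\<^bsub>R\<^esub>}}"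
  "ring.add (free_module R S) = (\<lambda>f g i. f i \<oplus>\<^bsub>R\<^esub> g i)"
  "smult (free_module R S) = (\<lambda>r f i. r \<otimes>\<^bsub>R\<^esub> f i)"
  by (simp_all add: free_module_def)

text \<open>
  A linear map out of a free module is determined by the images of the unit vectors. The finite set \<open>F\<close>
  may exceed the support of \<open>v\<close>, so that one \<open>F\<close> can serve for a whole family of vectors.
\<close>

lemma mod_hom_free_module:
  assumes M: "module R M" and p: "p \<in> mod_hom R (free_module R S) M" and F: "finite F" "F \<subseteq> S"
    and v: "v \<in> carrier (free_module R S)" "\<And>s. s \<notin> F \<Longrightarrow> v s = \<zero>\<^bsub>R\<^esub>"
  shows "p v = (\<Oplus>\<^bsub>M\<^esub>s\<in>F. v s \<odot>\<^bsub>M\<^esub> p (\<lambda>i. if i = s then \<one>\<^bsub>R\<^esub> else \<zero>\<^bsub>R\<^esub>))"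
  using F v
proof (induction F arbitrary: v rule: finite_induct)
  interpret M: module R M by fact
  let ?F = "free_module R S" and ?\<delta> = "\<lambda>s i. if i = s then \<one>\<^bsub>R\<^esub> else \<zero>\<^bsub>R\<^esub>"
  have \<delta>: "?\<delta> s \<in> carrier ?F" if "s \<in> S" for s
    using that by (auto simp: free_module_simps)
  have p\<delta>: "p (?\<delta> s) \<in> carrier M" if "s \<in> S" for s
    using p \<delta>[OF that] by (auto simp: mod_hom_def)
  {
    case (empty v)
    then have v: "v = (\<lambda>_. \<zero>\<^bsub>R\<^esub>)" by auto
    have "p (\<zero>\<^bsub>R\<^esub> \<odot>\<^bsub>?F\<^esub> v) = \<zero>\<^bsub>R\<^esub> \<odot>\<^bsub>M\<^esub> p v"
      by (rule mod_hom_smult[OF p M.R.zero_closed]) (rule empty.prems(2))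
    moreover have "\<zero>\<^bsub>R\<^esub> \<odot>\<^bsub>?F\<^esub> v = v" by (simp add: v free_module_simps)
    moreover have "p v \<in> carrier M" by (rule add_hom_closed[OF mod_hom_add_hom[OF p] empty.prems(2)])
    ultimately show ?case by simp
  next
    case (insert s F v)
    let ?w = "v(s := \<zero>\<^bsub>R\<^esub>)"
    have s: "s \<in> S" using insert by auto
    have vR: "v i \<in> carrier R" for i using insert.prems(2) by (cases "i \<in> S") (auto simp: free_module_simps)
    have w: "?w \<in> carrier ?F"
      using insert.prems(2) by (auto simp: free_module_simps elim!: rev_finite_subset)
    have sd: "v s \<odot>\<^bsub>?F\<^esub> ?\<delta> s \<in> carrier ?F"
      using s vR by (auto simp: free_module_simps intro!: finite_subset[of _ "{s}"])
    have v: "v = (v s \<odot>\<^bsub>?F\<^esub> ?\<delta> s) \<oplus>\<^bsub>?F\<^esub> ?w"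
      using vR by (auto simp: free_module_simps)
    have "p v = v s \<odot>\<^bsub>M\<^esub> p (?\<delta> s) \<oplus>\<^bsub>M\<^esub> p ?w"
      using add_hom_add[OF mod_hom_add_hom[OF p] sd w] mod_hom_smult[OF p vR \<delta>[OF s], of s] v by simp
    also have "p ?w = (\<Oplus>\<^bsub>M\<^esub>t\<in>F. ?w t \<odot>\<^bsub>M\<^esub> p (?\<delta> t))"
      by (rule insert.IH[OF _ w]) (use insert.prems(1,3) in auto)
    also have "\<dots> = (\<Oplus>\<^bsub>M\<^esub>t\<in>F. v t \<odot>\<^bsub>M\<^esub> p (?\<delta> t))"
      by (rule M.M.finsum_cong') (use insert vR p\<delta> in auto)
    finally show ?case
      using insert vR p\<delta> by (subst M.M.finsum_insert) auto
  }
qed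

text \<open>
  Embed \<open>M\<close> as a direct summand in a free module. Finitely many generators of \<open>M\<close> involve finitely many
  coordinates, so all other coordinates vanish on \<open>M\<close>; the remaining coordinate forms, together with
  the projections of their unit vectors, are a finite dual basis.
\<close>

lemma dual_basis:
  fixes R :: "('r, 'w) ring_scheme" and M :: "('r, 'm, 'z) module_scheme"
  assumes fg: "finitely_generated R M" and proj: "projective R M"
  obtains F :: "'m set" and e and c where "finite F" "e \<in> F \<rightarrow> carrier M" "\<And>s. s \<in> F \<Longrightarrow> c s \<in> mod_hom R M (regular R)"
    "\<And>x. x \<in> carrier M \<Longrightarrow> x = (\<Oplus>\<^bsub>M\<^esub>s\<in>F. c s x \<odot>\<^bsub>M\<^esub> e s)"
proof -
  have M: "module R M" using proj by (simp add: projective_def)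
  interpret M: module R M by fact
  obtain S :: "'m set" and i p where i: "i \<in> mod_hom R M (free_module R S)" and p: "p \<in> mod_hom R (free_module R S) M"
    and pi: "\<And>x. x \<in> carrier M \<Longrightarrow> p (i x) = x"
    using proj unfolding projective_def by blast
  obtain X where X: "finite X" "X \<subseteq> carrier M"
    "\<And>x. x \<in> carrier M \<Longrightarrow> \<exists>c\<in>X \<rightarrow> carrier R. x = (\<Oplus>\<^bsub>M\<^esub>g\<in>X. c g \<odot>\<^bsub>M\<^esub> g)"
    using fg unfolding finitely_generated_def by blast
  have iF: "i x \<in> carrier (free_module R S)" if "x \<in> carrier M" for x using i that by (auto simp: mod_hom_def)
  have coord: "(\<lambda>x. i x s) \<in> mod_hom R M (regular R)" for s
    using i by (cases "s \<in> S") (auto simp: mod_hom_def free_module_simps Pi_iff)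
  define F where "F = (\<Union>g\<in>X. {s. i g s \<noteq> \<zero>\<^bsub>R\<^esub>})"
  have iX: "finite {s. i g s \<noteq> \<zero>\<^bsub>R\<^esub>}" "{s. i g s \<noteq> \<zero>\<^bsub>R\<^esub>} \<subseteq> S" if "g \<in> X" for g
    using iF[of g] that X(2) by (auto simp: free_module_simps)
  have F: "finite F" "F \<subseteq> S"
    unfolding F_def using X(1) iX by auto
  \<comment> \<open>Outside \<open>F\<close> a coordinate vanishes on the generators, hence on \<open>M\<close>.\<close>
  have supp: "i x s = \<zero>\<^bsub>R\<^esub>" if x: "x \<in> carrier M" and s: "s \<notin> F" for x s
  proof -
    obtain c where c: "c \<in> X \<rightarrow> carrier R" "x = (\<Oplus>\<^bsub>M\<^esub>g\<in>X. c g \<odot>\<^bsub>M\<^esub> g)" using X(3)[OF x] by blast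
    note h = add_hom_add[OF mod_hom_add_hom[OF coord[of s]]] mod_hom_smult[OF coord[of s]]
    have "i (\<Oplus>\<^bsub>M\<^esub>g\<in>Y. c g \<odot>\<^bsub>M\<^esub> g) s = \<zero>\<^bsub>R\<^esub>" if "Y \<subseteq> X" for Y
      using finite_subset[OF that X(1)] that
    proof (induction Y rule: finite_induct)
      case empty
      have "i \<zero>\<^bsub>M\<^esub> s = \<zero>\<^bsub>regular R\<^esub>"
        by (rule add_hom_zero[OF M.M.abelian_group_axioms _ mod_hom_add_hom[OF coord]])
          (rule module.axioms(2)[OF module_regular[OF M.R.is_cring]])
      then show ?case by simp
    next
      case (insert g Y)
      have g: "g \<in> carrier M" "c g \<in> carrier R" using insert X(2) c(1) by auto
      have Y: "(\<lambda>g. c g \<odot>\<^bsub>M\<^esub> g) \<in> Y \<rightarrow> carrier M" using insert X(2) c(1) by auto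
      have "i g s = \<zero>\<^bsub>R\<^esub>" using insert s unfolding F_def by auto
      then show ?case using insert g Y h M.M.finsum_closed[OF Y] by (simp add: M.M.finsum_insert)
    qed
    from this[of X] show ?thesis using c(2) by simp
  qed
  let ?e = "\<lambda>s. p (\<lambda>i. if i = s then \<one>\<^bsub>R\<^esub> else \<zero>\<^bsub>R\<^esub>)"
  show ?thesis
  proof (rule that[of F ?e "\<lambda>s x. i x s"])
    show "finite F" by (rule F)
    show "?e \<in> F \<rightarrow> carrier M"
    proof
      fix s assume "s \<in> F"
      then have "(\<lambda>i. if i = s then \<one>\<^bsub>R\<^esub> else \<zero>\<^bsub>R\<^esub>) \<in> carrier (free_module R S)"
        using F by (auto simp: free_module_simps)
      then show "?e s \<in> carrier M" using p by (auto simp: mod_hom_def)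
    qed
    show "(\<lambda>x. i x s) \<in> mod_hom R M (regular R)" for s by (rule coord)
    show "x = (\<Oplus>\<^bsub>M\<^esub>s\<in>F. i x s \<odot>\<^bsub>M\<^esub> ?e s)" if "x \<in> carrier M" for x
      using mod_hom_free_module[OF M p F iF[OF that] supp[OF that]] pi[OF that] by simp
  qed
qed

section \<open>Tensor products\<close>

definition balanced ::
    "('r, 'w) ring_scheme \<Rightarrow> ('r, 'm, 'y) module_scheme \<Rightarrow> ('r, 'n, 'z) module_scheme \<Rightarrow> ('p, 'v) ring_scheme \<Rightarrow>
     ('m \<Rightarrow> 'n \<Rightarrow> 'p) \<Rightarrow> bool"
  where "balanced R M N P f \<longleftrightarrow>
    (\<forall>x\<in>carrier M. f x \<in> add_hom N P) \<and> (\<forall>y\<in>carrier N. (\<lambda>x. f x y) \<in> add_hom M P) \<and>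
    (\<forall>r\<in>carrier R. \<forall>x\<in>carrier M. \<forall>y\<in>carrier N. f (r \<odot>\<^bsub>M\<^esub> x) y = f x (r \<odot>\<^bsub>N\<^esub> y))"

lemma balancedI:
  assumes "\<And>x. x \<in> carrier M \<Longrightarrow> f x \<in> add_hom N P" "\<And>y. y \<in> carrier N \<Longrightarrow> (\<lambda>x. f x y) \<in> add_hom M P"
    "\<And>r x y. r \<in> carrier R \<Longrightarrow> x \<in> carrier M \<Longrightarrow> y \<in> carrier N \<Longrightarrow> f (r \<odot>\<^bsub>M\<^esub> x) y = f x (r \<odot>\<^bsub>N\<^esub> y)"
  shows "balanced R M N P f"
  using assms by (simp add: balanced_def)

lemma balancedD:
  assumes "balanced R M N P f"
  shows "x \<in> carrier M \<Longrightarrow> f x \<in> add_hom N P"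
    and "y \<in> carrier N \<Longrightarrow> (\<lambda>x. f x y) \<in> add_hom M P"
    and "r \<in> carrier R \<Longrightarrow> x \<in> carrier M \<Longrightarrow> y \<in> carrier N \<Longrightarrow> f (r \<odot>\<^bsub>M\<^esub> x) y = f x (r \<odot>\<^bsub>N\<^esub> y)"
    and "x \<in> carrier M \<Longrightarrow> y \<in> carrier N \<Longrightarrow> f x y \<in> carrier P"
    and "x \<in> carrier M \<Longrightarrow> x' \<in> carrier M \<Longrightarrow> y \<in> carrier N \<Longrightarrow> f (x \<oplus>\<^bsub>M\<^esub> x') y = f x y \<oplus>\<^bsub>P\<^esub> f x' y"
    and "x \<in> carrier M \<Longrightarrow> y \<in> carrier N \<Longrightarrow> y' \<in> carrier N \<Longrightarrow> f x (y \<oplus>\<^bsub>N\<^esub> y') = f x y \<oplus>\<^bsub>P\<^esub> f x y'"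
  using assms by (auto simp: balanced_def add_hom_def Pi_iff)

lemma balanced_compose:
  "balanced R M N P f \<Longrightarrow> g \<in> add_hom P Q \<Longrightarrow> balanced R M N Q (\<lambda>x y. g (f x y))"
  by (auto simp: balanced_def add_hom_def Pi_iff)

locale tensor_factors =
  fixes R :: "('r, 'w) ring_scheme" and M :: "('r, 'm, 'y) module_scheme" and N :: "('r, 'n, 'z) module_scheme"
  assumes abelian_left: "abelian_group M" and abelian_right: "abelian_group N"
    and smult_left: "\<And>r x. r \<in> carrier R \<Longrightarrow> x \<in> carrier M \<Longrightarrow> r \<odot>\<^bsub>M\<^esub> x \<in> carrier M"
    and smult_right: "\<And>r y. r \<in> carrier R \<Longrightarrow> y \<in> carrier N \<Longrightarrow> r \<odot>\<^bsub>N\<^esub> y \<in> carrier N"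
begin

sublocale M: abelian_group M by (rule abelian_left)
sublocale N: abelian_group N by (rule abelian_right)

sublocale presentation "carrier M \<times> carrier N" "tensor_rels R M N"
proof
  show "tensor_rels R M N \<subseteq> carrier (free_Abelian_group (carrier M \<times> carrier N))"
    unfolding tensor_rels_def
    by (auto simp del: carrier_free_Abelian_group_iff simp: smult_left smult_right
        intro!: frag_of_diff_closed frag_of_diff2_closed)
qed

abbreviation "G \<equiv> pres_group (carrier M \<times> carrier N) (tensor_rels R M N)"

lemma tensor_simps:
  "carrier (tensor R M N) = carrier G" "\<zero>\<^bsub>tensor R M N\<^esub> = \<one>\<^bsub>G\<^esub>" "ring.add (tensor R M N) = monoid.mult G"
  by (simp_all add: tensor_def Let_def)

lemma abelian_group_tensor: "abelian_group (tensor R M N)"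
  by (rule abelian_group_of_comm_group[OF pres_group_comm_group]) (simp_all add: tensor_simps)

lemma tens_closed: "x \<in> carrier M \<Longrightarrow> y \<in> carrier N \<Longrightarrow> tens R M N x y \<in> carrier (tensor R M N)"
  by (simp add: tens_def tensor_simps pres_gen_closed)

lemma add_generated_tensor: "add_generated (tensor R M N) {tens R M N x y | x y. x \<in> carrier M \<and> y \<in> carrier N}"
  unfolding add_generated_def tensor_simps
proof (intro allI impI subsetI)
  fix U X
  assume U: "\<one>\<^bsub>G\<^esub> \<in> U" "{tens R M N x y | x y. x \<in> carrier M \<and> y \<in> carrier N} \<subseteq> U"
    "\<forall>x\<in>carrier G. \<forall>y\<in>carrier G. x \<otimes>\<^bsub>G\<^esub> y \<in> U \<longrightarrow> y \<in> U \<longrightarrow> x \<in> U" and X: "X \<in> carrier G"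
  show "X \<in> U"
    by (rule pres_induct[OF X]) (use U in \<open>auto simp: tens_def\<close>)
qed

lemma tensor_eqI:
  assumes "abelian_group P" "f \<in> add_hom (tensor R M N) P" "g \<in> add_hom (tensor R M N) P"
    "\<And>x y. x \<in> carrier M \<Longrightarrow> y \<in> carrier N \<Longrightarrow> f (tens R M N x y) = g (tens R M N x y)"
    "X \<in> carrier (tensor R M N)"
  shows "f X = g X"
  using add_hom_eqI[OF abelian_group_tensor assms(1) add_generated_tensor assms(2,3) _ assms(5)] assms(4) by auto

lemma pres_lift_tensor:
  assumes G': "comm_group G'"
    and f: "\<And>x y. x \<in> carrier M \<Longrightarrow> y \<in> carrier N \<Longrightarrow> f x y \<in> carrier G'"
    "\<And>x x' y. x \<in> carrier M \<Longrightarrow> x' \<in> carrier M \<Longrightarrow> y \<in> carrier N \<Longrightarrow> f (x \<oplus>\<^bsub>M\<^esub> x') y = f x y \<otimes>\<^bsub>G'\<^esub> f x' y"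
    "\<And>x y y'. x \<in> carrier M \<Longrightarrow> y \<in> carrier N \<Longrightarrow> y' \<in> carrier N \<Longrightarrow> f x (y \<oplus>\<^bsub>N\<^esub> y') = f x y \<otimes>\<^bsub>G'\<^esub> f x y'"
    "\<And>r x y. r \<in> carrier R \<Longrightarrow> x \<in> carrier M \<Longrightarrow> y \<in> carrier N \<Longrightarrow> f (r \<odot>\<^bsub>M\<^esub> x) y = f x (r \<odot>\<^bsub>N\<^esub> y)"
  shows "pres_lift G' (\<lambda>(x, y). f x y) \<in> hom G G'"
    and "x \<in> carrier M \<Longrightarrow> y \<in> carrier N \<Longrightarrow> pres_lift G' (\<lambda>(x, y). f x y) (tens R M N x y) = f x y"
proof -
  have fS: "(\<lambda>(x, y). f x y) \<in> carrier M \<times> carrier N \<rightarrow> carrier G'" using f(1) by auto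
  have rels: "free_ext G' (\<lambda>(x, y). f x y) c = \<one>\<^bsub>G'\<^esub>" if "c \<in> tensor_rels R M N" for c
    using that unfolding tensor_rels_def
    by (auto intro!: free_ext_rel3[OF G' fS] free_ext_rel2[OF G' fS] simp: f(2-) smult_left smult_right)
  show "pres_lift G' (\<lambda>(x, y). f x y) \<in> hom G G'" by (rule pres_lift_hom[OF G' fS rels])
  show "pres_lift G' (\<lambda>(x, y). f x y) (tens R M N x y) = f x y" if "x \<in> carrier M" "y \<in> carrier N"
    using pres_lift_gen[OF G' fS rels, where x = "(x, y)"] that by (simp add: tens_def)
qed

lemma
  assumes "abelian_group P" "balanced R M N P f"
  shows tensor_lift_hom: "tensor_lift P f \<in> add_hom (tensor R M N) P"
    and tensor_lift_tens: "x \<in> carrier M \<Longrightarrow> y \<in> carrier N \<Longrightarrow> tensor_lift P f (tens R M N x y) = f x y"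
proof -
  interpret P: abelian_group P by fact
  have G': "comm_group (add_monoid P)" by (rule P.a_comm_group)
  note lift = pres_lift_tensor[OF G', where f = f]
  note b = balancedD(3-6)[OF assms(2)]
  have "pres_lift (add_monoid P) (\<lambda>(x, y). f x y) \<in> hom G (add_monoid P)"
    by (rule lift) (auto simp: b)
  then show "tensor_lift P f \<in> add_hom (tensor R M N) P"
    unfolding tensor_lift_def by (auto intro!: add_homI simp: tensor_simps hom_def)
  show "tensor_lift P f (tens R M N x y) = f x y" if "x \<in> carrier M" "y \<in> carrier N"
    unfolding tensor_lift_def by (rule lift) (auto simp: b that)
qed

lemma balanced_tens: "balanced R M N (tensor R M N) (tens R M N)"
proof -
  show ?thesis
  proof (intro balancedI add_homI tens_closed; (assumption)?)
    fix x y y' assume "x \<in> carrier M" "y \<in> carrier N" "y' \<in> carrier N"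
    then show "tens R M N x (y \<oplus>\<^bsub>N\<^esub> y') = tens R M N x y \<oplus>\<^bsub>tensor R M N\<^esub> tens R M N x y'"
      unfolding tens_def tensor_simps by (intro pres_gen_rel3) (auto simp: tensor_rels_def)
  next
    fix y x x' assume "y \<in> carrier N" "x \<in> carrier M" "x' \<in> carrier M"
    then show "tens R M N (x \<oplus>\<^bsub>M\<^esub> x') y = tens R M N x y \<oplus>\<^bsub>tensor R M N\<^esub> tens R M N x' y"
      unfolding tens_def tensor_simps by (intro pres_gen_rel3) (auto simp: tensor_rels_def)
  next
    fix r x y assume "r \<in> carrier R" "x \<in> carrier M" "y \<in> carrier N"
    then show "tens R M N (r \<odot>\<^bsub>M\<^esub> x) y = tens R M N x (r \<odot>\<^bsub>N\<^esub> y)"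
      unfolding tens_def by (intro pres_gen_rel2) (auto simp: tensor_rels_def smult_left smult_right)
  qed
qed

text \<open>
  The product on a tensor product is defined by lifting into the presented group itself instead of
  the additive group of a record.
\<close>

lemma
  assumes "balanced R M N (tensor R M N) f"
  shows tensor_endo_hom: "pres_lift G (\<lambda>(x, y). f x y) \<in> add_hom (tensor R M N) (tensor R M N)"
    and tensor_endo_tens: "x \<in> carrier M \<Longrightarrow> y \<in> carrier N \<Longrightarrow> pres_lift G (\<lambda>(x, y). f x y) (tens R M N x y) = f x y"
proof -
  note lift = pres_lift_tensor[OF pres_group_comm_group, where f = f]
  note b = balancedD(3-6)[OF assms, unfolded tensor_simps]
  have "pres_lift G (\<lambda>(x, y). f x y) \<in> hom G G"
    by (rule lift) (auto simp: b)
  then show "pres_lift G (\<lambda>(x, y). f x y) \<in> add_hom (tensor R M N) (tensor R M N)"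
    by (auto intro!: add_homI simp: tensor_simps hom_def)
  show "pres_lift G (\<lambda>(x, y). f x y) (tens R M N x y) = f x y" if "x \<in> carrier M" "y \<in> carrier N"
    by (rule lift) (auto simp: b that)
qed

lemma balanced_cong:
  assumes "balanced R M N P f" "\<And>x y. x \<in> carrier M \<Longrightarrow> y \<in> carrier N \<Longrightarrow> f x y = g x y"
  shows "balanced R M N P g"
  using balancedD(3-6)[OF assms(1)]
  by (intro balancedI add_homI) (simp_all add: smult_left smult_right flip: assms(2))

lemma tensor_lift_cong:
  assumes "abelian_group P" "balanced R M N P f" "\<And>x y. x \<in> carrier M \<Longrightarrow> y \<in> carrier N \<Longrightarrow> f x y = g x y"
    "X \<in> carrier (tensor R M N)"
  shows "tensor_lift P f X = tensor_lift P g X"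
proof (rule tensor_eqI[OF assms(1) _ _ _ assms(4)])
  have g: "balanced R M N P g" by (rule balanced_cong[OF assms(2,3)])
  show "tensor_lift P f \<in> add_hom (tensor R M N) P" "tensor_lift P g \<in> add_hom (tensor R M N) P"
    by (rule tensor_lift_hom; fact)+
  show "tensor_lift P f (tens R M N x y) = tensor_lift P g (tens R M N x y)" if "x \<in> carrier M" "y \<in> carrier N" for x y
    using that assms g by (simp add: tensor_lift_tens)
qed

lemma tensor_lift_compose:
  assumes "abelian_group P" "abelian_group Q" "balanced R M N P f" "F \<in> add_hom P Q" "X \<in> carrier (tensor R M N)"
  shows "tensor_lift Q (\<lambda>x y. F (f x y)) X = F (tensor_lift P f X)"
proof (rule tensor_eqI[OF assms(2) _ _ _ assms(5)])
  have b: "balanced R M N Q (\<lambda>x y. F (f x y))" by (rule balanced_compose; fact)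
  show "tensor_lift Q (\<lambda>x y. F (f x y)) \<in> add_hom (tensor R M N) Q"
    by (rule tensor_lift_hom[OF assms(2) b])
  show "(\<lambda>X. F (tensor_lift P f X)) \<in> add_hom (tensor R M N) Q"
    by (rule add_hom_compose[OF tensor_lift_hom assms(4)]; fact)
  show "tensor_lift Q (\<lambda>x y. F (f x y)) (tens R M N x y) = F (tensor_lift P f (tens R M N x y))"
    if "x \<in> carrier M" "y \<in> carrier N" for x y
    using that tensor_lift_tens[OF assms(2) b] tensor_lift_tens[OF assms(1,3)] by simp
qed

lemma tensor_lift_add:
  assumes "abelian_group P" "balanced R M N P f" "balanced R M N P g" "balanced R M N P h"
    "\<And>x y. x \<in> carrier M \<Longrightarrow> y \<in> carrier N \<Longrightarrow> h x y = f x y \<oplus>\<^bsub>P\<^esub> g x y"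
    "X \<in> carrier (tensor R M N)"
  shows "tensor_lift P h X = tensor_lift P f X \<oplus>\<^bsub>P\<^esub> tensor_lift P g X"
proof (rule tensor_eqI[OF assms(1) _ _ _ assms(6)])
  show "tensor_lift P h \<in> add_hom (tensor R M N) P" by (rule tensor_lift_hom; fact)
  show "(\<lambda>X. tensor_lift P f X \<oplus>\<^bsub>P\<^esub> tensor_lift P g X) \<in> add_hom (tensor R M N) P"
    by (rule add_hom_sum[OF assms(1) tensor_lift_hom tensor_lift_hom]; fact)
  show "tensor_lift P h (tens R M N x y) = tensor_lift P f (tens R M N x y) \<oplus>\<^bsub>P\<^esub> tensor_lift P g (tens R M N x y)"
    if "x \<in> carrier M" "y \<in> carrier N" for x y
    using that assms by (simp add: tensor_lift_tens)
qed

end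

lemma tensor_factors_modules: "module R M \<Longrightarrow> module R N \<Longrightarrow> tensor_factors R M N"
  by (intro tensor_factors.intro) (auto simp: module_def module_axioms_def)

lemma
  assumes T': "tensor_factors R' M' N'" and T: "tensor_factors R M N"
    and f: "f \<in> add_hom M' M" and g: "g \<in> add_hom N' N"
    and bal: "\<And>r x y. r \<in> carrier R' \<Longrightarrow> x \<in> carrier M' \<Longrightarrow> y \<in> carrier N' \<Longrightarrow>
      tens R M N (f (r \<odot>\<^bsub>M'\<^esub> x)) (g y) = tens R M N (f x) (g (r \<odot>\<^bsub>N'\<^esub> y))"
  shows tensor_map_hom: "tensor_map R M N f g \<in> add_hom (tensor R' M' N') (tensor R M N)"
    and tensor_map_tens: "x \<in> carrier M' \<Longrightarrow> y \<in> carrier N' \<Longrightarrow>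
      tensor_map R M N f g (tens R' M' N' x y) = tens R M N (f x) (g y)"
proof -
  interpret T': tensor_factors R' M' N' by fact
  interpret T: tensor_factors R M N by fact
  note b = balancedD[OF T.balanced_tens]
  have "balanced R' M' N' (tensor R M N) (\<lambda>x y. tens R M N (f x) (g y))"
    using f g by (intro balancedI bal add_homI) (auto simp: b add_hom_closed add_hom_add)
  note lift = T'.tensor_lift_hom[OF T.abelian_group_tensor this] T'.tensor_lift_tens[OF T.abelian_group_tensor this]
  show "tensor_map R M N f g \<in> add_hom (tensor R' M' N') (tensor R M N)"
    unfolding tensor_map_def by (rule lift)
  show "tensor_map R M N f g (tens R' M' N' x y) = tens R M N (f x) (g y)"
    if "x \<in> carrier M'" "y \<in> carrier N'"
    unfolding tensor_map_def using that by (rule lift)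
qed

section \<open>Extension of scalars\<close>

locale scalar_extension =
  fixes R :: "('r, 'w) ring_scheme" and B :: "('b, 'y) ring_scheme" and f :: "'r \<Rightarrow> 'b"
    and N :: "('r, 'n, 'z) module_scheme"
  assumes cring_R: "cring R" and cring_B: "cring B" and hom_f: "f \<in> ring_hom R B" and module_N: "module R N"
begin

sublocale R: cring R by (rule cring_R)
sublocale B: cring B by (rule cring_B)
sublocale N: module R N by (rule module_N)
sublocale L: module R "ring_via f B" by (rule module_ring_via[OF cring_R hom_f cring_B])
sublocale T: tensor_factors R "ring_via f B" N
  by (rule tensor_factors_modules[OF L.module_axioms N.module_axioms])

abbreviation "E \<equiv> extend_scalars R B f N"
abbreviation "tn \<equiv> tens R (ring_via f B) N"

lemma f_closed [simp]: "r \<in> carrier R \<Longrightarrow> f r \<in> carrier B"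
  using hom_f by (rule ring_hom_closed)

lemma extend_simps [simp]:
  "carrier E = carrier (tensor R (ring_via f B) N)"
  "\<zero>\<^bsub>E\<^esub> = \<zero>\<^bsub>tensor R (ring_via f B) N\<^esub>"
  "ring.add E = ring.add (tensor R (ring_via f B) N)"
  by (simp_all add: extend_scalars_def)

lemma add_generated_extend: "add_generated E {tn b y | b y. b \<in> carrier B \<and> y \<in> carrier N}"
  using T.add_generated_tensor unfolding add_generated_def by simp

lemma abelian_group_extend: "abelian_group E"
  unfolding extend_scalars_def by (rule abelian_group_with_smult[OF T.abelian_group_tensor])

lemma tn_closed [simp]: "b \<in> carrier B \<Longrightarrow> y \<in> carrier N \<Longrightarrow> tn b y \<in> carrier (tensor R (ring_via f B) N)"
  by (rule T.tens_closed) simp_all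

lemmas tn_balanced = balancedD(3-6)[OF T.balanced_tens, simplified]

lemma
  assumes b: "b \<in> carrier B"
  shows smult_extend_hom: "(\<lambda>X. b \<odot>\<^bsub>E\<^esub> X) \<in> add_hom E E"
    and smult_extend_tens: "x \<in> carrier B \<Longrightarrow> y \<in> carrier N \<Longrightarrow> b \<odot>\<^bsub>E\<^esub> tn x y = tn (b \<otimes>\<^bsub>B\<^esub> x) y"
proof -
  have act: "smult E b = tensor_map R (ring_via f B) N (\<lambda>x. b \<otimes>\<^bsub>B\<^esub> x) (\<lambda>y. y)"
    by (simp add: extend_scalars_def)
  have T: "tensor_factors R (ring_via f B) N" by (rule T.tensor_factors_axioms)
  have 1: "(\<lambda>x. b \<otimes>\<^bsub>B\<^esub> x) \<in> add_hom (ring_via f B) (ring_via f B)"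
    using b by (intro add_homI) (auto simp: B.r_distr)
  have 2: "tn (b \<otimes>\<^bsub>B\<^esub> (r \<odot>\<^bsub>ring_via f B\<^esub> x)) y = tn (b \<otimes>\<^bsub>B\<^esub> x) (r \<odot>\<^bsub>N\<^esub> y)"
    if "r \<in> carrier R" "x \<in> carrier (ring_via f B)" "y \<in> carrier N" for r x y
  proof -
    have "b \<otimes>\<^bsub>B\<^esub> (f r \<otimes>\<^bsub>B\<^esub> x) = f r \<otimes>\<^bsub>B\<^esub> (b \<otimes>\<^bsub>B\<^esub> x)" using that b by (simp add: B.m_lcomm)
    then show ?thesis using that b tn_balanced(1)[of r "b \<otimes>\<^bsub>B\<^esub> x" y] by simp
  qed
  have "tensor_map R (ring_via f B) N (\<lambda>x. b \<otimes>\<^bsub>B\<^esub> x) (\<lambda>y. y) \<in>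
    add_hom (tensor R (ring_via f B) N) (tensor R (ring_via f B) N)"
    by (rule tensor_map_hom[OF T T 1 add_hom_ident]) (use 2 in auto)
  then show "(\<lambda>X. b \<odot>\<^bsub>E\<^esub> X) \<in> add_hom E E" by (simp add: act add_hom_def)
  show "b \<odot>\<^bsub>E\<^esub> tn x y = tn (b \<otimes>\<^bsub>B\<^esub> x) y" if "x \<in> carrier B" "y \<in> carrier N"
    unfolding act by (rule tensor_map_tens[OF T T 1 add_hom_ident]) (use 2 that in auto)
qed

lemma module_extend: "module B E"
  by (rule module_by_generators[OF cring_B abelian_group_extend add_generated_extend])
    (auto simp: smult_extend_hom smult_extend_tens tn_balanced B.l_distr B.m_assoc)

text \<open>
  Half of the adjunction between extension and restriction of scalars: the linear extension of \<open>g\<close>.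
\<close>

lemma
  assumes M: "module B M" and g: "g \<in> mod_hom R N (restrict_scalars f M)"
  shows extend_lift_hom: "tensor_lift M (\<lambda>b y. b \<odot>\<^bsub>M\<^esub> g y) \<in> mod_hom B E M"
    and extend_lift_tens: "b \<in> carrier B \<Longrightarrow> y \<in> carrier N \<Longrightarrow>
      tensor_lift M (\<lambda>b y. b \<odot>\<^bsub>M\<^esub> g y) (tn b y) = b \<odot>\<^bsub>M\<^esub> g y"
proof -
  interpret M: module B M by fact
  have gc: "g y \<in> carrier M" if "y \<in> carrier N" for y using g that by (auto simp: mod_hom_def)
  have bal: "balanced R (ring_via f B) N M (\<lambda>b y. b \<odot>\<^bsub>M\<^esub> g y)"
    using g by (intro balancedI add_homI)
      (auto simp: gc mod_hom_def M.smult_l_distr M.smult_r_distr M.smult_assoc1[symmetric] B.m_comm)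
  note lift = T.tensor_lift_hom[OF M.abelian_group_axioms bal] T.tensor_lift_tens[OF M.abelian_group_axioms bal]
  show *: "tensor_lift M (\<lambda>b y. b \<odot>\<^bsub>M\<^esub> g y) (tn b y) = b \<odot>\<^bsub>M\<^esub> g y" if "b \<in> carrier B" "y \<in> carrier N" for b y
    using that by (simp add: lift)
  show "tensor_lift M (\<lambda>b y. b \<odot>\<^bsub>M\<^esub> g y) \<in> mod_hom B E M"
    by (rule mod_hom_by_generators[OF module_extend M add_generated_extend])
      (use lift(1) in \<open>auto simp: add_hom_def smult_extend_tens * gc M.smult_assoc1\<close>)
qed

end

section \<open>Kaehler differentials\<close>

locale kaehler_algebra =
  fixes R :: "('r, 'w) ring_scheme" and B :: "('r, 'b, 'z) module_scheme"
  assumes algebra: "algebra R B"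
begin

sublocale B: cring B by (rule algebra.M_cring[OF algebra])
sublocale algebra R B by (rule algebra)

sublocale presentation "carrier B \<times> carrier B" "kaehler_rels R B"
proof
  show "kaehler_rels R B \<subseteq> carrier (free_Abelian_group (carrier B \<times> carrier B))"
    unfolding kaehler_rels_def
    by (auto simp del: carrier_free_Abelian_group_iff 
        intro!: frag_of_diff_closed frag_of_diff2_closed)
qed

abbreviation "\<Omega> \<equiv> kaehler R B"
abbreviation "G \<equiv> pres_group (carrier B \<times> carrier B) (kaehler_rels R B)"

definition "form u v = pres_gen (carrier B \<times> carrier B) (kaehler_rels R B) (u, v)"

lemma kaehler_simps:
  "carrier \<Omega> = carrier G" "\<zero>\<^bsub>\<Omega>\<^esub> = \<one>\<^bsub>G\<^esub>" "ring.add \<Omega> = monoid.mult G"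
  "smult \<Omega> = (\<lambda>b. pres_lift G (\<lambda>(u, v). form (b \<otimes>\<^bsub>B\<^esub> u) v))"
  by (simp_all add: kaehler_def Let_def form_def)

lemma abelian_group_kaehler: "abelian_group \<Omega>"
  by (rule abelian_group_of_comm_group[OF pres_group_comm_group]) (simp_all add: kaehler_simps)

lemma form_closed [simp]: "u \<in> carrier B \<Longrightarrow> v \<in> carrier B \<Longrightarrow> form u v \<in> carrier \<Omega>"
  by (simp add: form_def kaehler_simps pres_gen_closed)

lemma add_generated_kaehler: "add_generated \<Omega> {form u v | u v. u \<in> carrier B \<and> v \<in> carrier B}"
  unfolding add_generated_def kaehler_simps
proof (intro allI impI subsetI)
  fix U X
  assume U: "\<one>\<^bsub>G\<^esub> \<in> U" "{form u v | u v. u \<in> carrier B \<and> v \<in> carrier B} \<subseteq> U"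
    "\<forall>x\<in>carrier G. \<forall>y\<in>carrier G. x \<otimes>\<^bsub>G\<^esub> y \<in> U \<longrightarrow> y \<in> U \<longrightarrow> x \<in> U" and X: "X \<in> carrier G"
  show "X \<in> U"
    by (rule pres_induct[OF X]) (use U in \<open>auto simp: form_def\<close>)
qed

lemma form_rels:
  assumes "u \<in> carrier B" "v \<in> carrier B" "w \<in> carrier B"
  shows "form (u \<oplus>\<^bsub>B\<^esub> v) w = form u w \<oplus>\<^bsub>\<Omega>\<^esub> form v w"
    and "form u (v \<oplus>\<^bsub>B\<^esub> w) = form u v \<oplus>\<^bsub>\<Omega>\<^esub> form u w"
    and "r \<in> carrier R \<Longrightarrow> form u (r \<odot>\<^bsub>B\<^esub> v) = form (r \<odot>\<^bsub>B\<^esub> u) v"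
    and "form u (v \<otimes>\<^bsub>B\<^esub> w) = form (u \<otimes>\<^bsub>B\<^esub> v) w \<oplus>\<^bsub>\<Omega>\<^esub> form (u \<otimes>\<^bsub>B\<^esub> w) v"
proof -
  show "form (u \<oplus>\<^bsub>B\<^esub> v) w = form u w \<oplus>\<^bsub>\<Omega>\<^esub> form v w"
    unfolding form_def kaehler_simps
    by (rule pres_gen_rel3) (use assms in \<open>unfold kaehler_rels_def, blast | simp\<close>)+
  show "form u (v \<oplus>\<^bsub>B\<^esub> w) = form u v \<oplus>\<^bsub>\<Omega>\<^esub> form u w"
    unfolding form_def kaehler_simps
    by (rule pres_gen_rel3) (use assms in \<open>unfold kaehler_rels_def, blast | simp\<close>)+
  show "form u (r \<odot>\<^bsub>B\<^esub> v) = form (r \<odot>\<^bsub>B\<^esub> u) v" if "r \<in> carrier R"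
    unfolding form_def
    by (rule pres_gen_rel2) (use assms that in \<open>unfold kaehler_rels_def, blast | simp\<close>)+
  show "form u (v \<otimes>\<^bsub>B\<^esub> w) = form (u \<otimes>\<^bsub>B\<^esub> v) w \<oplus>\<^bsub>\<Omega>\<^esub> form (u \<otimes>\<^bsub>B\<^esub> w) v"
    unfolding form_def kaehler_simps
    by (rule pres_gen_rel3) (use assms in \<open>unfold kaehler_rels_def, blast | simp\<close>)+
qed

lemma pres_lift_kaehler:
  assumes G': "comm_group G'"
    and f: "\<And>u v. u \<in> carrier B \<Longrightarrow> v \<in> carrier B \<Longrightarrow> f u v \<in> carrier G'"
    "\<And>u u' v. u \<in> carrier B \<Longrightarrow> u' \<in> carrier B \<Longrightarrow> v \<in> carrier B \<Longrightarrow> f (u \<oplus>\<^bsub>B\<^esub> u') v = f u v \<otimes>\<^bsub>G'\<^esub> f u' v"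
    "\<And>u v v'. u \<in> carrier B \<Longrightarrow> v \<in> carrier B \<Longrightarrow> v' \<in> carrier B \<Longrightarrow> f u (v \<oplus>\<^bsub>B\<^esub> v') = f u v \<otimes>\<^bsub>G'\<^esub> f u v'"
    "\<And>r u v. r \<in> carrier R \<Longrightarrow> u \<in> carrier B \<Longrightarrow> v \<in> carrier B \<Longrightarrow> f u (r \<odot>\<^bsub>B\<^esub> v) = f (r \<odot>\<^bsub>B\<^esub> u) v"
    "\<And>u v w. u \<in> carrier B \<Longrightarrow> v \<in> carrier B \<Longrightarrow> w \<in> carrier B \<Longrightarrow>
      f u (v \<otimes>\<^bsub>B\<^esub> w) = f (u \<otimes>\<^bsub>B\<^esub> v) w \<otimes>\<^bsub>G'\<^esub> f (u \<otimes>\<^bsub>B\<^esub> w) v"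
  shows "pres_lift G' (\<lambda>(u, v). f u v) \<in> hom G G'"
    and "u \<in> carrier B \<Longrightarrow> v \<in> carrier B \<Longrightarrow> pres_lift G' (\<lambda>(u, v). f u v) (form u v) = f u v"
proof -
  have fS: "(\<lambda>(u, v). f u v) \<in> carrier B \<times> carrier B \<rightarrow> carrier G'" using f(1) by auto
  have rels: "free_ext G' (\<lambda>(u, v). f u v) c = \<one>\<^bsub>G'\<^esub>" if "c \<in> kaehler_rels R B" for c
    using that unfolding kaehler_rels_def
    by (auto intro!: free_ext_rel3[OF G' fS] free_ext_rel2[OF G' fS] simp: f(2-))
  show "pres_lift G' (\<lambda>(u, v). f u v) \<in> hom G G'" by (rule pres_lift_hom[OF G' fS rels])
  show "pres_lift G' (\<lambda>(u, v). f u v) (form u v) = f u v" if "u \<in> carrier B" "v \<in> carrier B"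
    using pres_lift_gen[OF G' fS rels, where x = "(u, v)"] that by (simp add: form_def)
qed

lemma
  assumes b: "b \<in> carrier B"
  shows smult_kaehler_hom: "(\<lambda>X. b \<odot>\<^bsub>\<Omega>\<^esub> X) \<in> add_hom \<Omega> \<Omega>"
    and smult_form: "u \<in> carrier B \<Longrightarrow> v \<in> carrier B \<Longrightarrow> b \<odot>\<^bsub>\<Omega>\<^esub> form u v = form (b \<otimes>\<^bsub>B\<^esub> u) v"
proof -
  note lift = pres_lift_kaehler[OF pres_group_comm_group, where f = "\<lambda>u v. form (b \<otimes>\<^bsub>B\<^esub> u) v"]
  note rels = form_rels[unfolded kaehler_simps]
  have assoc: "b \<otimes>\<^bsub>B\<^esub> (r \<odot>\<^bsub>B\<^esub> u) = r \<odot>\<^bsub>B\<^esub> (b \<otimes>\<^bsub>B\<^esub> u)" if "r \<in> carrier R" "u \<in> carrier B" for r u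
    using that b by (metis B.m_comm smult_assoc2 smult_closed)
  note s = b B.r_distr rels assoc B.m_assoc form_closed[unfolded kaehler_simps]
  have "pres_lift G (\<lambda>(u, v). form (b \<otimes>\<^bsub>B\<^esub> u) v) \<in> hom G G"
    by (rule lift) (simp_all add: s)
  then show "(\<lambda>X. b \<odot>\<^bsub>\<Omega>\<^esub> X) \<in> add_hom \<Omega> \<Omega>"
    by (auto simp: add_hom_def hom_def kaehler_simps)
  show "b \<odot>\<^bsub>\<Omega>\<^esub> form u v = form (b \<otimes>\<^bsub>B\<^esub> u) v" if "u \<in> carrier B" "v \<in> carrier B"
    unfolding kaehler_simps by (rule lift) (simp_all add: s that)
qed

lemma module_kaehler: "module B \<Omega>"
  by (rule module_by_generators[OF B.is_cring abelian_group_kaehler add_generated_kaehler])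
    (auto simp: smult_kaehler_hom smult_form form_rels B.l_distr B.m_assoc)

text \<open>
  Derivations are linear maps out of the differentials; \<open>form u v\<close> is \<open>u dv\<close>.
\<close>

lemma
  assumes M: "module B P" and \<delta>: "\<delta> \<in> add_hom B P"
    and scalar: "\<And>r v. r \<in> carrier R \<Longrightarrow> v \<in> carrier B \<Longrightarrow> \<delta> (r \<odot>\<^bsub>B\<^esub> v) = (r \<odot>\<^bsub>B\<^esub> \<one>\<^bsub>B\<^esub>) \<odot>\<^bsub>P\<^esub> \<delta> v"
    and leibniz: "\<And>v w. v \<in> carrier B \<Longrightarrow> w \<in> carrier B \<Longrightarrow> \<delta> (v \<otimes>\<^bsub>B\<^esub> w) = v \<odot>\<^bsub>P\<^esub> \<delta> w \<oplus>\<^bsub>P\<^esub> w \<odot>\<^bsub>P\<^esub> \<delta> v"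
  shows kaehler_lift_hom: "pres_lift (add_monoid P) (\<lambda>(u, v). u \<odot>\<^bsub>P\<^esub> \<delta> v) \<in> mod_hom B \<Omega> P"
    and kaehler_lift_form: "u \<in> carrier B \<Longrightarrow> v \<in> carrier B \<Longrightarrow>
      pres_lift (add_monoid P) (\<lambda>(u, v). u \<odot>\<^bsub>P\<^esub> \<delta> v) (form u v) = u \<odot>\<^bsub>P\<^esub> \<delta> v"
proof -
  interpret P: module B P by fact
  have \<delta>c: "\<delta> v \<in> carrier P" if "v \<in> carrier B" for v using \<delta> that by (rule add_hom_closed)
  note lift = pres_lift_kaehler[OF P.a_comm_group, where f = "\<lambda>u v. u \<odot>\<^bsub>P\<^esub> \<delta> v"]
  have assoc: "u \<odot>\<^bsub>P\<^esub> \<delta> (r \<odot>\<^bsub>B\<^esub> v) = (r \<odot>\<^bsub>B\<^esub> u) \<odot>\<^bsub>P\<^esub> \<delta> v"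
    if "r \<in> carrier R" "u \<in> carrier B" "v \<in> carrier B" for r u v
  proof -
    have "r \<odot>\<^bsub>B\<^esub> u = u \<otimes>\<^bsub>B\<^esub> (r \<odot>\<^bsub>B\<^esub> \<one>\<^bsub>B\<^esub>)"
      using that by (metis B.l_one B.m_comm B.one_closed smult_assoc2 smult_closed)
    then show ?thesis using that by (simp add: P.smult_assoc1 \<delta>c scalar)
  qed
  note s = \<delta>c P.smult_l_distr P.smult_r_distr add_hom_add[OF \<delta>] leibniz assoc P.smult_assoc1
  have hom: "pres_lift (add_monoid P) (\<lambda>(u, v). u \<odot>\<^bsub>P\<^esub> \<delta> v) \<in> hom G (add_monoid P)"
    by (rule lift) (simp_all add: s)
  show *: "pres_lift (add_monoid P) (\<lambda>(u, v). u \<odot>\<^bsub>P\<^esub> \<delta> v) (form u v) = u \<odot>\<^bsub>P\<^esub> \<delta> v"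
    if "u \<in> carrier B" "v \<in> carrier B" for u v
    by (rule lift) (simp_all add: s that)
  show "pres_lift (add_monoid P) (\<lambda>(u, v). u \<odot>\<^bsub>P\<^esub> \<delta> v) \<in> mod_hom B \<Omega> P"
    by (rule mod_hom_by_generators[OF module_kaehler M add_generated_kaehler])
      (use hom in \<open>auto simp: add_hom_def hom_def kaehler_simps(1,3) smult_form * P.smult_assoc1 \<delta>c
        simp flip: kaehler_simps(1,3)\<close>)
qed

end

section \<open>Calculating with the comultiplication\<close>

lemma alg_hom_ring_hom: "f \<in> alg_hom R M N \<Longrightarrow> f \<in> ring_hom M N"
  by (simp add: alg_hom_def)

text \<open>
  In Sweedler notation, \<open>sweedler H P f u\<close> is \<open>f(u\<^sub>1, u\<^sub>2)\<close>.
\<close>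

definition sweedler ::
    "('k, 'a, 'h, 'z) hopf_algebroid_scheme \<Rightarrow> ('p, 'v) ring_scheme \<Rightarrow> ('h \<Rightarrow> 'h \<Rightarrow> 'p) \<Rightarrow> 'h \<Rightarrow> 'p"
  where "sweedler H P f u = tensor_lift P f (comult H u)"

abbreviation bal2 ::
    "('a, 'w) ring_scheme \<Rightarrow> ('k, 'a, 'h, 'z) hopf_algebroid_scheme \<Rightarrow> ('p, 'v) ring_scheme \<Rightarrow> ('h \<Rightarrow> 'h \<Rightarrow> 'p) \<Rightarrow> bool"
  where "bal2 A H \<equiv> balanced A (tgt_module H) (src_module H)"

lemma tgt_module_simps [simp]:
  "carrier (tgt_module H) = carrier H"
  "monoid.mult (tgt_module H) = monoid.mult H"
  "one (tgt_module H) = one H"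
  "ring.zero (tgt_module H) = ring.zero H"
  "ring.add (tgt_module H) = ring.add H"
  "smult (tgt_module H) = (\<lambda>r x. tgt H r \<otimes>\<^bsub>H\<^esub> x)"
  by (simp_all add: tgt_module_def)

lemma src_module_simps [simp]:
  "carrier (src_module H) = carrier H"
  "monoid.mult (src_module H) = monoid.mult H"
  "one (src_module H) = one H"
  "ring.zero (src_module H) = ring.zero H"
  "ring.add (src_module H) = ring.add H"
  "smult (src_module H) = (\<lambda>r x. src H r \<otimes>\<^bsub>H\<^esub> x)"
  by (simp_all add: src_module_def)

context commutative_hopf_algebroid begin

sublocale A: cring A by (rule algebra.M_cring[OF base_algebra])
sublocale H: cring H by (rule algebra.M_cring[OF total_algebra])
sublocale Hk: algebra k H by (rule total_algebra)

lemmas structure_homs =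
  alg_hom_ring_hom[OF src_hom] alg_hom_ring_hom[OF tgt_hom]
  alg_hom_ring_hom[OF counit_hom] alg_hom_ring_hom[OF antipode_hom]

lemmas [simp] = structure_homs[THEN ring_hom_closed] structure_homs[THEN ring_hom_add]
  structure_homs[THEN ring_hom_mult] structure_homs[THEN ring_hom_one]

lemma counit_src [simp]: "a \<in> carrier A \<Longrightarrow> counit H (src H a) = a"
  using counit_left[of a "\<one>\<^bsub>H\<^esub>"] by simp

lemma counit_tgt [simp]: "a \<in> carrier A \<Longrightarrow> counit H (tgt H a) = a"
  using counit_right[of a "\<one>\<^bsub>H\<^esub>"] by simp

declare antipode_src [simp] antipode_tgt [simp]

lemma tgt_commute: "a \<in> carrier A \<Longrightarrow> x \<in> carrier H \<Longrightarrow> tgt H a \<otimes>\<^bsub>H\<^esub> x = x \<otimes>\<^bsub>H\<^esub> tgt H a"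
  by (simp add: H.m_comm)

sublocale tgt: module A "tgt_module H"
  unfolding tgt_module_def by (rule module_ring_via[OF A.is_cring structure_homs(2) H.is_cring])
sublocale src: module A "src_module H"
  unfolding src_module_def by (rule module_ring_via[OF A.is_cring structure_homs(1) H.is_cring])
sublocale T2: tensor_factors A "tgt_module H" "src_module H"
  by (rule tensor_factors_modules[OF tgt.module_axioms src.module_axioms])

abbreviation "tt \<equiv> tens A (tgt_module H) (src_module H)"

lemmas abelian_group_tensor2 = T2.abelian_group_tensor[folded tensor2_def]
lemmas tt_closed [simp] = T2.tens_closed[folded tensor2_def, simplified]
lemmas tt_balanced = balancedD(3-6)[OF T2.balanced_tens[folded tensor2_def], simplified]

lemma bal2I:
  assumes "\<And>x y. x \<in> carrier H \<Longrightarrow> y \<in> carrier H \<Longrightarrow> f x y \<in> carrier P"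
    "\<And>x x' y. x \<in> carrier H \<Longrightarrow> x' \<in> carrier H \<Longrightarrow> y \<in> carrier H \<Longrightarrow> f (x \<oplus>\<^bsub>H\<^esub> x') y = f x y \<oplus>\<^bsub>P\<^esub> f x' y"
    "\<And>x y y'. x \<in> carrier H \<Longrightarrow> y \<in> carrier H \<Longrightarrow> y' \<in> carrier H \<Longrightarrow> f x (y \<oplus>\<^bsub>H\<^esub> y') = f x y \<oplus>\<^bsub>P\<^esub> f x y'"
    "\<And>a x y. a \<in> carrier A \<Longrightarrow> x \<in> carrier H \<Longrightarrow> y \<in> carrier H \<Longrightarrow> f (tgt H a \<otimes>\<^bsub>H\<^esub> x) y = f x (src H a \<otimes>\<^bsub>H\<^esub> y)"
  shows "bal2 A H P f"
  using assms by (intro balancedI add_homI) auto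

lemmas bal2D = balancedD(3-6)[of A "tgt_module H" "src_module H", simplified]

lemmas lift2_hom = T2.tensor_lift_hom[folded tensor2_def]
lemmas lift2_tens = T2.tensor_lift_tens[folded tensor2_def, simplified]
lemmas tensor2_eqI = T2.tensor_eqI[folded tensor2_def, simplified]
lemmas tensor2_lift_cong = T2.tensor_lift_cong[folded tensor2_def, simplified]
lemmas tensor2_lift_compose = T2.tensor_lift_compose[folded tensor2_def, simplified]
lemmas tensor2_lift_add = T2.tensor_lift_add[folded tensor2_def, simplified]

lemma
  assumes "f \<in> add_hom H H" "g \<in> add_hom H H"
    "\<And>a x y. a \<in> carrier A \<Longrightarrow> x \<in> carrier H \<Longrightarrow> y \<in> carrier H \<Longrightarrow>
      tt (f (tgt H a \<otimes>\<^bsub>H\<^esub> x)) (g y) = tt (f x) (g (src H a \<otimes>\<^bsub>H\<^esub> y))"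
  shows tensor2_map_hom: "tensor_map A (tgt_module H) (src_module H) f g \<in> add_hom (tensor2 A H) (tensor2 A H)"
    and tensor2_map_tens: "x \<in> carrier H \<Longrightarrow> y \<in> carrier H \<Longrightarrow>
      tensor_map A (tgt_module H) (src_module H) f g (tt x y) = tt (f x) (g y)"
proof -
  have *: "f \<in> add_hom (tgt_module H) (tgt_module H)" "g \<in> add_hom (src_module H) (src_module H)"
    using assms by (simp_all add: add_hom_def)
  show "tensor_map A (tgt_module H) (src_module H) f g \<in> add_hom (tensor2 A H) (tensor2 A H)"
    unfolding tensor2_def
    by (rule tensor_map_hom[OF T2.tensor_factors_axioms T2.tensor_factors_axioms *]) (use assms in auto)
  show "tensor_map A (tgt_module H) (src_module H) f g (tt x y) = tt (f x) (g y)"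
    if "x \<in> carrier H" "y \<in> carrier H"
    by (rule tensor_map_tens[OF T2.tensor_factors_axioms T2.tensor_factors_axioms *]) (use assms that in auto)
qed

lemma mult_add_hom: "u \<in> carrier H \<Longrightarrow> (\<lambda>x. u \<otimes>\<^bsub>H\<^esub> x) \<in> add_hom H H"
  "u \<in> carrier H \<Longrightarrow> (\<lambda>x. x \<otimes>\<^bsub>H\<^esub> u) \<in> add_hom H H"
  by (auto intro!: add_homI simp: H.r_distr H.l_distr)

lemma
  assumes a: "a \<in> carrier A"
  shows left_hom: "(\<lambda>X. a \<odot>\<^bsub>tensor2_left A H\<^esub> X) \<in> add_hom (tensor2 A H) (tensor2 A H)"
    and left_tens: "x \<in> carrier H \<Longrightarrow> y \<in> carrier H \<Longrightarrow>
      a \<odot>\<^bsub>tensor2_left A H\<^esub> tt x y = tt (src H a \<otimes>\<^bsub>H\<^esub> x) y"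
    and right_hom: "(\<lambda>X. a \<odot>\<^bsub>tensor2_right A H\<^esub> X) \<in> add_hom (tensor2 A H) (tensor2 A H)"
    and right_tens: "x \<in> carrier H \<Longrightarrow> y \<in> carrier H \<Longrightarrow>
      a \<odot>\<^bsub>tensor2_right A H\<^esub> tt x y = tt x (y \<otimes>\<^bsub>H\<^esub> tgt H a)"
proof -
  have l: "tt (src H a \<otimes>\<^bsub>H\<^esub> (tgt H b \<otimes>\<^bsub>H\<^esub> x)) y = tt (src H a \<otimes>\<^bsub>H\<^esub> x) (src H b \<otimes>\<^bsub>H\<^esub> y)"
    if "b \<in> carrier A" "x \<in> carrier H" "y \<in> carrier H" for b x y
    using that a tt_balanced(1)[of b "src H a \<otimes>\<^bsub>H\<^esub> x" y] by (simp add: H.m_lcomm)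
  have r: "tt (tgt H b \<otimes>\<^bsub>H\<^esub> x) (y \<otimes>\<^bsub>H\<^esub> tgt H a) = tt x (src H b \<otimes>\<^bsub>H\<^esub> y \<otimes>\<^bsub>H\<^esub> tgt H a)"
    if "b \<in> carrier A" "x \<in> carrier H" "y \<in> carrier H" for b x y
    using that a tt_balanced(1)[of b x "y \<otimes>\<^bsub>H\<^esub> tgt H a"] by (simp add: H.m_assoc)
  have act: "smult (tensor2_left A H) a = tensor_map A (tgt_module H) (src_module H) (\<lambda>u. src H a \<otimes>\<^bsub>H\<^esub> u) (\<lambda>v. v)"
    "smult (tensor2_right A H) a = tensor_map A (tgt_module H) (src_module H) (\<lambda>u. u) (\<lambda>v. v \<otimes>\<^bsub>H\<^esub> tgt H a)"
    by (simp_all add: tensor2_left_def tensor2_right_def)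
  show "(\<lambda>X. a \<odot>\<^bsub>tensor2_left A H\<^esub> X) \<in> add_hom (tensor2 A H) (tensor2 A H)" unfolding act
    by (rule tensor2_map_hom[OF mult_add_hom(1) add_hom_ident]) (simp_all add: a l)
  show "a \<odot>\<^bsub>tensor2_left A H\<^esub> tt x y = tt (src H a \<otimes>\<^bsub>H\<^esub> x) y" if "x \<in> carrier H" "y \<in> carrier H"
    unfolding act using that
    by (intro tensor2_map_tens[OF mult_add_hom(1) add_hom_ident]) (simp_all add: a l)
  show "(\<lambda>X. a \<odot>\<^bsub>tensor2_right A H\<^esub> X) \<in> add_hom (tensor2 A H) (tensor2 A H)" unfolding act
    by (rule tensor2_map_hom[OF add_hom_ident mult_add_hom(2)]) (simp_all add: a r)
  show "a \<odot>\<^bsub>tensor2_right A H\<^esub> tt x y = tt x (y \<otimes>\<^bsub>H\<^esub> tgt H a)" if "x \<in> carrier H" "y \<in> carrier H"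
    unfolding act using that
    by (intro tensor2_map_tens[OF add_hom_ident mult_add_hom(2)]) (simp_all add: a r)
qed

text \<open>
  The product of \<open>\<H> \<otimes>\<^sub>A \<H>\<close> is defined by two nested lifts, so its value on pure tensors requires that
  both maps being lifted are balanced.
\<close>

lemma
  shows tensor2_mult_hom1: "Y \<in> carrier (tensor2 A H) \<Longrightarrow> (\<lambda>X. X \<otimes>\<^bsub>tensor2 A H\<^esub> Y) \<in> add_hom (tensor2 A H) (tensor2 A H)"
    and tensor2_mult_hom2: "x \<in> carrier H \<Longrightarrow> y \<in> carrier H \<Longrightarrow> (\<lambda>Y. tt x y \<otimes>\<^bsub>tensor2 A H\<^esub> Y) \<in> add_hom (tensor2 A H) (tensor2 A H)"
    and tensor2_mult_tens: "\<lbrakk>x \<in> carrier H; y \<in> carrier H; x' \<in> carrier H; y' \<in> carrier H\<rbrakk> \<Longrightarrow>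
      tt x y \<otimes>\<^bsub>tensor2 A H\<^esub> tt x' y' = tt (x \<otimes>\<^bsub>H\<^esub> x') (y \<otimes>\<^bsub>H\<^esub> y')"
proof -
  let ?T = "tensor2 A H"
  define inner where "inner x y = pres_lift T2.G (\<lambda>(x', y'). tt (x \<otimes>\<^bsub>H\<^esub> x') (y \<otimes>\<^bsub>H\<^esub> y'))" for x y
  have mult: "X \<otimes>\<^bsub>?T\<^esub> Y = pres_lift T2.G (\<lambda>(x, y). inner x y Y) X" for X Y
    by (simp add: tensor2_def tensor_def Let_def inner_def)
  have bi: "bal2 A H ?T (\<lambda>x' y'. tt (x \<otimes>\<^bsub>H\<^esub> x') (y \<otimes>\<^bsub>H\<^esub> y'))" if "x \<in> carrier H" "y \<in> carrier H" for x y
  proof (rule bal2I)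
    fix a x' y' assume *: "a \<in> carrier A" "x' \<in> carrier H" "y' \<in> carrier H"
    then have "tt (x \<otimes>\<^bsub>H\<^esub> (tgt H a \<otimes>\<^bsub>H\<^esub> x')) (y \<otimes>\<^bsub>H\<^esub> y') = tt (tgt H a \<otimes>\<^bsub>H\<^esub> (x \<otimes>\<^bsub>H\<^esub> x')) (y \<otimes>\<^bsub>H\<^esub> y')"
      using that by (simp add: H.m_lcomm)
    also have "\<dots> = tt (x \<otimes>\<^bsub>H\<^esub> x') (src H a \<otimes>\<^bsub>H\<^esub> (y \<otimes>\<^bsub>H\<^esub> y'))"
      using that * by (intro tt_balanced) auto
    finally show "tt (x \<otimes>\<^bsub>H\<^esub> (tgt H a \<otimes>\<^bsub>H\<^esub> x')) (y \<otimes>\<^bsub>H\<^esub> y') = tt (x \<otimes>\<^bsub>H\<^esub> x') (y \<otimes>\<^bsub>H\<^esub> (src H a \<otimes>\<^bsub>H\<^esub> y'))"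
      using that * by (simp add: H.m_lcomm)
  qed (use that in \<open>simp_all add: H.r_distr tt_balanced\<close>)
  have inner_hom: "inner x y \<in> add_hom ?T ?T" if "x \<in> carrier H" "y \<in> carrier H" for x y
    unfolding inner_def tensor2_def by (rule T2.tensor_endo_hom[OF bi[unfolded tensor2_def, OF that]])
  have inner_tens: "inner x y (tt x' y') = tt (x \<otimes>\<^bsub>H\<^esub> x') (y \<otimes>\<^bsub>H\<^esub> y')"
    if "x \<in> carrier H" "y \<in> carrier H" "x' \<in> carrier H" "y' \<in> carrier H" for x y x' y'
    unfolding inner_def using T2.tensor_endo_tens[OF bi[unfolded tensor2_def, OF that(1,2)]] that by simp
  note ab = abelian_group_tensor2
  have outer: "bal2 A H ?T (\<lambda>x y. inner x y Y)" if Y: "Y \<in> carrier ?T" for Y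
  proof (rule bal2I)
    show "inner x y Y \<in> carrier ?T" if "x \<in> carrier H" "y \<in> carrier H" for x y
      using add_hom_closed[OF inner_hom Y] that by simp
    show "inner (x \<oplus>\<^bsub>H\<^esub> x') y Y = inner x y Y \<oplus>\<^bsub>?T\<^esub> inner x' y Y"
      if "x \<in> carrier H" "x' \<in> carrier H" "y \<in> carrier H" for x x' y
      by (rule tensor2_eqI[OF ab inner_hom add_hom_sum[OF ab inner_hom inner_hom] _ Y])
        (use that in \<open>simp_all add: inner_tens H.l_distr tt_balanced\<close>)
    show "inner x (y \<oplus>\<^bsub>H\<^esub> y') Y = inner x y Y \<oplus>\<^bsub>?T\<^esub> inner x y' Y"
      if "x \<in> carrier H" "y \<in> carrier H" "y' \<in> carrier H" for x y y'
      by (rule tensor2_eqI[OF ab inner_hom add_hom_sum[OF ab inner_hom inner_hom] _ Y])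
        (use that in \<open>simp_all add: inner_tens H.l_distr tt_balanced\<close>)
    show "inner (tgt H a \<otimes>\<^bsub>H\<^esub> x) y Y = inner x (src H a \<otimes>\<^bsub>H\<^esub> y) Y"
      if "a \<in> carrier A" "x \<in> carrier H" "y \<in> carrier H" for a x y
      by (rule tensor2_eqI[OF ab inner_hom inner_hom _ Y])
        (use that in \<open>simp_all add: inner_tens H.m_assoc tt_balanced\<close>)
  qed
  show "(\<lambda>X. X \<otimes>\<^bsub>?T\<^esub> Y) \<in> add_hom ?T ?T" if "Y \<in> carrier ?T"
    unfolding mult using T2.tensor_endo_hom[OF outer[unfolded tensor2_def], folded tensor2_def] that by simp
  have *: "tt x y \<otimes>\<^bsub>?T\<^esub> Y = inner x y Y" if "x \<in> carrier H" "y \<in> carrier H" "Y \<in> carrier ?T" for x y Y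
    unfolding mult using T2.tensor_endo_tens[OF outer[unfolded tensor2_def], folded tensor2_def] that by simp
  show "(\<lambda>Y. tt x y \<otimes>\<^bsub>?T\<^esub> Y) \<in> add_hom ?T ?T" if "x \<in> carrier H" "y \<in> carrier H"
    using inner_hom[OF that] that * T2.abelian_group_tensor[folded tensor2_def]
    by (auto simp: add_hom_def abelian_group_def abelian_monoid.a_closed)
  show "tt x y \<otimes>\<^bsub>?T\<^esub> tt x' y' = tt (x \<otimes>\<^bsub>H\<^esub> x') (y \<otimes>\<^bsub>H\<^esub> y')"
    if "x \<in> carrier H" "y \<in> carrier H" "x' \<in> carrier H" "y' \<in> carrier H"
    using that by (simp add: * inner_tens)
qed

lemma comult_ring_hom: "comult H \<in> ring_hom H (tensor2_base A H)"
  by (rule alg_hom_ring_hom[OF comult_hom])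

lemma comult_add_hom: "comult H \<in> add_hom H (tensor2 A H)"
  using ring_hom_closed[OF comult_ring_hom] ring_hom_add[OF comult_ring_hom]
  by (auto intro!: add_homI simp: tensor2_base_def)

lemma comult_closed [simp]: "u \<in> carrier H \<Longrightarrow> comult H u \<in> carrier (tensor2 A H)"
  by (rule add_hom_closed[OF comult_add_hom])

lemma comult_mult:
  "u \<in> carrier H \<Longrightarrow> v \<in> carrier H \<Longrightarrow> comult H (u \<otimes>\<^bsub>H\<^esub> v) = comult H u \<otimes>\<^bsub>tensor2 A H\<^esub> comult H v"
  using ring_hom_mult[OF comult_ring_hom] by (simp add: tensor2_base_def)

lemma sweedler_hom: "abelian_group P \<Longrightarrow> bal2 A H P f \<Longrightarrow> sweedler H P f \<in> add_hom H P"
  unfolding sweedler_def[abs_def] by (rule add_hom_compose[OF comult_add_hom lift2_hom])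

lemma sweedler_closed: "abelian_group P \<Longrightarrow> bal2 A H P f \<Longrightarrow> u \<in> carrier H \<Longrightarrow> sweedler H P f u \<in> carrier P"
  by (rule add_hom_closed[OF sweedler_hom])

lemma sweedler_cong:
  "\<lbrakk>abelian_group P; bal2 A H P f; \<And>x y. x \<in> carrier H \<Longrightarrow> y \<in> carrier H \<Longrightarrow> f x y = g x y; u \<in> carrier H\<rbrakk>
    \<Longrightarrow> sweedler H P f u = sweedler H P g u"
  unfolding sweedler_def by (rule tensor2_lift_cong) auto

lemma sweedler_compose:
  "\<lbrakk>abelian_group P; abelian_group Q; bal2 A H P f; F \<in> add_hom P Q; u \<in> carrier H\<rbrakk>
    \<Longrightarrow> sweedler H Q (\<lambda>x y. F (f x y)) u = F (sweedler H P f u)"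
  unfolding sweedler_def by (rule tensor2_lift_compose) auto

text \<open>
  The left linearity of \<open>\<Delta>\<close>: \<open>\<Delta>(s(a) u) = s(a) u\<^sub>1 \<otimes> u\<^sub>2\<close>.
\<close>

lemma sweedler_src:
  assumes P: "abelian_group P" and f: "bal2 A H P f" and F: "F \<in> add_hom P P" and a: "a \<in> carrier A"
    and src: "\<And>x y. x \<in> carrier H \<Longrightarrow> y \<in> carrier H \<Longrightarrow> f (src H a \<otimes>\<^bsub>H\<^esub> x) y = F (f x y)"
    and u: "u \<in> carrier H"
  shows "sweedler H P f (src H a \<otimes>\<^bsub>H\<^esub> u) = F (sweedler H P f u)"
proof -
  have "tensor_lift P f (a \<odot>\<^bsub>tensor2_left A H\<^esub> comult H u) = F (tensor_lift P f (comult H u))"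
    by (rule tensor2_eqI[OF P add_hom_compose[OF left_hom[OF a] lift2_hom[OF P f]] add_hom_compose[OF lift2_hom[OF P f] F]])
      (use a u in \<open>simp_all add: left_tens lift2_tens[OF P f] src\<close>)
  then show ?thesis unfolding sweedler_def comult_left[OF a u] .
qed

text \<open>
  Since \<open>\<Delta>\<close> is multiplicative, a Leibniz rule for \<open>g\<close> on pure tensors, twisted by \<open>m\<close>, becomes one for
  \<open>u \<mapsto> g(u\<^sub>1, u\<^sub>2)\<close>, twisted by \<open>u \<mapsto> m(u\<^sub>1, u\<^sub>2)\<close>. It serves in both directions of the correspondence
  between derivations and linear maps: with \<open>m(x, y) = x t(\<epsilon>(y))\<close> the twist is the identity, and with
  \<open>m(x, y) = S(x) y\<close> it is \<open>t \<circ> \<epsilon>\<close>.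
\<close>

lemma sweedler_mult:
  assumes M: "module H M" and g: "bal2 A H M g" and m: "bal2 A H H m"
    and leibniz: "\<And>x y x' y'. \<lbrakk>x \<in> carrier H; y \<in> carrier H; x' \<in> carrier H; y' \<in> carrier H\<rbrakk> \<Longrightarrow>
      g (x \<otimes>\<^bsub>H\<^esub> x') (y \<otimes>\<^bsub>H\<^esub> y') = m x y \<odot>\<^bsub>M\<^esub> g x' y' \<oplus>\<^bsub>M\<^esub> m x' y' \<odot>\<^bsub>M\<^esub> g x y"
    and u: "u \<in> carrier H" and v: "v \<in> carrier H"
  shows "sweedler H M g (u \<otimes>\<^bsub>H\<^esub> v) =
    sweedler H H m u \<odot>\<^bsub>M\<^esub> sweedler H M g v \<oplus>\<^bsub>M\<^esub> sweedler H H m v \<odot>\<^bsub>M\<^esub> sweedler H M g u"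
proof -
  interpret M: module H M by fact
  let ?T = "tensor2 A H" and ?g = "tensor_lift M g" and ?m = "tensor_lift H m"
  note aM = M.abelian_group_axioms and aH = H.abelian_group_axioms and aT = abelian_group_tensor2
  have gh: "?g \<in> add_hom ?T M" and mh: "?m \<in> add_hom ?T H"
    by (rule lift2_hom; fact)+
  have l: "(\<lambda>X. ?m X \<odot>\<^bsub>M\<^esub> z) \<in> add_hom ?T M" if "z \<in> carrier M" for z
    using mh that by (auto simp: add_hom_def Pi_iff M.smult_l_distr)
  have r: "(\<lambda>X. h \<odot>\<^bsub>M\<^esub> ?g X) \<in> add_hom ?T M" if "h \<in> carrier H" for h
    using gh that by (auto simp: add_hom_def Pi_iff M.smult_r_distr)
  note [simp] = add_hom_closed[OF gh] add_hom_closed[OF mh] bal2D(2)[OF g] bal2D(2)[OF m]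
  have 1: "?g (tt x y \<otimes>\<^bsub>?T\<^esub> Y) = m x y \<odot>\<^bsub>M\<^esub> ?g Y \<oplus>\<^bsub>M\<^esub> ?m Y \<odot>\<^bsub>M\<^esub> g x y"
    if xy: "x \<in> carrier H" "y \<in> carrier H" and Y: "Y \<in> carrier ?T" for x y Y
    by (rule tensor2_eqI[OF aM add_hom_compose[OF tensor2_mult_hom2[OF xy] gh] add_hom_sum[OF aM r l] _ Y])
      (use xy in \<open>simp_all add: tensor2_mult_tens lift2_tens[OF aM g] lift2_tens[OF aH m] leibniz\<close>)
  have 2: "?g (X \<otimes>\<^bsub>?T\<^esub> Y) = ?m X \<odot>\<^bsub>M\<^esub> ?g Y \<oplus>\<^bsub>M\<^esub> ?m Y \<odot>\<^bsub>M\<^esub> ?g X"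
    if Y: "Y \<in> carrier ?T" and X: "X \<in> carrier ?T" for X Y
    by (rule tensor2_eqI[OF aM add_hom_compose[OF tensor2_mult_hom1[OF Y] gh] add_hom_sum[OF aM l r] _ X])
      (use Y in \<open>simp_all add: 1 lift2_tens[OF aM g] lift2_tens[OF aH m]\<close>)
  show ?thesis unfolding sweedler_def using u v by (simp add: comult_mult 2)
qed

text \<open>
  Coassociativity in the form \<open>h(u\<^sub>1, (u\<^sub>2)\<^sub>1, (u\<^sub>2)\<^sub>2) = h((u\<^sub>1)\<^sub>1, (u\<^sub>1)\<^sub>2, u\<^sub>2)\<close>. A map \<open>h\<close> that is additive in
  each argument and balanced between neighbours factors through the map \<open>\<Phi>\<close> on \<open>\<H> \<otimes>\<^sub>A (\<H> \<otimes>\<^sub>A \<H>)\<close> below;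
  applying \<open>\<Phi>\<close> to both sides of the coassociativity axiom gives the two sides of the equation.
\<close>

lemma sweedler_coassoc:
  assumes P: "abelian_group P"
    and h: "\<And>x y z. x \<in> carrier H \<Longrightarrow> y \<in> carrier H \<Longrightarrow> z \<in> carrier H \<Longrightarrow> h x y z \<in> carrier P"
    "\<And>x x' y z. x \<in> carrier H \<Longrightarrow> x' \<in> carrier H \<Longrightarrow> y \<in> carrier H \<Longrightarrow> z \<in> carrier H \<Longrightarrow>
      h (x \<oplus>\<^bsub>H\<^esub> x') y z = h x y z \<oplus>\<^bsub>P\<^esub> h x' y z"
    "\<And>x y y' z. x \<in> carrier H \<Longrightarrow> y \<in> carrier H \<Longrightarrow> y' \<in> carrier H \<Longrightarrow> z \<in> carrier H \<Longrightarrow>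
      h x (y \<oplus>\<^bsub>H\<^esub> y') z = h x y z \<oplus>\<^bsub>P\<^esub> h x y' z"
    "\<And>x y z z'. x \<in> carrier H \<Longrightarrow> y \<in> carrier H \<Longrightarrow> z \<in> carrier H \<Longrightarrow> z' \<in> carrier H \<Longrightarrow>
      h x y (z \<oplus>\<^bsub>H\<^esub> z') = h x y z \<oplus>\<^bsub>P\<^esub> h x y z'"
    "\<And>a x y z. a \<in> carrier A \<Longrightarrow> x \<in> carrier H \<Longrightarrow> y \<in> carrier H \<Longrightarrow> z \<in> carrier H \<Longrightarrow>
      h (tgt H a \<otimes>\<^bsub>H\<^esub> x) y z = h x (src H a \<otimes>\<^bsub>H\<^esub> y) z"
    "\<And>a x y z. a \<in> carrier A \<Longrightarrow> x \<in> carrier H \<Longrightarrow> y \<in> carrier H \<Longrightarrow> z \<in> carrier H \<Longrightarrow>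
      h x (tgt H a \<otimes>\<^bsub>H\<^esub> y) z = h x y (src H a \<otimes>\<^bsub>H\<^esub> z)"
    and u: "u \<in> carrier H"
  shows "sweedler H P (\<lambda>x w. sweedler H P (h x) w) u = sweedler H P (\<lambda>w z. sweedler H P (\<lambda>x y. h x y z) w) u"
proof -
  let ?T = "tensor2 A H" and ?L = "tensor2_left A H" and ?R = "tensor2_right A H"
  let ?T3 = "tensor A (tgt_module H) ?L"
  interpret P: abelian_group P by fact
  note aT = abelian_group_tensor2
  have simps: "carrier ?L = carrier ?T" "ring.add ?L = ring.add ?T" "carrier ?R = carrier ?T" "ring.add ?R = ring.add ?T"
    by (simp_all add: tensor2_left_def tensor2_right_def)
  interpret L: tensor_factors A "tgt_module H" ?L
    by (rule tensor_factors.intro)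
      (use add_hom_closed[OF left_hom] abelian_group_with_smult[OF aT] tgt.abelian_group_axioms
        in \<open>simp_all add: simps tensor2_left_def\<close>)
  interpret R: tensor_factors A ?R "src_module H"
    by (rule tensor_factors.intro)
      (use add_hom_closed[OF right_hom] abelian_group_with_smult[OF aT] src.abelian_group_axioms
        in \<open>simp_all add: simps tensor2_right_def\<close>)
  note aL = L.abelian_group_tensor
  let ?tL = "tens A (tgt_module H) ?L" and ?tR = "tens A ?R (src_module H)"
  note tL = balancedD(3-6)[OF L.balanced_tens, unfolded simps, simplified]
  have b1: "bal2 A H P (h x)" if "x \<in> carrier H" for x
    using h that by (intro bal2I) auto
  have b2: "bal2 A H P (\<lambda>x y. h x y z)" if "z \<in> carrier H" for z
    using h that by (intro bal2I) auto
  have Lam: "balanced A (tgt_module H) ?L P (\<lambda>x Y. tensor_lift P (h x) Y)"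
  proof (intro balancedI add_homI; unfold simps tgt_module_simps)
    fix x Y assume "x \<in> carrier H" "Y \<in> carrier ?T"
    then show "tensor_lift P (h x) Y \<in> carrier P" using add_hom_closed[OF lift2_hom[OF P b1]] by simp
  next
    fix x Y Y' assume "x \<in> carrier H" "Y \<in> carrier ?T" "Y' \<in> carrier ?T"
    then show "tensor_lift P (h x) (Y \<oplus>\<^bsub>?T\<^esub> Y') = tensor_lift P (h x) Y \<oplus>\<^bsub>P\<^esub> tensor_lift P (h x) Y'"
      using add_hom_add[OF lift2_hom[OF P b1]] by simp
  next
    fix Y x assume "Y \<in> carrier ?T" "x \<in> carrier H"
    then show "tensor_lift P (h x) Y \<in> carrier P" using add_hom_closed[OF lift2_hom[OF P b1]] by simp
  next
    fix Y x x' assume "Y \<in> carrier ?T" "x \<in> carrier H" "x' \<in> carrier H"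
    then show "tensor_lift P (h (x \<oplus>\<^bsub>H\<^esub> x')) Y = tensor_lift P (h x) Y \<oplus>\<^bsub>P\<^esub> tensor_lift P (h x') Y"
      by (intro tensor2_lift_add[OF P b1 b1 b1]) (auto simp: h)
  next
    fix a x Y assume a: "a \<in> carrier A" and x: "x \<in> carrier H" and Y: "Y \<in> carrier ?T"
    show "tensor_lift P (h (tgt H a \<otimes>\<^bsub>H\<^esub> x)) Y = tensor_lift P (h x) (a \<odot>\<^bsub>?L\<^esub> Y)"
      by (rule tensor2_eqI[OF P lift2_hom[OF P b1] add_hom_compose[OF left_hom[OF a] lift2_hom[OF P b1]] _ Y])
        (use a x in \<open>simp_all add: left_tens lift2_tens[OF P b1] h\<close>)
  qed
  define \<Phi> where "\<Phi> = tensor_lift P (\<lambda>x Y. tensor_lift P (h x) Y)"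
  have \<Phi>_hom: "\<Phi> \<in> add_hom ?T3 P" unfolding \<Phi>_def by (rule L.tensor_lift_hom[OF P Lam])
  have \<Phi>_tens: "\<Phi> (?tL x Y) = tensor_lift P (h x) Y" if "x \<in> carrier H" "Y \<in> carrier ?T" for x Y
    unfolding \<Phi>_def using L.tensor_lift_tens[OF P Lam] that by (simp add: simps)
  have tLc: "?tL x Y \<in> carrier ?T3" if "x \<in> carrier H" "Y \<in> carrier ?T" for x Y
    using L.tens_closed[of x Y] that by (simp add: simps)

  have map1: "tensor_map A (tgt_module H) ?L (\<lambda>v. v) (comult H) \<in> add_hom ?T ?T3"
    "\<And>x y. x \<in> carrier H \<Longrightarrow> y \<in> carrier H \<Longrightarrow>
      tensor_map A (tgt_module H) ?L (\<lambda>v. v) (comult H) (tt x y) = ?tL x (comult H y)"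
  proof -
    have c: "comult H \<in> add_hom (src_module H) ?L" using comult_add_hom by (simp add: add_hom_def simps)
    have b: "?tL (a \<odot>\<^bsub>tgt_module H\<^esub> x) (comult H y) = ?tL x (comult H (a \<odot>\<^bsub>src_module H\<^esub> y))"
      if "a \<in> carrier A" "x \<in> carrier (tgt_module H)" "y \<in> carrier (src_module H)" for a x y
      using that by (simp add: comult_left tL)
    show "tensor_map A (tgt_module H) ?L (\<lambda>v. v) (comult H) \<in> add_hom ?T ?T3"
      unfolding tensor2_def[of A H] by (rule tensor_map_hom[OF T2.tensor_factors_axioms L.tensor_factors_axioms add_hom_ident c b])
    show "tensor_map A (tgt_module H) ?L (\<lambda>v. v) (comult H) (tt x y) = ?tL x (comult H y)"
      if "x \<in> carrier H" "y \<in> carrier H" for x y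
      using tensor_map_tens[OF T2.tensor_factors_axioms L.tensor_factors_axioms add_hom_ident c b] that by simp
  qed
  have map2: "tensor_map A ?R (src_module H) (comult H) (\<lambda>v. v) \<in> add_hom ?T (tensor A ?R (src_module H))"
    "\<And>x y. x \<in> carrier H \<Longrightarrow> y \<in> carrier H \<Longrightarrow>
      tensor_map A ?R (src_module H) (comult H) (\<lambda>v. v) (tt x y) = ?tR (comult H x) y"
  proof -
    have c: "comult H \<in> add_hom (tgt_module H) ?R" using comult_add_hom by (simp add: add_hom_def simps)
    have b: "?tR (comult H (a \<odot>\<^bsub>tgt_module H\<^esub> x)) y = ?tR (comult H x) (a \<odot>\<^bsub>src_module H\<^esub> y)"
      if "a \<in> carrier A" "x \<in> carrier (tgt_module H)" "y \<in> carrier (src_module H)" for a x y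
      using that comult_right[of a x] balancedD(3)[OF R.balanced_tens, of a "comult H x" y]
      by (simp add: H.m_comm[of "tgt H a" x] simps)
    show "tensor_map A ?R (src_module H) (comult H) (\<lambda>v. v) \<in> add_hom ?T (tensor A ?R (src_module H))"
      unfolding tensor2_def[of A H] by (rule tensor_map_hom[OF T2.tensor_factors_axioms R.tensor_factors_axioms c add_hom_ident b])
    show "tensor_map A ?R (src_module H) (comult H) (\<lambda>v. v) (tt x y) = ?tR (comult H x) y"
      if "x \<in> carrier H" "y \<in> carrier H" for x y
      using tensor_map_tens[OF T2.tensor_factors_axioms R.tensor_factors_axioms c add_hom_ident b] that by simp
  qed

  \<comment> \<open>\<open>\<alpha>\<close> is the map that the associativity isomorphism lifts.\<close>
  define \<alpha> where "\<alpha> X w = tensor_lift ?T3 (\<lambda>u v. ?tL u (tt v w)) X" for X w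
  have \<alpha>b: "bal2 A H ?T3 (\<lambda>u v. ?tL u (tt v w))" if "w \<in> carrier H" for w
    by (rule bal2I) (use that in \<open>simp_all add: tLc tL tt_balanced left_tens\<close>)
  have \<alpha>_hom: "(\<lambda>X. \<alpha> X w) \<in> add_hom ?T ?T3" if "w \<in> carrier H" for w
    unfolding \<alpha>_def by (rule lift2_hom[OF aL \<alpha>b[OF that]])
  have \<alpha>_tens: "\<alpha> (tt x y) w = ?tL x (tt y w)" if "x \<in> carrier H" "y \<in> carrier H" "w \<in> carrier H" for x y w
    unfolding \<alpha>_def using that by (simp add: lift2_tens[OF aL \<alpha>b])
  have \<alpha>2: "balanced A ?R (src_module H) ?T3 \<alpha>"
  proof (intro balancedI add_homI; unfold simps src_module_simps)
    fix X w assume "X \<in> carrier ?T" "w \<in> carrier H"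
    then show "\<alpha> X w \<in> carrier ?T3" using add_hom_closed[OF \<alpha>_hom] by simp
  next
    fix X w w' assume *: "X \<in> carrier ?T" "w \<in> carrier H" "w' \<in> carrier H"
    then show "\<alpha> X (w \<oplus>\<^bsub>H\<^esub> w') = \<alpha> X w \<oplus>\<^bsub>?T3\<^esub> \<alpha> X w'"
      unfolding \<alpha>_def by (intro tensor2_lift_add[OF aL \<alpha>b \<alpha>b \<alpha>b]) (auto simp: tL tt_balanced)
  next
    fix w X assume "w \<in> carrier H" "X \<in> carrier ?T"
    then show "\<alpha> X w \<in> carrier ?T3" using add_hom_closed[OF \<alpha>_hom] by simp
  next
    fix w X X' assume "w \<in> carrier H" "X \<in> carrier ?T" "X' \<in> carrier ?T"
    then show "\<alpha> (X \<oplus>\<^bsub>?T\<^esub> X') w = \<alpha> X w \<oplus>\<^bsub>?T3\<^esub> \<alpha> X' w" using add_hom_add[OF \<alpha>_hom] by simp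
  next
    fix a X w assume a: "a \<in> carrier A" and X: "X \<in> carrier ?T" and w: "w \<in> carrier H"
    have "?tL x (tt (y \<otimes>\<^bsub>H\<^esub> tgt H a) w) = ?tL x (tt y (src H a \<otimes>\<^bsub>H\<^esub> w))" if "x \<in> carrier H" "y \<in> carrier H" for x y
      using that a w by (simp add: H.m_comm[of y "tgt H a"] tt_balanced)
    then show "\<alpha> (a \<odot>\<^bsub>?R\<^esub> X) w = \<alpha> X (src H a \<otimes>\<^bsub>H\<^esub> w)"
      by (intro tensor2_eqI[OF aL add_hom_compose[OF right_hom[OF a] \<alpha>_hom] \<alpha>_hom _ X])
        (use a w in \<open>simp_all add: right_tens \<alpha>_tens\<close>)
  qed
  have assoc: "tensor3_assoc A H = tensor_lift ?T3 \<alpha>"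
    by (simp add: tensor3_assoc_def Let_def \<alpha>_def[abs_def])

  have "\<Phi> (tensor3_assoc A H (tensor_map A ?R (src_module H) (comult H) (\<lambda>v. v) (comult H u))) =
      \<Phi> (tensor_map A (tgt_module H) ?L (\<lambda>v. v) (comult H) (comult H u))"
    using coassoc[OF u] by simp
  moreover have "\<Phi> (tensor_map A (tgt_module H) ?L (\<lambda>v. v) (comult H) X) =
      tensor_lift P (\<lambda>x w. sweedler H P (h x) w) X" if X: "X \<in> carrier ?T" for X
  proof -
    have b: "bal2 A H P (\<lambda>x w. tensor_lift P (h x) (comult H w))"
      by (rule bal2I) (use balancedD(3-6)[OF Lam] in \<open>simp_all add: simps comult_left add_hom_add[OF comult_add_hom]\<close>)
    show ?thesis unfolding sweedler_def
      by (rule tensor2_eqI[OF P add_hom_compose[OF map1(1) \<Phi>_hom] lift2_hom[OF P b] _ X])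
        (simp_all add: lift2_tens[OF P b] map1 \<Phi>_tens)
  qed
  moreover have "\<Phi> (tensor3_assoc A H (tensor_map A ?R (src_module H) (comult H) (\<lambda>v. v) X)) =
      tensor_lift P (\<lambda>w z. sweedler H P (\<lambda>x y. h x y z) w) X" if X: "X \<in> carrier ?T" for X
  proof -
    have \<Phi>\<alpha>: "\<Phi> (\<alpha> Y z) = tensor_lift P (\<lambda>x y. h x y z) Y" if "Y \<in> carrier ?T" "z \<in> carrier H" for Y z
      by (rule tensor2_eqI[OF P add_hom_compose[OF \<alpha>_hom \<Phi>_hom] lift2_hom[OF P b2]])
        (use that in \<open>simp_all add: \<alpha>_tens \<Phi>_tens lift2_tens[OF P b1] lift2_tens[OF P b2]\<close>)
    have b: "bal2 A H P (\<lambda>w z. \<Phi> (\<alpha> (comult H w) z))"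
    proof -
      have "balanced A ?R (src_module H) P (\<lambda>X w. \<Phi> (\<alpha> X w))" by (rule balanced_compose[OF \<alpha>2 \<Phi>_hom])
      note b = balancedD(3-6)[OF this, unfolded simps, simplified]
      show ?thesis
        using b comult_right H.m_comm by (intro bal2I) (simp_all add: add_hom_add[OF comult_add_hom])
    qed
    have "\<Phi> (tensor3_assoc A H (tensor_map A ?R (src_module H) (comult H) (\<lambda>v. v) X)) =
        tensor_lift P (\<lambda>w z. \<Phi> (\<alpha> (comult H w) z)) X"
      unfolding assoc
      by (rule tensor2_eqI[OF P add_hom_compose[OF map2(1) add_hom_compose[OF R.tensor_lift_hom[OF aL \<alpha>2] \<Phi>_hom]] lift2_hom[OF P b] _ X])
        (simp_all add: lift2_tens[OF P b] map2 R.tensor_lift_tens[OF aL \<alpha>2] simps)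
    also have "\<dots> = tensor_lift P (\<lambda>w z. sweedler H P (\<lambda>x y. h x y z) w) X"
      by (rule tensor2_lift_cong[OF P b _ X]) (simp add: \<Phi>\<alpha> sweedler_def)
    finally show ?thesis .
  qed
  ultimately show ?thesis unfolding sweedler_def[of H P _ u] using u by simp
qed

end

section \<open>Derivations that vanish on the source\<close>

text \<open>
  \<open>Der_s\<close> without linearity over the field, which \<open>Der_s_iff\<close> recovers from \<open>c u = s(c 1) u\<close>, and
  without extensionality, so that compositions need not be restricted to the carrier.
\<close>

definition s_derivation ::
    "('k, 'a, 'y) module_scheme \<Rightarrow> ('k, 'a, 'h, 'z) hopf_algebroid_scheme \<Rightarrow> ('h, 'm, 'x) module_scheme \<Rightarrow> ('h \<Rightarrow> 'm) \<Rightarrow> bool"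
  where "s_derivation A H M \<delta> \<longleftrightarrow> \<delta> \<in> add_hom H M \<and>
    (\<forall>u\<in>carrier H. \<forall>v\<in>carrier H. \<delta> (u \<otimes>\<^bsub>H\<^esub> v) = u \<odot>\<^bsub>M\<^esub> \<delta> v \<oplus>\<^bsub>M\<^esub> v \<odot>\<^bsub>M\<^esub> \<delta> u) \<and>
    (\<forall>a\<in>carrier A. \<delta> (src H a) = \<zero>\<^bsub>M\<^esub>)"

lemma s_derivationD:
  assumes "s_derivation A H M \<delta>"
  shows "\<delta> \<in> add_hom H M"
    and "u \<in> carrier H \<Longrightarrow> \<delta> u \<in> carrier M"
    and "u \<in> carrier H \<Longrightarrow> v \<in> carrier H \<Longrightarrow> \<delta> (u \<oplus>\<^bsub>H\<^esub> v) = \<delta> u \<oplus>\<^bsub>M\<^esub> \<delta> v"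
    and "u \<in> carrier H \<Longrightarrow> v \<in> carrier H \<Longrightarrow> \<delta> (u \<otimes>\<^bsub>H\<^esub> v) = u \<odot>\<^bsub>M\<^esub> \<delta> v \<oplus>\<^bsub>M\<^esub> v \<odot>\<^bsub>M\<^esub> \<delta> u"
    and "a \<in> carrier A \<Longrightarrow> \<delta> (src H a) = \<zero>\<^bsub>M\<^esub>"
  using assms by (auto simp: s_derivation_def add_hom_def Pi_iff)

context commutative_hopf_algebroid begin

lemma s_derivation_src:
  assumes M: "module H M" and \<delta>: "s_derivation A H M \<delta>" and "a \<in> carrier A" "u \<in> carrier H"
  shows "\<delta> (src H a \<otimes>\<^bsub>H\<^esub> u) = src H a \<odot>\<^bsub>M\<^esub> \<delta> u"
proof -
  interpret M: module H M by fact
  show ?thesis using assms(3,4) by (simp add: s_derivationD[OF \<delta>])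
qed

lemma field_smult_src:
  assumes "c \<in> carrier k" "u \<in> carrier H"
  shows "c \<odot>\<^bsub>A\<^esub> \<one>\<^bsub>A\<^esub> \<in> carrier A" "c \<odot>\<^bsub>H\<^esub> \<one>\<^bsub>H\<^esub> = src H (c \<odot>\<^bsub>A\<^esub> \<one>\<^bsub>A\<^esub>)"
    "c \<odot>\<^bsub>H\<^esub> u = src H (c \<odot>\<^bsub>A\<^esub> \<one>\<^bsub>A\<^esub>) \<otimes>\<^bsub>H\<^esub> u"
proof -
  interpret Ak: algebra k A by (rule base_algebra)
  show 1: "c \<odot>\<^bsub>A\<^esub> \<one>\<^bsub>A\<^esub> \<in> carrier A" using assms by simp
  have "src H (c \<odot>\<^bsub>A\<^esub> \<one>\<^bsub>A\<^esub>) = c \<odot>\<^bsub>H\<^esub> src H \<one>\<^bsub>A\<^esub>" using src_hom assms by (simp add: alg_hom_def)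
  then show 2: "c \<odot>\<^bsub>H\<^esub> \<one>\<^bsub>H\<^esub> = src H (c \<odot>\<^bsub>A\<^esub> \<one>\<^bsub>A\<^esub>)" by simp
  show "c \<odot>\<^bsub>H\<^esub> u = src H (c \<odot>\<^bsub>A\<^esub> \<one>\<^bsub>A\<^esub>) \<otimes>\<^bsub>H\<^esub> u"
    using assms Hk.smult_assoc2[of c "\<one>\<^bsub>H\<^esub>" u] by (simp flip: 2)
qed

lemma Der_s_iff:
  assumes M: "module H M"
  shows "\<delta> \<in> Der_s k A H M \<longleftrightarrow> \<delta> \<in> extensional (carrier H) \<and> s_derivation A H M \<delta>"
proof
  assume "\<delta> \<in> Der_s k A H M"
  then show "\<delta> \<in> extensional (carrier H) \<and> s_derivation A H M \<delta>"
    by (auto simp: Der_s_def s_derivation_def add_hom_def PiE_def)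
next
  assume *: "\<delta> \<in> extensional (carrier H) \<and> s_derivation A H M \<delta>"
  then have \<delta>: "s_derivation A H M \<delta>" by simp
  have "\<delta> (c \<odot>\<^bsub>H\<^esub> u) = (c \<odot>\<^bsub>H\<^esub> \<one>\<^bsub>H\<^esub>) \<odot>\<^bsub>M\<^esub> \<delta> u" if "c \<in> carrier k" "u \<in> carrier H" for c u
    using s_derivation_src[OF M \<delta> field_smult_src(1)[OF that] that(2)] field_smult_src[OF that] by simp
  then show "\<delta> \<in> Der_s k A H M"
    using * by (auto simp: Der_s_def PiE_def s_derivationD[OF \<delta>])
qed

lemma s_derivation_restrict:
  "s_derivation A H M \<delta> \<Longrightarrow> s_derivation A H M (restrict \<delta> (carrier H))"
  by (auto simp: s_derivation_def add_hom_def)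

lemma restrict_Der_s:
  "module H M \<Longrightarrow> s_derivation A H M \<delta> \<Longrightarrow> restrict \<delta> (carrier H) \<in> Der_s k A H M"
  by (simp add: Der_s_iff s_derivation_restrict)

section \<open>Indecomposables\<close>

abbreviation "I \<equiv> aug_ideal A H"
abbreviation "J \<equiv> aug_ideal_sq A H"
abbreviation "Q \<equiv> Q_module A H"
abbreviation "proj \<equiv> Q_proj A H"

lemma ideal_I: "ideal I H"
  unfolding aug_ideal_def 
  by (rule ring_hom_ring.kernel_is_ideal[OF ring_hom_ringI2[OF H.ring_axioms A.ring_axioms structure_homs(3)]])

sublocale J: ideal J H
  unfolding aug_ideal_sq_def by (rule H.ideal_prod_is_ideal[OF ideal_I ideal_I])

lemma mem_I: "u \<in> I \<longleftrightarrow> u \<in> carrier H \<and> counit H u = \<zero>\<^bsub>A\<^esub>"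
  unfolding aug_ideal_def a_kernel_def kernel_def by (simp only: mem_Collect_eq monoid.simps partial_object.simps)

lemma J_sub: "J \<subseteq> carrier H"
  by (rule J.a_subset)

lemma src_zero [simp]: "src H \<zero>\<^bsub>A\<^esub> = \<zero>\<^bsub>H\<^esub>" and tgt_zero [simp]: "tgt H \<zero>\<^bsub>A\<^esub> = \<zero>\<^bsub>H\<^esub>"
  and counit_zero [simp]: "counit H \<zero>\<^bsub>H\<^esub> = \<zero>\<^bsub>A\<^esub>"
  using add_hom_zero[of H A "counit H"] add_hom_zero[of A H "src H"] add_hom_zero[of A H "tgt H"] A.abelian_group_axioms H.abelian_group_axioms
  by (auto simp: add_hom_def)

text \<open>
  The component of \<open>u\<close> in the augmentation ideal under \<open>\<H> = s(A) \<oplus> \<I>\<close>.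
\<close>

definition "reduced u = u \<ominus>\<^bsub>H\<^esub> src H (counit H u)"

lemma reduced_closed [simp]: "u \<in> carrier H \<Longrightarrow> reduced u \<in> carrier H"
  by (simp add: reduced_def)

lemma src_minus: "a \<in> carrier A \<Longrightarrow> src H (\<ominus>\<^bsub>A\<^esub> a) = \<ominus>\<^bsub>H\<^esub> src H a"
proof -
  assume a: "a \<in> carrier A"
  have "src H (\<ominus>\<^bsub>A\<^esub> a) \<oplus>\<^bsub>H\<^esub> src H a = src H (\<ominus>\<^bsub>A\<^esub> a \<oplus>\<^bsub>A\<^esub> a)" using a by simp
  also have "\<dots> = \<zero>\<^bsub>H\<^esub>" using a by (simp only: A.l_neg src_zero)
  finally show ?thesis using a by (simp add: H.minus_equality)
qed

lemma reduced_I: "u \<in> carrier H \<Longrightarrow> reduced u \<in> I"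
  by (simp add: mem_I reduced_def a_minus_def A.r_neg flip: src_minus)

lemma proj_reduced: "proj u = J +>\<^bsub>H\<^esub> reduced u"
  by (simp add: Q_proj_def reduced_def)

lemma Q_simps:
  "carrier Q = (\<lambda>u. J +>\<^bsub>H\<^esub> u) ` I" "ring.add Q = set_add H" "\<zero>\<^bsub>Q\<^esub> = J"
  "smult Q = (\<lambda>a X. rcoset_mult H J (J +>\<^bsub>H\<^esub> src H a) X)"
  by (simp_all add: Q_module_def Let_def FactRing_def)

lemma proj_closed [simp]: "u \<in> carrier H \<Longrightarrow> proj u \<in> carrier Q"
  by (simp add: proj_reduced Q_simps reduced_I)

lemma proj_surj:
  assumes "X \<in> carrier Q"
  obtains u where "u \<in> carrier H" "X = proj u"
proof -
  obtain u where u: "u \<in> I" "X = J +>\<^bsub>H\<^esub> u" using assms by (auto simp: Q_simps)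
  have "X = proj u" using u by (simp add: proj_reduced reduced_def mem_I a_minus_def)
  then show ?thesis using u mem_I that by blast
qed

lemma proj_eq_iff: "u \<in> carrier H \<Longrightarrow> v \<in> carrier H \<Longrightarrow> proj u = proj v \<longleftrightarrow> reduced u \<ominus>\<^bsub>H\<^esub> reduced v \<in> J"
  unfolding proj_reduced by (rule H.quotient_eq_iff_same_a_r_cos[OF J.ideal_axioms, symmetric]) auto

lemma proj_add: "u \<in> carrier H \<Longrightarrow> v \<in> carrier H \<Longrightarrow> proj (u \<oplus>\<^bsub>H\<^esub> v) = proj u \<oplus>\<^bsub>Q\<^esub> proj v"
proof -
  assume uv: "u \<in> carrier H" "v \<in> carrier H"
  have "reduced (u \<oplus>\<^bsub>H\<^esub> v) = reduced u \<oplus>\<^bsub>H\<^esub> reduced v"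
    using uv by (simp add: reduced_def a_minus_def H.minus_add H.a_ac)
  then show ?thesis using uv by (simp add: proj_reduced Q_simps J.a_rcos_sum)
qed

lemma proj_smult: "a \<in> carrier A \<Longrightarrow> u \<in> carrier H \<Longrightarrow> proj (src H a \<otimes>\<^bsub>H\<^esub> u) = a \<odot>\<^bsub>Q\<^esub> proj u"
proof -
  assume au: "a \<in> carrier A" "u \<in> carrier H"
  have "reduced (src H a \<otimes>\<^bsub>H\<^esub> u) = src H a \<otimes>\<^bsub>H\<^esub> reduced u"
    using au by (simp add: reduced_def a_minus_def H.r_distr H.r_minus)
  then show ?thesis using au by (simp add: proj_reduced Q_simps J.rcoset_mult_add)
qed

text \<open>
  The difference of the two sides is the class of \<open>(u - s(\<epsilon>(u))) (v - s(\<epsilon>(v))) \<in> \<I>\<^sup>2\<close>.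
\<close>

lemma proj_mult:
  assumes "u \<in> carrier H" "v \<in> carrier H"
  shows "proj (u \<otimes>\<^bsub>H\<^esub> v) = counit H u \<odot>\<^bsub>Q\<^esub> proj v \<oplus>\<^bsub>Q\<^esub> counit H v \<odot>\<^bsub>Q\<^esub> proj u"
proof -
  let ?a = "src H (counit H u)" and ?b = "src H (counit H v)"
  have "reduced (u \<otimes>\<^bsub>H\<^esub> v) \<ominus>\<^bsub>H\<^esub> reduced (?a \<otimes>\<^bsub>H\<^esub> v \<oplus>\<^bsub>H\<^esub> ?b \<otimes>\<^bsub>H\<^esub> u) = reduced u \<otimes>\<^bsub>H\<^esub> reduced v"
  proof -
    obtain a b where ab: "a = ?a" "b = ?b" "a \<in> carrier H" "b \<in> carrier H" using assms by simp
    have "(u \<otimes>\<^bsub>H\<^esub> v \<ominus>\<^bsub>H\<^esub> a \<otimes>\<^bsub>H\<^esub> b) \<ominus>\<^bsub>H\<^esub> ((a \<otimes>\<^bsub>H\<^esub> v \<oplus>\<^bsub>H\<^esub> b \<otimes>\<^bsub>H\<^esub> u) \<ominus>\<^bsub>H\<^esub> (a \<otimes>\<^bsub>H\<^esub> b \<oplus>\<^bsub>H\<^esub> b \<otimes>\<^bsub>H\<^esub> a)) =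
        (u \<ominus>\<^bsub>H\<^esub> a) \<otimes>\<^bsub>H\<^esub> (v \<ominus>\<^bsub>H\<^esub> b)"
      using assms ab(3,4) by algebra
    then show ?thesis using assms by (simp add: reduced_def ab(1,2))
  qed
  also have "\<dots> \<in> J" using assms by (simp add: aug_ideal_sq_def reduced_I ideal_prod.prod)
  finally have "proj (u \<otimes>\<^bsub>H\<^esub> v) = proj (?a \<otimes>\<^bsub>H\<^esub> v \<oplus>\<^bsub>H\<^esub> ?b \<otimes>\<^bsub>H\<^esub> u)"
    using assms by (simp add: proj_eq_iff)
  then show ?thesis using assms by (simp add: proj_add proj_smult)
qed

lemma proj_zero: "proj \<zero>\<^bsub>H\<^esub> = \<zero>\<^bsub>Q\<^esub>"
  by (simp add: proj_reduced reduced_def Q_simps a_minus_def J.a_rcos_const J.zero_closed)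

lemma module_Q: "module A Q"
proof (rule moduleI)
  show "abelian_group Q"
  proof (rule abelian_groupI)
    fix X Y Z assume "X \<in> carrier Q" "Y \<in> carrier Q" "Z \<in> carrier Q"
    then obtain u v w where "u \<in> carrier H" "X = proj u" "v \<in> carrier H" "Y = proj v" "w \<in> carrier H" "Z = proj w"
      by (meson proj_surj)
    then show "X \<oplus>\<^bsub>Q\<^esub> Y \<oplus>\<^bsub>Q\<^esub> Z = X \<oplus>\<^bsub>Q\<^esub> (Y \<oplus>\<^bsub>Q\<^esub> Z)"
      by (simp add: H.a_ac flip: proj_add)
  next
    fix X Y assume "X \<in> carrier Q" "Y \<in> carrier Q"
    then obtain u v where "u \<in> carrier H" "X = proj u" "v \<in> carrier H" "Y = proj v" by (meson proj_surj)
    then show "X \<oplus>\<^bsub>Q\<^esub> Y \<in> carrier Q" "X \<oplus>\<^bsub>Q\<^esub> Y = Y \<oplus>\<^bsub>Q\<^esub> X"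
      by (simp_all add: H.a_comm flip: proj_add)
  next
    fix X assume "X \<in> carrier Q"
    then obtain u where u: "u \<in> carrier H" "X = proj u" by (meson proj_surj)
    then show "\<zero>\<^bsub>Q\<^esub> \<oplus>\<^bsub>Q\<^esub> X = X" by (simp flip: proj_add proj_zero)
    have "proj (\<ominus>\<^bsub>H\<^esub> u) \<oplus>\<^bsub>Q\<^esub> X = \<zero>\<^bsub>Q\<^esub>" using u by (simp add: H.l_neg flip: proj_add proj_zero)
    then show "\<exists>Y\<in>carrier Q. Y \<oplus>\<^bsub>Q\<^esub> X = \<zero>\<^bsub>Q\<^esub>" using u by (intro bexI[of _ "proj (\<ominus>\<^bsub>H\<^esub> u)"]) auto
  next
    show "\<zero>\<^bsub>Q\<^esub> \<in> carrier Q" by (simp flip: proj_zero)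
  qed
next
  fix a X assume "a \<in> carrier A" "X \<in> carrier Q"
  then show "a \<odot>\<^bsub>Q\<^esub> X \<in> carrier Q" by (auto elim!: proj_surj simp flip: proj_smult)
next
  fix a b X assume "a \<in> carrier A" "b \<in> carrier A" "X \<in> carrier Q"
  then show "(a \<oplus>\<^bsub>A\<^esub> b) \<odot>\<^bsub>Q\<^esub> X = a \<odot>\<^bsub>Q\<^esub> X \<oplus>\<^bsub>Q\<^esub> b \<odot>\<^bsub>Q\<^esub> X"
    by (auto elim!: proj_surj simp: H.l_distr simp flip: proj_smult proj_add)
next
  fix a X Y assume "a \<in> carrier A" "X \<in> carrier Q" "Y \<in> carrier Q"
  then show "a \<odot>\<^bsub>Q\<^esub> (X \<oplus>\<^bsub>Q\<^esub> Y) = a \<odot>\<^bsub>Q\<^esub> X \<oplus>\<^bsub>Q\<^esub> a \<odot>\<^bsub>Q\<^esub> Y"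
    by (auto elim!: proj_surj simp: H.r_distr simp flip: proj_smult proj_add)
next
  fix a b X assume "a \<in> carrier A" "b \<in> carrier A" "X \<in> carrier Q"
  then show "(a \<otimes>\<^bsub>A\<^esub> b) \<odot>\<^bsub>Q\<^esub> X = a \<odot>\<^bsub>Q\<^esub> (b \<odot>\<^bsub>Q\<^esub> X)"
    by (auto elim!: proj_surj simp: H.m_assoc simp flip: proj_smult)
next
  fix X assume "X \<in> carrier Q"
  then show "\<one>\<^bsub>A\<^esub> \<odot>\<^bsub>Q\<^esub> X = X"
    by (auto elim!: proj_surj simp flip: proj_smult)
qed (rule A.is_cring)

sublocale Q: module A Q by (rule module_Q)

lemma proj_hom: "proj \<in> add_hom H Q"
  by (simp add: add_hom_def proj_add)

lemma proj_src: "a \<in> carrier A \<Longrightarrow> proj (src H a) = \<zero>\<^bsub>Q\<^esub>"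
  by (simp add: proj_reduced reduced_def Q_simps a_minus_def H.r_neg J.a_rcos_const J.zero_closed)

text \<open>
  The universal property of \<open>\<pi>\<close>: every derivation that is linear over \<open>s\<close>, into an \<open>A\<close>-module
  on which \<open>\<H>\<close> acts through \<open>\<epsilon>\<close>, factors through \<open>\<pi>\<close>, because the Leibniz rule makes it vanish on products of two elements of \<open>\<I>\<close>. The
  factorization has the same form as \<open>Q_map\<close>.
\<close>

lemma
  assumes N: "module A N" and f: "f \<in> add_hom H N"
    and src: "\<And>a u. a \<in> carrier A \<Longrightarrow> u \<in> carrier H \<Longrightarrow> f (src H a \<otimes>\<^bsub>H\<^esub> u) = a \<odot>\<^bsub>N\<^esub> f u"
    and leibniz: "\<And>u v. u \<in> carrier H \<Longrightarrow> v \<in> carrier H \<Longrightarrow>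
      f (u \<otimes>\<^bsub>H\<^esub> v) = counit H u \<odot>\<^bsub>N\<^esub> f v \<oplus>\<^bsub>N\<^esub> counit H v \<odot>\<^bsub>N\<^esub> f u"
  shows Q_factor_hom: "(\<lambda>X. f (inv_into (carrier H) proj X)) \<in> mod_hom A Q N"
    and Q_factor_proj: "u \<in> carrier H \<Longrightarrow> f (inv_into (carrier H) proj (proj u)) = f u"
proof -
  interpret N: module A N by fact
  note [simp] = add_hom_closed[OF f]
  have one: "f \<one>\<^bsub>H\<^esub> = \<zero>\<^bsub>N\<^esub>"
    by (rule zero_if_idem_add[OF N.abelian_group_axioms]) (use leibniz[of "\<one>\<^bsub>H\<^esub>" "\<one>\<^bsub>H\<^esub>"] in simp_all)
  have fsrc: "f (src H a) = \<zero>\<^bsub>N\<^esub>" if "a \<in> carrier A" for a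
    using src[of a "\<one>\<^bsub>H\<^esub>"] that one by simp
  have fJ: "f u = \<zero>\<^bsub>N\<^esub>" if "u \<in> J" for u
    using that unfolding aug_ideal_sq_def
  proof (induct u rule: ideal_prod.induct)
    case (prod i j) then show ?case by (simp add: leibniz mem_I)
  next
    case (sum s t)
    then have "s \<in> carrier H" "t \<in> carrier H" using J_sub unfolding aug_ideal_sq_def by auto
    then show ?case using sum by (simp add: add_hom_add[OF f])
  qed
  have f_reduced: "f (reduced u) = f u" if "u \<in> carrier H" for u
  proof -
    have "f u = f (reduced u \<oplus>\<^bsub>H\<^esub> src H (counit H u))"
      using that by (simp add: reduced_def a_minus_def H.a_assoc H.l_neg)
    also have "\<dots> = f (reduced u)" using that by (simp add: add_hom_add[OF f] fsrc)
    finally show ?thesis by simp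
  qed
  have eq: "f u = f v" if "u \<in> carrier H" "v \<in> carrier H" "proj u = proj v" for u v
  proof -
    have "f (reduced u) = f ((reduced u \<ominus>\<^bsub>H\<^esub> reduced v) \<oplus>\<^bsub>H\<^esub> reduced v)"
      using that by (simp add: a_minus_def H.a_assoc H.l_neg)
    also have "\<dots> = f (reduced v)"
      using that fJ[of "reduced u \<ominus>\<^bsub>H\<^esub> reduced v"] by (simp add: add_hom_add[OF f] proj_eq_iff)
    finally show ?thesis using that f_reduced by simp
  qed
  show *: "f (inv_into (carrier H) proj (proj u)) = f u" if "u \<in> carrier H" for u
    using that by (intro eq inv_into_into[of "proj u"] f_inv_into_f[of "proj u"]) auto
  show "(\<lambda>X. f (inv_into (carrier H) proj X)) \<in> mod_hom A Q N"
    by (auto intro!: mod_homI add_homI elim!: proj_surj simp: * add_hom_add[OF f] src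
        simp flip: proj_add proj_smult)
qed

section \<open>Derivations as linear maps out of the indecomposables\<close>

text \<open>
  The value at \<open>u\<close> is \<open>u\<^sub>1 f(\<pi> u\<^sub>2)\<close>, the translate of \<open>f\<close> from the units to all of \<open>\<H>\<close>.
\<close>

abbreviation "invariant_form M f \<equiv> sweedler H M (\<lambda>x y. x \<odot>\<^bsub>M\<^esub> f (proj y))"

text \<open>
  By the Leibniz rule for \<open>\<pi>\<close>, \<open>x x' f(\<pi>(y y'))\<close> is \<open>x t(\<epsilon>(y)) \<cdot> x' f(\<pi> y') + x' t(\<epsilon>(y')) \<cdot> x f(\<pi> y)\<close>, and
  \<open>u\<^sub>1 t(\<epsilon>(u\<^sub>2)) = u\<close> by the counit axiom.
\<close>

lemma
  assumes M: "module H M" and f: "f \<in> mod_hom A Q (restrict_scalars (tgt H) M)"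
  shows Q_hom_bal2: "bal2 A H M (\<lambda>x y. x \<odot>\<^bsub>M\<^esub> f (proj y))"
    and s_derivation_of_Q_hom: "s_derivation A H M (invariant_form M f)"
proof -
  interpret M: module H M by fact
  have fc [simp]: "X \<in> carrier Q \<Longrightarrow> f X \<in> carrier M" for X
    using f by (auto simp: mod_hom_def)
  have fa: "X \<in> carrier Q \<Longrightarrow> Y \<in> carrier Q \<Longrightarrow> f (X \<oplus>\<^bsub>Q\<^esub> Y) = f X \<oplus>\<^bsub>M\<^esub> f Y" for X Y
    using f by (auto simp: mod_hom_def)
  have fs: "a \<in> carrier A \<Longrightarrow> X \<in> carrier Q \<Longrightarrow> f (a \<odot>\<^bsub>Q\<^esub> X) = tgt H a \<odot>\<^bsub>M\<^esub> f X" for a X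
    using f by (auto simp: mod_hom_def)
  show b: "bal2 A H M (\<lambda>x y. x \<odot>\<^bsub>M\<^esub> f (proj y))"
    by (rule bal2I) (simp_all add: M.smult_l_distr M.smult_r_distr M.smult_assoc1[symmetric]
        proj_add proj_smult fa fs tgt_commute)
  have m: "bal2 A H H (\<lambda>x y. x \<otimes>\<^bsub>H\<^esub> tgt H (counit H y))"
    by (rule bal2I) (simp_all add: H.l_distr H.r_distr H.m_ac)
  have mult: "invariant_form M f (u \<otimes>\<^bsub>H\<^esub> v) =
      u \<odot>\<^bsub>M\<^esub> invariant_form M f v \<oplus>\<^bsub>M\<^esub> v \<odot>\<^bsub>M\<^esub> invariant_form M f u"
    if uv: "u \<in> carrier H" "v \<in> carrier H" for u v
  proof -
    have "(x \<otimes>\<^bsub>H\<^esub> x') \<odot>\<^bsub>M\<^esub> f (proj (y \<otimes>\<^bsub>H\<^esub> y')) =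
        (x \<otimes>\<^bsub>H\<^esub> tgt H (counit H y)) \<odot>\<^bsub>M\<^esub> (x' \<odot>\<^bsub>M\<^esub> f (proj y')) \<oplus>\<^bsub>M\<^esub>
        (x' \<otimes>\<^bsub>H\<^esub> tgt H (counit H y')) \<odot>\<^bsub>M\<^esub> (x \<odot>\<^bsub>M\<^esub> f (proj y))"
      if "x \<in> carrier H" "y \<in> carrier H" "x' \<in> carrier H" "y' \<in> carrier H" for x y x' y'
    proof -
      have "x \<otimes>\<^bsub>H\<^esub> x' \<otimes>\<^bsub>H\<^esub> tgt H (counit H y) = x \<otimes>\<^bsub>H\<^esub> tgt H (counit H y) \<otimes>\<^bsub>H\<^esub> x'"
        "x \<otimes>\<^bsub>H\<^esub> x' \<otimes>\<^bsub>H\<^esub> tgt H (counit H y') = x' \<otimes>\<^bsub>H\<^esub> tgt H (counit H y') \<otimes>\<^bsub>H\<^esub> x"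
        using that by (simp_all add: H.m_ac)
      then show ?thesis
        using that by (simp add: proj_mult fa fs M.smult_r_distr flip: M.smult_assoc1)
    qed
    note L = sweedler_mult[OF M b m this uv]
    show ?thesis
      using L counit_r[OF uv(1)] counit_r[OF uv(2)] by (simp add: sweedler_def)
  qed
  have closed [simp]: "u \<in> carrier H \<Longrightarrow> invariant_form M f u \<in> carrier M" for u
    by (rule sweedler_closed[OF M.abelian_group_axioms b])
  have one: "invariant_form M f \<one>\<^bsub>H\<^esub> = \<zero>\<^bsub>M\<^esub>"
    by (rule zero_if_idem_add[OF M.abelian_group_axioms]) (use mult[of "\<one>\<^bsub>H\<^esub>" "\<one>\<^bsub>H\<^esub>"] in simp_all)
  have "invariant_form M f (src H a) = \<zero>\<^bsub>M\<^esub>" if a: "a \<in> carrier A" for a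
  proof -
    have "invariant_form M f (src H a \<otimes>\<^bsub>H\<^esub> \<one>\<^bsub>H\<^esub>) = src H a \<odot>\<^bsub>M\<^esub> invariant_form M f \<one>\<^bsub>H\<^esub>"
      by (rule sweedler_src[OF M.abelian_group_axioms b module_smult_add_hom[OF M] a])
        (use a in \<open>simp_all add: M.smult_assoc1\<close>)
    then show ?thesis using a one by simp
  qed
  then show "s_derivation A H M (invariant_form M f)"
    using mult sweedler_hom[OF M.abelian_group_axioms b] by (simp add: s_derivation_def)
qed

text \<open>
  The map \<open>f\<^sub>0(u) = S(u\<^sub>1) \<delta>(u\<^sub>2)\<close> is a derivation along \<open>t \<circ> \<epsilon>\<close>, because \<open>S(u\<^sub>1) u\<^sub>2 = t(\<epsilon>(u))\<close>, and therefore
  factors through \<open>\<pi>\<close>. Coassociativity, the other antipode axiom and the counit axiom give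
  \<open>u\<^sub>1 f\<^sub>0(u\<^sub>2) = u\<^sub>1 S(u\<^sub>2) \<delta>(u\<^sub>3) = s(\<epsilon>(u\<^sub>1)) \<delta>(u\<^sub>2) = \<delta>(u)\<close>.
\<close>

lemma Q_hom_of_s_derivation:
  assumes M: "module H M" and \<delta>: "s_derivation A H M \<delta>"
  obtains f where "f \<in> mod_hom A Q (restrict_scalars (tgt H) M)"
    "\<And>u. u \<in> carrier H \<Longrightarrow> invariant_form M f u = \<delta> u"
proof -
  interpret M: module H M by fact
  note aM = M.abelian_group_axioms and aH = H.abelian_group_axioms
  note [simp] = s_derivationD(2)[OF \<delta>]
  let ?g = "\<lambda>x y. antipode H x \<odot>\<^bsub>M\<^esub> \<delta> y" and ?m = "\<lambda>x y. antipode H x \<otimes>\<^bsub>H\<^esub> y"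
  define f0 where "f0 = sweedler H M ?g"
  have b: "bal2 A H M ?g"
    by (rule bal2I) (simp_all add: M.smult_l_distr M.smult_r_distr M.smult_assoc1[symmetric]
        s_derivationD[OF \<delta>] s_derivation_src[OF M \<delta>] H.m_comm)
  have m: "bal2 A H H ?m"
    by (rule bal2I) (simp_all add: H.l_distr H.r_distr H.m_ac)
  have f0_hom: "f0 \<in> add_hom H M" unfolding f0_def by (rule sweedler_hom[OF aM b])
  have f0c [simp]: "u \<in> carrier H \<Longrightarrow> f0 u \<in> carrier M" for u by (rule add_hom_closed[OF f0_hom])
  have mult: "f0 (u \<otimes>\<^bsub>H\<^esub> v) = tgt H (counit H u) \<odot>\<^bsub>M\<^esub> f0 v \<oplus>\<^bsub>M\<^esub> tgt H (counit H v) \<odot>\<^bsub>M\<^esub> f0 u"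
    if uv: "u \<in> carrier H" "v \<in> carrier H" for u v
  proof -
    have "antipode H (x \<otimes>\<^bsub>H\<^esub> x') \<odot>\<^bsub>M\<^esub> \<delta> (y \<otimes>\<^bsub>H\<^esub> y') =
        (antipode H x \<otimes>\<^bsub>H\<^esub> y) \<odot>\<^bsub>M\<^esub> (antipode H x' \<odot>\<^bsub>M\<^esub> \<delta> y') \<oplus>\<^bsub>M\<^esub>
        (antipode H x' \<otimes>\<^bsub>H\<^esub> y') \<odot>\<^bsub>M\<^esub> (antipode H x \<odot>\<^bsub>M\<^esub> \<delta> y)"
      if "x \<in> carrier H" "y \<in> carrier H" "x' \<in> carrier H" "y' \<in> carrier H" for x y x' y'
    proof -
      have "antipode H x \<otimes>\<^bsub>H\<^esub> antipode H x' \<otimes>\<^bsub>H\<^esub> y = antipode H x \<otimes>\<^bsub>H\<^esub> y \<otimes>\<^bsub>H\<^esub> antipode H x'"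
        "antipode H x \<otimes>\<^bsub>H\<^esub> antipode H x' \<otimes>\<^bsub>H\<^esub> y' = antipode H x' \<otimes>\<^bsub>H\<^esub> y' \<otimes>\<^bsub>H\<^esub> antipode H x"
        using that by (simp_all add: H.m_ac)
      then show ?thesis
        using that by (simp add: s_derivationD[OF \<delta>] M.smult_r_distr flip: M.smult_assoc1)
    qed
    note L = sweedler_mult[OF M b m this uv]
    show ?thesis
      unfolding f0_def using L antipode_l[OF uv(1)] antipode_l[OF uv(2)] by (simp add: sweedler_def)
  qed
  have src: "f0 (src H a \<otimes>\<^bsub>H\<^esub> u) = tgt H a \<odot>\<^bsub>M\<^esub> f0 u" if "a \<in> carrier A" "u \<in> carrier H" for a u
    unfolding f0_def
    by (rule sweedler_src[OF aM b module_smult_add_hom[OF M]]) (use that in \<open>simp_all add: M.smult_assoc1\<close>)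
  have mt: "module A (restrict_scalars (tgt H) M)"
    by (rule module_restrict_scalars[OF A.is_cring structure_homs(2) M])
  have f0t: "f0 \<in> add_hom H (restrict_scalars (tgt H) M)" using f0_hom by (simp add: add_hom_def)
  define f where "f X = f0 (inv_into (carrier H) proj X)" for X
  have f: "f \<in> mod_hom A Q (restrict_scalars (tgt H) M)"
    unfolding f_def[abs_def] by (rule Q_factor_hom[OF mt f0t]) (simp add: src, simp add: mult)
  have fp: "f (proj u) = f0 u" if "u \<in> carrier H" for u
    unfolding f_def by (rule Q_factor_proj[OF mt f0t]) (simp add: src, simp add: mult, rule that)
  have "invariant_form M f u = \<delta> u" if u: "u \<in> carrier H" for u
  proof -
    let ?h = "\<lambda>x y z. (x \<otimes>\<^bsub>H\<^esub> antipode H y) \<odot>\<^bsub>M\<^esub> \<delta> z"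
    have bx: "x \<odot>\<^bsub>M\<^esub> f (proj w) = sweedler H M (?h x) w" if "x \<in> carrier H" "w \<in> carrier H" for x w
    proof -
      have "x \<odot>\<^bsub>M\<^esub> f (proj w) = x \<odot>\<^bsub>M\<^esub> sweedler H M ?g w" using that by (simp add: fp f0_def)
      also have "\<dots> = sweedler H M (\<lambda>y z. x \<odot>\<^bsub>M\<^esub> (antipode H y \<odot>\<^bsub>M\<^esub> \<delta> z)) w"
        using that sweedler_compose[OF aM aM b module_smult_add_hom[OF M that(1)] that(2)] by simp
      also have "\<dots> = sweedler H M (?h x) w"
        by (rule sweedler_cong[OF aM balanced_compose[OF b module_smult_add_hom[OF M that(1)]] _ that(2)])
          (use that in \<open>simp add: M.smult_assoc1\<close>)
      finally show ?thesis .
    qed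
    have r: "bal2 A H H (\<lambda>x y. x \<otimes>\<^bsub>H\<^esub> antipode H y)"
      by (rule bal2I) (simp_all add: H.l_distr H.r_distr H.m_ac)
    have l: "bal2 A H H (\<lambda>x y. src H (counit H x) \<otimes>\<^bsub>H\<^esub> y)"
      by (rule bal2I) (simp_all add: H.l_distr H.r_distr H.m_ac)
    have act: "(\<lambda>c. c \<odot>\<^bsub>M\<^esub> \<delta> z) \<in> add_hom H M" if "z \<in> carrier H" for z
      using that by (auto intro!: add_homI simp: M.smult_l_distr)
    have inner: "sweedler H M (\<lambda>x y. ?h x y z) w = \<delta> (src H (counit H w) \<otimes>\<^bsub>H\<^esub> z)"
      if "w \<in> carrier H" "z \<in> carrier H" for w z
    proof -
      have "sweedler H M (\<lambda>x y. ?h x y z) w = sweedler H H (\<lambda>x y. x \<otimes>\<^bsub>H\<^esub> antipode H y) w \<odot>\<^bsub>M\<^esub> \<delta> z"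
        by (rule sweedler_compose[OF aH aM r act that(1)]) fact
      also have "\<dots> = src H (counit H w) \<odot>\<^bsub>M\<^esub> \<delta> z"
        using antipode_r[OF that(1)] by (simp add: sweedler_def)
      finally show ?thesis using that by (simp add: s_derivation_src[OF M \<delta>])
    qed
    have "invariant_form M f u = sweedler H M (\<lambda>x w. sweedler H M (?h x) w) u"
      by (rule sweedler_cong[OF aM Q_hom_bal2[OF M f] _ u]) (rule bx)
    also have "\<dots> = sweedler H M (\<lambda>w z. sweedler H M (\<lambda>x y. ?h x y z) w) u"
      by (rule sweedler_coassoc[OF aM _ _ _ _ _ _ u])
        (simp_all add: M.smult_l_distr M.smult_r_distr M.smult_assoc1[symmetric] H.l_distr H.r_distr H.m_ac
          s_derivationD[OF \<delta>] s_derivation_src[OF M \<delta>])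
    also have "\<dots> = sweedler H M (\<lambda>w z. \<delta> (src H (counit H w) \<otimes>\<^bsub>H\<^esub> z)) u"
      by (rule sweedler_cong[OF aM balanced_compose[OF l s_derivationD(1)[OF \<delta>]] _ u, symmetric])
        (simp add: inner)
    also have "\<dots> = \<delta> (sweedler H H (\<lambda>w z. src H (counit H w) \<otimes>\<^bsub>H\<^esub> z) u)"
      by (rule sweedler_compose[OF aH aM l s_derivationD(1)[OF \<delta>] u])
    also have "\<dots> = \<delta> u" using counit_l[OF u] by (simp add: sweedler_def)
    finally show ?thesis .
  qed
  then show ?thesis using f that by blast
qed

abbreviation "A\<epsilon> \<equiv> ring_via (counit H) A"

lemma module_A\<epsilon>: "module H A\<epsilon>"
  by (rule module_ring_via[OF H.is_cring structure_homs(3) A.is_cring])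

text \<open>
  The derivations into \<open>A\<^sub>\<epsilon>\<close> are the linear forms on \<open>Q(\<H>)\<close>, composed with \<open>\<pi>\<close>: the module action in the
  Leibniz rule for \<open>\<pi>\<close> is through \<open>\<epsilon>\<close>.
\<close>

lemma s_derivation_counitI:
  assumes c: "c \<in> mod_hom A Q (regular A)"
  shows "s_derivation A H A\<epsilon> (\<lambda>u. c (proj u))"
proof -
  have zero: "c \<zero>\<^bsub>Q\<^esub> = \<zero>\<^bsub>A\<^esub>"
    using add_hom_zero[OF Q.abelian_group_axioms _ mod_hom_add_hom[OF c]] module_regular[OF A.is_cring]
    by (simp add: module_def)
  show ?thesis
    using add_hom_closed[OF mod_hom_add_hom[OF c]] add_hom_add[OF mod_hom_add_hom[OF c]] mod_hom_smult[OF c]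
    by (auto simp: s_derivation_def add_hom_def proj_add proj_mult proj_src zero)
qed

lemma s_derivation_counitE:
  assumes \<delta>: "s_derivation A H A\<epsilon> \<delta>"
  obtains c where "c \<in> mod_hom A Q (regular A)" "\<And>u. u \<in> carrier H \<Longrightarrow> c (proj u) = \<delta> u"
proof -
  have h: "\<delta> \<in> add_hom H (regular A)" using s_derivationD(1)[OF \<delta>] by (simp add: add_hom_def)
  have src: "\<delta> (src H a \<otimes>\<^bsub>H\<^esub> u) = a \<odot>\<^bsub>regular A\<^esub> \<delta> u" if "a \<in> carrier A" "u \<in> carrier H" for a u
    using s_derivation_src[OF module_A\<epsilon> \<delta> that] that by simp
  have mult: "\<delta> (u \<otimes>\<^bsub>H\<^esub> v) = counit H u \<odot>\<^bsub>regular A\<^esub> \<delta> v \<oplus>\<^bsub>regular A\<^esub> counit H v \<odot>\<^bsub>regular A\<^esub> \<delta> u"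
    if "u \<in> carrier H" "v \<in> carrier H" for u v
    using s_derivationD(4)[OF \<delta> that] by simp
  show ?thesis
    using that[OF Q_factor_hom[OF module_regular[OF A.is_cring] h src mult]
        Q_factor_proj[OF module_regular[OF A.is_cring] h src mult]] by blast
qed

section \<open>Differentials of a Hopf algebroid\<close>

lemma algebra_src: "algebra A (src_module H)"
proof (intro algebra.intro algebra_axioms.intro)
  show "module A (src_module H)" by (rule src.module_axioms)
  show "cring (src_module H)" unfolding src_module_def by (rule cring_ring_via[OF H.is_cring])
qed (simp add: H.m_assoc)

sublocale Om: kaehler_algebra A "src_module H"
  by (rule kaehler_algebra.intro[OF algebra_src])

abbreviation "\<Omega> \<equiv> Omega_s A H"
abbreviation "form \<equiv> Om.form"

text \<open>
  \<open>Omega_s\<close> is built over the record \<open>src_module H\<close>, which is the ring \<open>\<H>\<close> with another action attached.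
\<close>

lemma module_src_module: "module H M \<longleftrightarrow> module (src_module H) M"
  using module_cong_ring[of H M "src_module H"] module_cong_ring[of "src_module H" M H]
    algebra.M_cring[OF algebra_src] H.is_cring by auto

lemma module_Omega: "module H \<Omega>"
  unfolding module_src_module Omega_s_def by (rule Om.module_kaehler)

sublocale Omega: module H \<Omega> by (rule module_Omega)

lemma form_closed [simp]: "u \<in> carrier H \<Longrightarrow> v \<in> carrier H \<Longrightarrow> form u v \<in> carrier \<Omega>"
  using Om.form_closed[of u v] by (simp add: Omega_s_def)

lemma smult_form: "b \<in> carrier H \<Longrightarrow> u \<in> carrier H \<Longrightarrow> v \<in> carrier H \<Longrightarrow> b \<odot>\<^bsub>\<Omega>\<^esub> form u v = form (b \<otimes>\<^bsub>H\<^esub> u) v"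
  using Om.smult_form[of b u v] by (simp add: Omega_s_def)

lemma add_generated_Omega: "add_generated \<Omega> {form u v | u v. u \<in> carrier H \<and> v \<in> carrier H}"
  using Om.add_generated_kaehler by (simp add: Omega_s_def)

lemma s_derivation_form: "s_derivation A H \<Omega> (form \<one>\<^bsub>H\<^esub>)"
proof -
  note rels = Om.form_rels[folded Omega_s_def, simplified]
  have one: "form \<one>\<^bsub>H\<^esub> \<one>\<^bsub>H\<^esub> = \<zero>\<^bsub>\<Omega>\<^esub>"
    by (rule zero_if_idem_add[OF Omega.abelian_group_axioms]) (use rels(4)[of "\<one>\<^bsub>H\<^esub>" "\<one>\<^bsub>H\<^esub>" "\<one>\<^bsub>H\<^esub>"] in simp_all)
  have "form \<one>\<^bsub>H\<^esub> (src H a) = \<zero>\<^bsub>\<Omega>\<^esub>" if a: "a \<in> carrier A" for a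
    using a rels(3)[of "\<one>\<^bsub>H\<^esub>" "\<one>\<^bsub>H\<^esub>" "\<one>\<^bsub>H\<^esub>" a] smult_form[of "src H a" "\<one>\<^bsub>H\<^esub>" "\<one>\<^bsub>H\<^esub>"] one by simp
  then show ?thesis
    by (auto simp: s_derivation_def add_hom_def rels smult_form)
qed

lemma
  assumes M: "module H M" and \<delta>: "s_derivation A H M \<delta>"
  shows Omega_lift_hom: "pres_lift (add_monoid M) (\<lambda>(u, v). u \<odot>\<^bsub>M\<^esub> \<delta> v) \<in> mod_hom H \<Omega> M"
    and Omega_lift_form: "u \<in> carrier H \<Longrightarrow> v \<in> carrier H \<Longrightarrow>
      pres_lift (add_monoid M) (\<lambda>(u, v). u \<odot>\<^bsub>M\<^esub> \<delta> v) (form u v) = u \<odot>\<^bsub>M\<^esub> \<delta> v"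
proof -
  have 1: "module (src_module H) M" using M module_src_module by blast
  have 2: "\<delta> \<in> add_hom (src_module H) M" using s_derivationD(1)[OF \<delta>] by (simp add: add_hom_def)
  note lift = Om.kaehler_lift_hom[OF 1 2] Om.kaehler_lift_form[OF 1 2]
  show "pres_lift (add_monoid M) (\<lambda>(u, v). u \<odot>\<^bsub>M\<^esub> \<delta> v) \<in> mod_hom H \<Omega> M"
    using lift(1) s_derivation_src[OF M \<delta>] by (simp add: mod_hom_def Omega_s_def s_derivationD[OF \<delta>])
  show "pres_lift (add_monoid M) (\<lambda>(u, v). u \<odot>\<^bsub>M\<^esub> \<delta> v) (form u v) = u \<odot>\<^bsub>M\<^esub> \<delta> v"
    if "u \<in> carrier H" "v \<in> carrier H"
    using lift(2)[of u v] s_derivation_src[OF M \<delta>] that by (simp add: s_derivationD[OF \<delta>])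
qed

sublocale TQ: scalar_extension A H "tgt H" Q
  by (intro scalar_extension.intro A.is_cring H.is_cring structure_homs module_Q)

abbreviation "HQ \<equiv> tensor_Q A H"
abbreviation "tq \<equiv> tens A (tgt_module H) Q"

lemma module_HQ: "module H HQ"
  unfolding tensor_Q_def by (rule TQ.module_extend)

sublocale HQ: module H HQ by (rule module_HQ)

lemma carrier_HQ: "carrier HQ = carrier (tensor A (tgt_module H) Q)"
  "ring.add HQ = ring.add (tensor A (tgt_module H) Q)"
  by (simp_all add: tensor_Q_def tgt_module_def)

lemma tq_closed [simp]: "x \<in> carrier H \<Longrightarrow> X \<in> carrier Q \<Longrightarrow> tq x X \<in> carrier HQ"
  by (simp add: tensor_Q_def tgt_module_def)

lemma smult_tq: "b \<in> carrier H \<Longrightarrow> x \<in> carrier H \<Longrightarrow> X \<in> carrier Q \<Longrightarrow> b \<odot>\<^bsub>HQ\<^esub> tq x X = tq (b \<otimes>\<^bsub>H\<^esub> x) X"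
  unfolding tensor_Q_def tgt_module_def by (rule TQ.smult_extend_tens)

lemmas tq_balanced = TQ.tn_balanced[folded tgt_module_def, folded carrier_HQ]

text \<open>
  The derivation that corresponds to \<open>X \<mapsto> 1 \<otimes> X\<close> is \<open>u \<mapsto> u\<^sub>1 \<otimes> \<pi> u\<^sub>2\<close>, the one that defines \<open>Omega_iso\<close>.
\<close>

lemma tq_one_hom: "tq \<one>\<^bsub>H\<^esub> \<in> mod_hom A Q (restrict_scalars (tgt H) HQ)"
  using tq_balanced(1)[of _ "\<one>\<^bsub>H\<^esub>"]
  by (intro mod_homI add_homI) (simp_all add: tq_balanced(4) smult_tq)

lemma bal2_tq: "bal2 A H HQ (\<lambda>x y. tq x (proj y))"
  by (rule T2.balanced_cong[OF Q_hom_bal2[OF module_HQ tq_one_hom]]) (simp add: smult_tq)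

lemma tensor_map_proj_sweedler: "u \<in> carrier H \<Longrightarrow>
    tensor_map A (tgt_module H) Q (\<lambda>w. w) proj (comult H u) = sweedler H HQ (\<lambda>x y. tq x (proj y)) u"
proof -
  assume u: "u \<in> carrier H"
  have *: "tensor_factors A (tgt_module H) Q"
    by (rule tensor_factors_modules[OF tgt.module_axioms module_Q])
  have p: "proj \<in> add_hom (src_module H) Q" using proj_hom by (simp add: add_hom_def)
  note map = tensor_map_hom[OF T2.tensor_factors_axioms * add_hom_ident p]
    tensor_map_tens[OF T2.tensor_factors_axioms * add_hom_ident p]
  have b: "tq (a \<odot>\<^bsub>tgt_module H\<^esub> x) (proj y) = tq x (proj (a \<odot>\<^bsub>src_module H\<^esub> y))"
    if "a \<in> carrier A" "x \<in> carrier (tgt_module H)" "y \<in> carrier (src_module H)" for a x y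
    using that tq_balanced(1)[of a x "proj y"] by (simp add: proj_smult)
  have hom: "tensor_map A (tgt_module H) Q (\<lambda>w. w) proj \<in> add_hom (tensor2 A H) HQ"
    using map(1)[OF b] by (simp add: add_hom_def carrier_HQ tensor2_def)
  show ?thesis unfolding sweedler_def
    by (rule tensor2_eqI[OF HQ.abelian_group_axioms hom lift2_hom[OF HQ.abelian_group_axioms bal2_tq]])
      (use u map(2)[OF b] lift2_tens[OF HQ.abelian_group_axioms bal2_tq] in \<open>simp_all\<close>)
qed

lemma s_derivation_HQ: "s_derivation A H HQ (sweedler H HQ (\<lambda>x y. tq x (proj y)))"
proof -
  have "invariant_form HQ (tq \<one>\<^bsub>H\<^esub>) u = sweedler H HQ (\<lambda>x y. tq x (proj y)) u" if "u \<in> carrier H" for u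
    by (rule sweedler_cong[OF HQ.abelian_group_axioms Q_hom_bal2[OF module_HQ tq_one_hom] _ that])
      (simp add: smult_tq)
  then show ?thesis
    using s_derivation_of_Q_hom[OF module_HQ tq_one_hom]
      sweedler_closed[OF HQ.abelian_group_axioms bal2_tq] by (auto simp: s_derivation_def add_hom_def)
qed

lemma
  shows Omega_iso_hom: "Omega_iso A H \<in> mod_hom H \<Omega> HQ"
    and Omega_iso_form: "u \<in> carrier H \<Longrightarrow> v \<in> carrier H \<Longrightarrow>
      Omega_iso A H (form u v) = u \<odot>\<^bsub>HQ\<^esub> sweedler H HQ (\<lambda>x y. tq x (proj y)) v"
proof -
  let ?c = "\<lambda>v. tensor_map A (tgt_module H) Q (\<lambda>w. w) proj (comult H v)"
  have "s_derivation A H HQ ?c"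
    using s_derivation_HQ tensor_map_proj_sweedler by (auto simp: s_derivation_def add_hom_def)
  note lift = Omega_lift_hom[OF module_HQ this] Omega_lift_form[OF module_HQ this]
  show "Omega_iso A H \<in> mod_hom H \<Omega> HQ"
    using lift(1) unfolding Omega_iso_def .
  show "Omega_iso A H (form u v) = u \<odot>\<^bsub>HQ\<^esub> sweedler H HQ (\<lambda>x y. tq x (proj y)) v"
    if "u \<in> carrier H" "v \<in> carrier H"
    using lift(2) tensor_map_proj_sweedler that unfolding Omega_iso_def by simp
qed

text \<open>
  If \<open>f\<close> corresponds to the universal derivation, then \<open>h \<otimes> X \<mapsto> h f(X)\<close> sends \<open>u (v\<^sub>1 \<otimes> \<pi> v\<^sub>2)\<close> to
  \<open>u v\<^sub>1 f(\<pi> v\<^sub>2) = u dv\<close> and so is a left inverse of \<open>Omega_iso\<close>.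
\<close>

lemma Omega_iso_inj: "inj_on (Omega_iso A H) (carrier \<Omega>)"
proof -
  obtain f where f: "f \<in> mod_hom A Q (restrict_scalars (tgt H) \<Omega>)"
    "\<And>u. u \<in> carrier H \<Longrightarrow> invariant_form \<Omega> f u = form \<one>\<^bsub>H\<^esub> u"
    using Q_hom_of_s_derivation[OF module_Omega s_derivation_form] by blast
  define G where "G = tensor_lift \<Omega> (\<lambda>b y. b \<odot>\<^bsub>\<Omega>\<^esub> f y)"
  have G: "G \<in> mod_hom H HQ \<Omega>"
    using TQ.extend_lift_hom[OF module_Omega f(1)] by (simp add: G_def tensor_Q_def)
  have Gt: "G (tq x X) = x \<odot>\<^bsub>\<Omega>\<^esub> f X" if "x \<in> carrier H" "X \<in> carrier Q" for x X
    using TQ.extend_lift_tens[OF module_Omega f(1) that] by (simp add: G_def tgt_module_def)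
  note aO = Omega.abelian_group_axioms and aQ = HQ.abelian_group_axioms
  note c = s_derivationD(2)[OF s_derivation_HQ]
  have Gc: "G (sweedler H HQ (\<lambda>x y. tq x (proj y)) v) = form \<one>\<^bsub>H\<^esub> v" if v: "v \<in> carrier H" for v
  proof -
    have "G (sweedler H HQ (\<lambda>x y. tq x (proj y)) v) = sweedler H \<Omega> (\<lambda>x y. G (tq x (proj y))) v"
      by (rule sweedler_compose[OF aQ aO bal2_tq mod_hom_add_hom[OF G] v, symmetric])
    also have "\<dots> = invariant_form \<Omega> f v"
      by (rule sweedler_cong[OF aO balanced_compose[OF bal2_tq mod_hom_add_hom[OF G]] _ v]) (simp add: Gt)
    finally show ?thesis using f(2) v by simp
  qed
  have "G (Omega_iso A H w) = w" if "w \<in> carrier \<Omega>" for w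
    by (rule add_hom_eqI[OF aO aO add_generated_Omega
          add_hom_compose[OF mod_hom_add_hom[OF Omega_iso_hom] mod_hom_add_hom[OF G]] add_hom_ident _ that])
      (auto simp: Omega_iso_form mod_hom_smult[OF G] c Gc smult_form)
  then show ?thesis by (rule inj_on_inverseI)
qed

end

section \<open>Derivations along a morphism\<close>

locale hopf_morphism =
  K: commutative_hopf_algebroid k A K + H: commutative_hopf_algebroid k A H
  for k :: "('k, 'w) ring_scheme" and A :: "('k, 'a, 'x) module_scheme"
    and K :: "('k, 'a, 'kk, 'y) hopf_algebroid_scheme" and H :: "('k, 'a, 'h, 'z) hopf_algebroid_scheme" +
  fixes \<phi> :: "'kk \<Rightarrow> 'h"
  assumes hom: "\<phi> \<in> hopf_algebroid_hom k A K H"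
begin

lemma phi_ring_hom: "\<phi> \<in> ring_hom K H"
  using hom by (simp add: hopf_algebroid_hom_def alg_hom_def)

lemma phi_simps [simp]:
  "u \<in> carrier K \<Longrightarrow> \<phi> u \<in> carrier H"
  "u \<in> carrier K \<Longrightarrow> v \<in> carrier K \<Longrightarrow> \<phi> (u \<oplus>\<^bsub>K\<^esub> v) = \<phi> u \<oplus>\<^bsub>H\<^esub> \<phi> v"
  "u \<in> carrier K \<Longrightarrow> v \<in> carrier K \<Longrightarrow> \<phi> (u \<otimes>\<^bsub>K\<^esub> v) = \<phi> u \<otimes>\<^bsub>H\<^esub> \<phi> v"
  "\<phi> \<one>\<^bsub>K\<^esub> = \<one>\<^bsub>H\<^esub>"
  "a \<in> carrier A \<Longrightarrow> \<phi> (src K a) = src H a"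
  "a \<in> carrier A \<Longrightarrow> \<phi> (tgt K a) = tgt H a"
  "u \<in> carrier K \<Longrightarrow> counit H (\<phi> u) = counit K u"
  using hom ring_hom_closed[OF phi_ring_hom] ring_hom_add[OF phi_ring_hom] ring_hom_mult[OF phi_ring_hom]
    ring_hom_one[OF phi_ring_hom]
  by (auto simp: hopf_algebroid_hom_def)

lemma phi_hom: "\<phi> \<in> add_hom K H"
  by (simp add: add_hom_def)

lemma module_restrict: "module H M \<Longrightarrow> module K (restrict_scalars \<phi> M)"
  by (rule module_restrict_scalars[OF K.H.is_cring phi_ring_hom])

lemma phi_bal2: "bal2 A H P f \<Longrightarrow> bal2 A K P (\<lambda>x y. f (\<phi> x) (\<phi> y))"
  by (rule K.bal2I) (simp_all add: H.bal2D)

lemma sweedler_phi: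
  assumes P: "abelian_group P" and f: "bal2 A H P f" and u: "u \<in> carrier K"
  shows "sweedler H P f (\<phi> u) = sweedler K P (\<lambda>x y. f (\<phi> x) (\<phi> y)) u"
proof -
  let ?m = "tensor_map A (tgt_module H) (src_module H) \<phi> \<phi>"
  have 1: "\<phi> \<in> add_hom (tgt_module K) (tgt_module H)" "\<phi> \<in> add_hom (src_module K) (src_module H)"
    by (simp_all add: add_hom_def)
  have b: "H.tt (\<phi> (a \<odot>\<^bsub>tgt_module K\<^esub> x)) (\<phi> y) = H.tt (\<phi> x) (\<phi> (a \<odot>\<^bsub>src_module K\<^esub> y))"
    if "a \<in> carrier A" "x \<in> carrier (tgt_module K)" "y \<in> carrier (src_module K)" for a x y
    using that by (simp add: H.tt_balanced)
  note map = tensor_map_hom[OF K.T2.tensor_factors_axioms H.T2.tensor_factors_axioms 1 b, folded tensor2_def]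
    tensor_map_tens[OF K.T2.tensor_factors_axioms H.T2.tensor_factors_axioms 1 b, simplified]
  have "tensor_lift P f (?m (comult K u)) = tensor_lift P (\<lambda>x y. f (\<phi> x) (\<phi> y)) (comult K u)"
    by (rule K.tensor2_eqI[OF P add_hom_compose[OF map(1) H.lift2_hom[OF P f]] K.lift2_hom[OF P phi_bal2[OF f]]])
      (use u in \<open>simp_all add: map H.lift2_tens[OF P f] K.lift2_tens[OF P phi_bal2[OF f]]\<close>)
  moreover have "comult H (\<phi> u) = ?m (comult K u)"
    using hom u by (simp add: hopf_algebroid_hom_def)
  ultimately show ?thesis by (simp add: sweedler_def)
qed

lemma s_derivation_phi:
  "s_derivation A H M \<delta> \<Longrightarrow> s_derivation A K (restrict_scalars \<phi> M) (\<lambda>v. \<delta> (\<phi> v))"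
  by (auto simp: s_derivation_def add_hom_def Pi_iff)

lemma compose_Der_s:
  assumes M: "module H M" and \<delta>: "\<delta> \<in> Der_s k A H M"
  shows "compose (carrier K) \<delta> \<phi> \<in> Der_s k A K (restrict_scalars \<phi> M)"
proof -
  have "restrict (\<lambda>v. \<delta> (\<phi> v)) (carrier K) \<in> Der_s k A K (restrict_scalars \<phi> M)"
    using \<delta> by (intro K.restrict_Der_s[OF module_restrict[OF M]] s_derivation_phi) (simp add: H.Der_s_iff[OF M])
  then show ?thesis by (simp add: compose_def)
qed

lemma Der_s_surjI:
  assumes M: "module H M"
    and lift: "\<And>\<delta>. s_derivation A K (restrict_scalars \<phi> M) \<delta> \<Longrightarrow>
      \<exists>D. s_derivation A H M D \<and> (\<forall>v\<in>carrier K. D (\<phi> v) = \<delta> v)"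
  shows "Der_s_surj k A K H \<phi> M"
  unfolding Der_s_surj_def
proof (intro equalityI subsetI)
  fix \<delta> assume "\<delta> \<in> (\<lambda>\<delta>. compose (carrier K) \<delta> \<phi>) ` Der_s k A H M"
  then show "\<delta> \<in> Der_s k A K (restrict_scalars \<phi> M)" using compose_Der_s[OF M] by auto
next
  fix \<delta> assume "\<delta> \<in> Der_s k A K (restrict_scalars \<phi> M)"
  then have \<delta>: "\<delta> \<in> extensional (carrier K)" "s_derivation A K (restrict_scalars \<phi> M) \<delta>"
    by (simp_all add: K.Der_s_iff[OF module_restrict[OF M]])
  obtain D where D: "s_derivation A H M D" "\<And>v. v \<in> carrier K \<Longrightarrow> D (\<phi> v) = \<delta> v"
    using lift[OF \<delta>(2)] by blast
  have "\<delta> = compose (carrier K) (restrict D (carrier H)) \<phi>"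
    using \<delta>(1) D(2) by (auto simp: compose_def extensional_def fun_eq_iff)
  then show "\<delta> \<in> (\<lambda>\<delta>. compose (carrier K) \<delta> \<phi>) ` Der_s k A H M"
    using H.restrict_Der_s[OF M D(1)] by blast
qed

lemma Der_s_surjD:
  assumes "Der_s_surj k A K H \<phi> M" and M: "module H M" and \<delta>: "s_derivation A K (restrict_scalars \<phi> M) \<delta>"
  obtains D where "s_derivation A H M D" "\<And>v. v \<in> carrier K \<Longrightarrow> D (\<phi> v) = \<delta> v"
proof -
  have "restrict \<delta> (carrier K) \<in> (\<lambda>\<delta>. compose (carrier K) \<delta> \<phi>) ` Der_s k A H M"
    using K.restrict_Der_s[OF module_restrict[OF M] \<delta>] assms(1) by (simp add: Der_s_surj_def)
  then obtain D where D: "D \<in> Der_s k A H M" "restrict \<delta> (carrier K) = compose (carrier K) D \<phi>" by auto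
  have "D (\<phi> v) = \<delta> v" if "v \<in> carrier K" for v
    using fun_cong[OF D(2), of v] that by (simp add: compose_def)
  moreover have "s_derivation A H M D" using D(1) by (simp add: H.Der_s_iff[OF M])
  ultimately show ?thesis using that by blast
qed

text \<open>
  \<open>\<pi> \<circ> \<phi>\<close> is a derivation along \<open>\<epsilon>\<close>, and \<open>Q_map\<close> is its factorization through \<open>\<pi>\<close>.
\<close>

lemma
  shows Q_map_hom: "Q_map A K H \<phi> \<in> mod_hom A K.Q H.Q"
    and Q_map_proj: "v \<in> carrier K \<Longrightarrow> Q_map A K H \<phi> (K.proj v) = H.proj (\<phi> v)"
proof -
  have f: "(\<lambda>v. H.proj (\<phi> v)) \<in> add_hom K H.Q"
    by (rule add_hom_compose[OF phi_hom H.proj_hom])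
  have src: "H.proj (\<phi> (src K a \<otimes>\<^bsub>K\<^esub> u)) = a \<odot>\<^bsub>H.Q\<^esub> H.proj (\<phi> u)" if "a \<in> carrier A" "u \<in> carrier K" for a u
    using that by (simp add: H.proj_smult)
  have mult: "H.proj (\<phi> (u \<otimes>\<^bsub>K\<^esub> v)) = counit K u \<odot>\<^bsub>H.Q\<^esub> H.proj (\<phi> v) \<oplus>\<^bsub>H.Q\<^esub> counit K v \<odot>\<^bsub>H.Q\<^esub> H.proj (\<phi> u)"
    if "u \<in> carrier K" "v \<in> carrier K" for u v
    using that by (simp add: H.proj_mult)
  show "Q_map A K H \<phi> \<in> mod_hom A K.Q H.Q"
    using K.Q_factor_hom[OF H.module_Q f src mult] by (simp add: Q_map_def[abs_def])
  show "Q_map A K H \<phi> (K.proj v) = H.proj (\<phi> v)" if "v \<in> carrier K"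
    using K.Q_factor_proj[OF H.module_Q f src mult that] by (simp add: Q_map_def)
qed

text \<open>
  With a retraction \<open>g\<close> of \<open>Q(\<phi>)\<close>, the linear map \<open>f\<close> of a derivation of \<open>\<K>\<close> extends to \<open>f \<circ> g\<close> on \<open>Q(\<H>)\<close>.
\<close>

lemma Der_s_surj_if_split:
  assumes split: "split_injective A K.Q H.Q (Q_map A K H \<phi>)" and M: "module H M"
  shows "Der_s_surj k A K H \<phi> M"
proof (rule Der_s_surjI[OF M])
  interpret M: module H M by fact
  fix \<delta> assume \<delta>: "s_derivation A K (restrict_scalars \<phi> M) \<delta>"
  note M' = module_restrict[OF M]
  obtain g where g: "g \<in> mod_hom A H.Q K.Q" "\<And>X. X \<in> carrier K.Q \<Longrightarrow> g (Q_map A K H \<phi> X) = X"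
    using split by (auto simp: split_injective_def)
  obtain f where f: "f \<in> mod_hom A K.Q (restrict_scalars (tgt K) (restrict_scalars \<phi> M))"
    "\<And>u. u \<in> carrier K \<Longrightarrow> K.invariant_form (restrict_scalars \<phi> M) f u = \<delta> u"
    using K.Q_hom_of_s_derivation[OF M' \<delta>] by blast
  have "f \<in> mod_hom A K.Q (restrict_scalars (tgt H) M)"
    using f(1) by (simp add: mod_hom_def)
  then have fg: "(\<lambda>X. f (g X)) \<in> mod_hom A H.Q (restrict_scalars (tgt H) M)"
    by (rule mod_hom_compose[OF g(1)])
  let ?D = "H.invariant_form M (\<lambda>X. f (g X))"
  have "?D (\<phi> v) = \<delta> v" if v: "v \<in> carrier K" for v
  proof -
    note b = phi_bal2[OF H.Q_hom_bal2[OF M fg]]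
    have "?D (\<phi> v) = sweedler K M (\<lambda>x y. \<phi> x \<odot>\<^bsub>M\<^esub> f (g (H.proj (\<phi> y)))) v"
      by (rule sweedler_phi[OF M.abelian_group_axioms H.Q_hom_bal2[OF M fg] v])
    also have "\<dots> = sweedler K M (\<lambda>x y. x \<odot>\<^bsub>restrict_scalars \<phi> M\<^esub> f (K.proj y)) v"
      by (rule K.sweedler_cong[OF M.abelian_group_axioms b _ v]) (simp add: g(2) flip: Q_map_proj)
    also have "\<dots> = K.invariant_form (restrict_scalars \<phi> M) f v"
      by (rule K.sweedler_compose[OF _ M.abelian_group_axioms K.Q_hom_bal2[OF M' f(1)] _ v, where F = "\<lambda>x. x"])
        (use M' in \<open>simp_all add: add_hom_def module_def\<close>)
    finally show ?thesis using f(2)[OF v] by simp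
  qed
  then show "\<exists>D. s_derivation A H M D \<and> (\<forall>v\<in>carrier K. D (\<phi> v) = \<delta> v)"
    using H.s_derivation_of_Q_hom[OF M fg] by blast
qed

lemma s_derivation_A\<epsilon>:
  "s_derivation A K (restrict_scalars \<phi> H.A\<epsilon>) \<delta> \<longleftrightarrow> s_derivation A K K.A\<epsilon> \<delta>"
  by (auto simp: s_derivation_def add_hom_def)

lemma LR_surj_iff: "LR_map K \<phi> ` LR k A H = LR k A K \<longleftrightarrow> Der_s_surj k A K H \<phi> H.A\<epsilon>"
proof -
  have "Der_s k A K (restrict_scalars \<phi> H.A\<epsilon>) = LR k A K"
    using K.Der_s_iff[OF module_restrict[OF H.module_A\<epsilon>]] K.Der_s_iff[OF K.module_A\<epsilon>] s_derivation_A\<epsilon>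
    by (auto simp: LR_def)
  then show ?thesis by (simp add: Der_s_surj_def LR_def LR_map_def[abs_def])
qed

text \<open>
  Given a linear form \<open>c\<close> on \<open>Q(\<K>)\<close>, lift the derivation into \<open>\<H>\<close> that corresponds to \<open>t \<circ> c\<close> and compose
  with \<open>\<epsilon>\<close>. On \<open>\<phi>(v)\<close> the result is \<open>\<epsilon>(v\<^sub>1) c(\<pi> v\<^sub>2) = c(\<pi>(s(\<epsilon>(v\<^sub>1)) v\<^sub>2)) = c(\<pi> v)\<close>.
\<close>

lemma LR_surj_if_Der_s_surj_regular:
  assumes surj: "Der_s_surj k A K H \<phi> (regular H)"
  shows "LR_map K \<phi> ` LR k A H = LR k A K"
  unfolding LR_surj_iff
proof (rule Der_s_surjI[OF H.module_A\<epsilon>])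
  fix \<delta> assume "s_derivation A K (restrict_scalars \<phi> H.A\<epsilon>) \<delta>"
  then have "s_derivation A K K.A\<epsilon> \<delta>" by (simp add: s_derivation_A\<epsilon>)
  then obtain c where c: "c \<in> mod_hom A K.Q (regular A)" "\<And>v. v \<in> carrier K \<Longrightarrow> c (K.proj v) = \<delta> v"
    using K.s_derivation_counitE by blast
  note ch = add_hom_closed[OF mod_hom_add_hom[OF c(1)], simplified] add_hom_add[OF mod_hom_add_hom[OF c(1)], simplified]
    mod_hom_smult[OF c(1), simplified]
  let ?M = "regular H" and ?M' = "restrict_scalars \<phi> (regular H)"
  have M: "module H ?M" by (rule module_regular[OF H.H.is_cring])
  interpret M': module K ?M' by (rule module_restrict[OF M])
  have tc: "(\<lambda>X. tgt H (c X)) \<in> mod_hom A K.Q (restrict_scalars (tgt K) ?M')"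
    by (intro mod_homI add_homI) (simp_all add: ch)
  note b = K.Q_hom_bal2[OF M'.module_axioms tc]
  obtain D where D: "s_derivation A H ?M D"
    "\<And>v. v \<in> carrier K \<Longrightarrow> D (\<phi> v) = K.invariant_form ?M' (\<lambda>X. tgt H (c X)) v"
    using Der_s_surjD[OF surj M K.s_derivation_of_Q_hom[OF M'.module_axioms tc]] by blast
  have eh: "counit H \<in> add_hom ?M' A" by (simp add: add_hom_def)
  have cp: "(\<lambda>v. c (K.proj v)) \<in> add_hom K A" by (simp add: add_hom_def ch K.proj_add)
  have l: "bal2 A K K (\<lambda>x y. src K (counit K x) \<otimes>\<^bsub>K\<^esub> y)"
    by (rule K.bal2I) (simp_all add: K.H.l_distr K.H.r_distr K.H.m_ac)
  have "counit H (D (\<phi> v)) = \<delta> v" if v: "v \<in> carrier K" for v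
  proof -
    have "counit H (D (\<phi> v)) = sweedler K A (\<lambda>x y. counit H (\<phi> x \<otimes>\<^bsub>H\<^esub> tgt H (c (K.proj y)))) v"
      using K.sweedler_compose[OF M'.abelian_group_axioms K.A.abelian_group_axioms b eh v] D(2)[OF v] by simp
    also have "\<dots> = sweedler K A (\<lambda>x y. c (K.proj (src K (counit K x) \<otimes>\<^bsub>K\<^esub> y))) v"
      by (rule K.sweedler_cong[OF K.A.abelian_group_axioms balanced_compose[OF l cp] _ v, symmetric])
        (simp add: ch K.proj_smult)
    also have "\<dots> = c (K.proj (sweedler K K (\<lambda>x y. src K (counit K x) \<otimes>\<^bsub>K\<^esub> y) v))"
      by (rule K.sweedler_compose[OF K.H.abelian_group_axioms K.A.abelian_group_axioms l cp v])
    also have "\<dots> = \<delta> v" using K.counit_l[OF v] c(2)[OF v] by (simp add: sweedler_def)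
    finally show ?thesis .
  qed
  moreover have "s_derivation A H H.A\<epsilon> (\<lambda>u. counit H (D u))"
    using D(1) by (auto simp: s_derivation_def add_hom_def Pi_iff)
  ultimately show "\<exists>D. s_derivation A H H.A\<epsilon> D \<and> (\<forall>v\<in>carrier K. D (\<phi> v) = \<delta> v)" by blast
qed

text \<open>
  Surjectivity lets every coordinate form \<open>c s\<close> of a dual basis of \<open>Q(\<K>)\<close> extend to a form \<open>C s\<close> on \<open>Q(\<H>)\<close>;
  the retraction is \<open>Y \<mapsto> \<Sum>\<^sub>s C s Y \<cdot> e s\<close>.
\<close>

lemma split_if_LR_surj:
  assumes fg: "finitely_generated A K.Q" and pr: "projective A K.Q"
    and surj: "LR_map K \<phi> ` LR k A H = LR k A K"
  shows "split_injective A K.Q H.Q (Q_map A K H \<phi>)"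
proof -
  obtain F and e :: "'kk set \<Rightarrow> 'kk set" and c where F: "finite F" "e \<in> F \<rightarrow> carrier K.Q"
    and c: "\<And>s. s \<in> F \<Longrightarrow> c s \<in> mod_hom A K.Q (regular A)"
    and basis: "\<And>X. X \<in> carrier K.Q \<Longrightarrow> X = (\<Oplus>\<^bsub>K.Q\<^esub>s\<in>F. c s X \<odot>\<^bsub>K.Q\<^esub> e s)"
    using dual_basis[OF fg pr] by blast
  have "\<exists>C. C \<in> mod_hom A H.Q (regular A) \<and> (\<forall>X\<in>carrier K.Q. C (Q_map A K H \<phi> X) = c s X)" if s: "s \<in> F" for s
  proof -
    have "s_derivation A K (restrict_scalars \<phi> H.A\<epsilon>) (\<lambda>v. c s (K.proj v))"
      unfolding s_derivation_A\<epsilon> by (rule K.s_derivation_counitI[OF c[OF s]])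
    then obtain D where D: "s_derivation A H H.A\<epsilon> D" "\<And>v. v \<in> carrier K \<Longrightarrow> D (\<phi> v) = c s (K.proj v)"
      using Der_s_surjD[OF surj[unfolded LR_surj_iff] H.module_A\<epsilon>] by blast
    obtain C where C: "C \<in> mod_hom A H.Q (regular A)" "\<And>u. u \<in> carrier H \<Longrightarrow> C (H.proj u) = D u"
      using H.s_derivation_counitE[OF D(1)] by blast
    have "C (Q_map A K H \<phi> X) = c s X" if X: "X \<in> carrier K.Q" for X
    proof -
      obtain v where "v \<in> carrier K" "X = K.proj v" using K.proj_surj[OF X] by blast
      then show ?thesis by (simp add: Q_map_proj C(2) D(2))
    qed
    then show ?thesis using C(1) by blast
  qed
  then obtain C where C: "\<And>s. s \<in> F \<Longrightarrow> C s \<in> mod_hom A H.Q (regular A)"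
    "\<And>s X. s \<in> F \<Longrightarrow> X \<in> carrier K.Q \<Longrightarrow> C s (Q_map A K H \<phi> X) = c s X"
    by metis
  define g where "g Y = (\<Oplus>\<^bsub>K.Q\<^esub>s\<in>F. C s Y \<odot>\<^bsub>K.Q\<^esub> e s)" for Y
  have Cc: "C s Y \<in> carrier A" if "s \<in> F" "Y \<in> carrier H.Q" for s Y
    using add_hom_closed[OF mod_hom_add_hom[OF C(1)[OF that(1)]] that(2)] by simp
  have Ca: "C s (Y \<oplus>\<^bsub>H.Q\<^esub> Z) = C s Y \<oplus>\<^bsub>A\<^esub> C s Z" if "s \<in> F" "Y \<in> carrier H.Q" "Z \<in> carrier H.Q" for s Y Z
    using add_hom_add[OF mod_hom_add_hom[OF C(1)[OF that(1)]] that(2,3)] by simp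
  have Cs: "C s (a \<odot>\<^bsub>H.Q\<^esub> Y) = a \<otimes>\<^bsub>A\<^esub> C s Y" if "s \<in> F" "Y \<in> carrier H.Q" "a \<in> carrier A" for s Y a
    using mod_hom_smult[OF C(1)[OF that(1)] that(3,2)] by simp
  have e: "e s \<in> carrier K.Q" if "s \<in> F" for s using F(2) that by auto
  have "g \<in> mod_hom A H.Q K.Q"
  proof (intro mod_homI add_homI)
    fix Y assume "Y \<in> carrier H.Q"
    then show "g Y \<in> carrier K.Q" unfolding g_def by (intro K.Q.M.finsum_closed) (auto simp: Cc e)
  next
    fix Y Z assume YZ: "Y \<in> carrier H.Q" "Z \<in> carrier H.Q"
    have "g (Y \<oplus>\<^bsub>H.Q\<^esub> Z) = (\<Oplus>\<^bsub>K.Q\<^esub>s\<in>F. C s Y \<odot>\<^bsub>K.Q\<^esub> e s \<oplus>\<^bsub>K.Q\<^esub> C s Z \<odot>\<^bsub>K.Q\<^esub> e s)"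
      unfolding g_def using YZ by (intro K.Q.M.finsum_cong') (auto simp: Ca Cc e K.Q.smult_l_distr)
    also have "\<dots> = g Y \<oplus>\<^bsub>K.Q\<^esub> g Z"
      unfolding g_def using YZ by (intro K.Q.M.finsum_addf) (auto simp: Cc e)
    finally show "g (Y \<oplus>\<^bsub>H.Q\<^esub> Z) = g Y \<oplus>\<^bsub>K.Q\<^esub> g Z" .
  next
    fix a Y assume aY: "a \<in> carrier A" "Y \<in> carrier H.Q"
    have "g (a \<odot>\<^bsub>H.Q\<^esub> Y) = (\<Oplus>\<^bsub>K.Q\<^esub>s\<in>F. a \<odot>\<^bsub>K.Q\<^esub> (C s Y \<odot>\<^bsub>K.Q\<^esub> e s))"
      unfolding g_def using aY by (intro K.Q.M.finsum_cong') (auto simp: Cs Cc e K.Q.smult_assoc1)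
    also have "\<dots> = a \<odot>\<^bsub>K.Q\<^esub> g Y"
      unfolding g_def using aY by (intro K.Q.finsum_smult_ldistr[symmetric] F) (auto simp: Cc e)
    finally show "g (a \<odot>\<^bsub>H.Q\<^esub> Y) = a \<odot>\<^bsub>K.Q\<^esub> g Y" .
  qed
  moreover have "g (Q_map A K H \<phi> X) = X" if X: "X \<in> carrier K.Q" for X
  proof -
    have "c s X \<in> carrier A" if "s \<in> F" for s
      using add_hom_closed[OF mod_hom_add_hom[OF c[OF that]] X] by simp
    then have "g (Q_map A K H \<phi> X) = (\<Oplus>\<^bsub>K.Q\<^esub>s\<in>F. c s X \<odot>\<^bsub>K.Q\<^esub> e s)"
      unfolding g_def using X by (intro K.Q.M.finsum_cong') (auto simp: C(2) e)
    then show ?thesis using basis[OF X] by simp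
  qed
  ultimately show ?thesis
    unfolding split_injective_def using Q_map_hom by blast
qed

section \<open>Differentials along a morphism\<close>

text \<open>
  The map \<open>om\<close>, \<open>u dv \<mapsto> \<phi>(u) d\<phi>(v)\<close>, corresponds to \<open>\<phi> \<otimes> Q(\<phi>)\<close> under the canonical maps. Injectivity of
  the canonical map of \<open>\<H>\<close> then identifies \<open>Omega_map\<close>, which is defined through its inverse, with \<open>om\<close>.
\<close>

lemma
  shows Omega_map_hom: "Omega_map A K H \<phi> \<in> mod_hom K K.\<Omega> (restrict_scalars \<phi> H.\<Omega>)"
    and Omega_map_form: "u \<in> carrier K \<Longrightarrow> v \<in> carrier K \<Longrightarrow> Omega_map A K H \<phi> (K.form u v) = H.form (\<phi> u) (\<phi> v)"
proof -
  let ?M = "restrict_scalars \<phi> H.\<Omega>"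
  have M: "module K ?M" by (rule module_restrict[OF H.module_Omega])
  have d: "s_derivation A K ?M (\<lambda>v. H.form \<one>\<^bsub>H\<^esub> (\<phi> v))"
    by (rule s_derivation_phi[OF H.s_derivation_form])
  define om where "om = pres_lift (add_monoid ?M) (\<lambda>(u, v). u \<odot>\<^bsub>?M\<^esub> H.form \<one>\<^bsub>H\<^esub> (\<phi> v))"
  have om: "om \<in> mod_hom K K.\<Omega> ?M" unfolding om_def by (rule K.Omega_lift_hom[OF M d])
  have omf: "om (K.form u v) = H.form (\<phi> u) (\<phi> v)" if "u \<in> carrier K" "v \<in> carrier K" for u v
    unfolding om_def using K.Omega_lift_form[OF M d that] that by (simp add: H.smult_form)
  have omc: "om w \<in> carrier H.\<Omega>" if "w \<in> carrier K.\<Omega>" for w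
    using add_hom_closed[OF mod_hom_add_hom[OF om] that] by simp
  define T where "T = tensor_map A (tgt_module H) H.Q \<phi> (Q_map A K H \<phi>)"
  have Tf: "tensor_factors A (tgt_module K) K.Q" "tensor_factors A (tgt_module H) H.Q"
    by (rule tensor_factors_modules[OF K.tgt.module_axioms K.module_Q] tensor_factors_modules[OF H.tgt.module_axioms H.module_Q])+
  have p: "\<phi> \<in> add_hom (tgt_module K) (tgt_module H)" by (simp add: add_hom_def)
  note q = mod_hom_add_hom[OF Q_map_hom]
  have b: "H.tq (\<phi> (a \<odot>\<^bsub>tgt_module K\<^esub> x)) (Q_map A K H \<phi> X) = H.tq (\<phi> x) (Q_map A K H \<phi> (a \<odot>\<^bsub>K.Q\<^esub> X))"
    if "a \<in> carrier A" "x \<in> carrier (tgt_module K)" "X \<in> carrier K.Q" for a x X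
    using that add_hom_closed[OF q] by (simp add: mod_hom_smult[OF Q_map_hom] H.tq_balanced)
  have Th: "T \<in> add_hom K.HQ H.HQ"
    using tensor_map_hom[OF Tf p q b] by (simp add: T_def add_hom_def K.carrier_HQ H.carrier_HQ)
  have Tt: "T (K.tq x X) = H.tq (\<phi> x) (Q_map A K H \<phi> X)" if "x \<in> carrier K" "X \<in> carrier K.Q" for x X
    unfolding T_def using tensor_map_tens[OF Tf p q b] that by simp
  note aK = K.HQ.abelian_group_axioms and aH = H.HQ.abelian_group_axioms
  have iso: "Omega_iso A H (om w) = T (Omega_iso A K w)" if w: "w \<in> carrier K.\<Omega>" for w
  proof (rule add_hom_eqI[OF K.Omega.abelian_group_axioms aH K.add_generated_Omega _ _ _ w])
    have "om \<in> add_hom K.\<Omega> H.\<Omega>" using mod_hom_add_hom[OF om] by (simp add: add_hom_def)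
    then show "(\<lambda>w. Omega_iso A H (om w)) \<in> add_hom K.\<Omega> H.HQ"
      by (rule add_hom_compose[OF _ mod_hom_add_hom[OF H.Omega_iso_hom]])
    show "(\<lambda>w. T (Omega_iso A K w)) \<in> add_hom K.\<Omega> H.HQ"
      by (rule add_hom_compose[OF mod_hom_add_hom[OF K.Omega_iso_hom] Th])
    fix w assume "w \<in> {K.form u v | u v. u \<in> carrier K \<and> v \<in> carrier K}"
    then obtain u v where w: "w = K.form u v" and uv: "u \<in> carrier K" "v \<in> carrier K" by blast
    let ?cK = "sweedler K K.HQ (\<lambda>x y. K.tq x (K.proj y))" and ?cH = "sweedler H H.HQ (\<lambda>x y. H.tq x (H.proj y))"
    note uK = module_smult_add_hom[OF K.module_HQ uv(1)]
    have "T (u \<odot>\<^bsub>K.HQ\<^esub> ?cK v) = sweedler K H.HQ (\<lambda>x y. T (u \<odot>\<^bsub>K.HQ\<^esub> K.tq x (K.proj y))) v"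
      by (rule K.sweedler_compose[OF aK aH K.bal2_tq add_hom_compose[OF uK Th] uv(2), symmetric])
    also have "\<dots> = sweedler K H.HQ (\<lambda>x y. \<phi> u \<odot>\<^bsub>H.HQ\<^esub> H.tq (\<phi> x) (H.proj (\<phi> y))) v"
      by (rule K.sweedler_cong[OF aH balanced_compose[OF K.bal2_tq add_hom_compose[OF uK Th]] _ uv(2)])
        (simp add: uv K.smult_tq H.smult_tq Tt Q_map_proj)
    also have "\<dots> = \<phi> u \<odot>\<^bsub>H.HQ\<^esub> sweedler K H.HQ (\<lambda>x y. H.tq (\<phi> x) (H.proj (\<phi> y))) v"
      by (rule K.sweedler_compose[OF aH aH phi_bal2[OF H.bal2_tq] module_smult_add_hom[OF H.module_HQ] uv(2)])
        (simp add: uv)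
    also have "\<dots> = \<phi> u \<odot>\<^bsub>H.HQ\<^esub> ?cH (\<phi> v)"
      using sweedler_phi[OF aH H.bal2_tq uv(2)] by simp
    finally show "Omega_iso A H (om w) = T (Omega_iso A K w)"
      using uv by (simp add: w omf K.Omega_iso_form H.Omega_iso_form)
  qed
  have eq: "Omega_map A K H \<phi> w = om w" if "w \<in> carrier K.\<Omega>" for w
    using inv_into_f_f[OF H.Omega_iso_inj omc[OF that]] iso[OF that] by (simp add: Omega_map_def T_def)
  show "Omega_map A K H \<phi> \<in> mod_hom K K.\<Omega> ?M"
    using om by (auto simp: mod_hom_def eq)
  show "Omega_map A K H \<phi> (K.form u v) = H.form (\<phi> u) (\<phi> v)" if "u \<in> carrier K" "v \<in> carrier K"
    using that by (simp add: eq omf)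
qed

sublocale E: scalar_extension K H \<phi> K.\<Omega>
  by (intro scalar_extension.intro K.H.is_cring H.H.is_cring phi_ring_hom K.module_Omega)

lemma
  shows Omega_ext_map_hom: "Omega_ext_map A K H \<phi> \<in> mod_hom H E.E H.\<Omega>"
    and Omega_ext_map_tens: "h \<in> carrier H \<Longrightarrow> w \<in> carrier K.\<Omega> \<Longrightarrow>
      Omega_ext_map A K H \<phi> (E.tn h w) = h \<odot>\<^bsub>H.\<Omega>\<^esub> Omega_map A K H \<phi> w"
  unfolding Omega_ext_map_def
  by (rule E.extend_lift_hom[OF H.module_Omega Omega_map_hom])
    (rule E.extend_lift_tens[OF H.module_Omega Omega_map_hom])

lemma s_derivation_ext: "s_derivation A K (restrict_scalars \<phi> E.E) (\<lambda>v. E.tn \<one>\<^bsub>H\<^esub> (K.form \<one>\<^bsub>K\<^esub> v))"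
proof -
  interpret E': module H E.E by (rule E.module_extend)
  note d = s_derivationD[OF K.s_derivation_form]
  have lin: "\<phi> u \<odot>\<^bsub>E.E\<^esub> E.tn \<one>\<^bsub>H\<^esub> w = E.tn \<one>\<^bsub>H\<^esub> (u \<odot>\<^bsub>K.\<Omega>\<^esub> w)" if "u \<in> carrier K" "w \<in> carrier K.\<Omega>" for u w
    using that E.tn_balanced(1)[of u "\<one>\<^bsub>H\<^esub>" w] by (simp add: E.smult_extend_tens)
  have zero: "E.tn \<one>\<^bsub>H\<^esub> \<zero>\<^bsub>K.\<Omega>\<^esub> = \<zero>\<^bsub>E.E\<^esub>"
    by (rule add_hom_zero[OF K.Omega.abelian_group_axioms E'.abelian_group_axioms])
      (simp add: add_hom_def E.tn_balanced)
  show ?thesis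
    by (auto simp: s_derivation_def add_hom_def d lin E.tn_balanced zero simp del: E.extend_simps(2)
        simp flip: E.extend_simps(3))
qed

text \<open>
  Extend the derivation \<open>v \<mapsto> 1 \<otimes> dv\<close> of \<open>\<K>\<close> to \<open>\<H>\<close>. The linear map \<open>r\<close> on \<open>\<Omega>\<^sup>s(\<H>)\<close> that it defines sends
  \<open>h \<phi>(u) d\<phi>(v)\<close> to \<open>h \<phi>(u) (1 \<otimes> dv) = h \<otimes> u dv\<close>.
\<close>

lemma split_Omega_if_split:
  assumes split: "split_injective A K.Q H.Q (Q_map A K H \<phi>)"
  shows "split_injective H E.E H.\<Omega> (Omega_ext_map A K H \<phi>)"
proof -
  obtain D where D: "s_derivation A H E.E D" "\<And>v. v \<in> carrier K \<Longrightarrow> D (\<phi> v) = E.tn \<one>\<^bsub>H\<^esub> (K.form \<one>\<^bsub>K\<^esub> v)"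
    using Der_s_surjD[OF Der_s_surj_if_split[OF split E.module_extend] E.module_extend s_derivation_ext] by blast
  define r where "r = pres_lift (add_monoid E.E) (\<lambda>(u, v). u \<odot>\<^bsub>E.E\<^esub> D v)"
  have r: "r \<in> mod_hom H H.\<Omega> E.E" unfolding r_def by (rule H.Omega_lift_hom[OF E.module_extend D(1)])
  have rf: "r (H.form u v) = u \<odot>\<^bsub>E.E\<^esub> D v" if "u \<in> carrier H" "v \<in> carrier H" for u v
    unfolding r_def by (rule H.Omega_lift_form[OF E.module_extend D(1) that])
  have retract: "r (h \<odot>\<^bsub>H.\<Omega>\<^esub> Omega_map A K H \<phi> w) = E.tn h w" if h: "h \<in> carrier H" and w: "w \<in> carrier K.\<Omega>" for h w
  proof (rule add_hom_eqI[OF K.Omega.abelian_group_axioms E.abelian_group_extend K.add_generated_Omega _ _ _ w])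
    have "Omega_map A K H \<phi> \<in> add_hom K.\<Omega> H.\<Omega>" using mod_hom_add_hom[OF Omega_map_hom] by (simp add: add_hom_def)
    then show "(\<lambda>w. r (h \<odot>\<^bsub>H.\<Omega>\<^esub> Omega_map A K H \<phi> w)) \<in> add_hom K.\<Omega> E.E"
      by (rule add_hom_compose[OF add_hom_compose[OF _ module_smult_add_hom[OF H.module_Omega h]] mod_hom_add_hom[OF r]])
    show "(\<lambda>w. E.tn h w) \<in> add_hom K.\<Omega> E.E"
      using h by (simp add: add_hom_def E.tn_balanced)
    fix w assume "w \<in> {K.form u v | u v. u \<in> carrier K \<and> v \<in> carrier K}"
    then obtain u v where w: "w = K.form u v" and uv: "u \<in> carrier K" "v \<in> carrier K" by blast
    have "r (h \<odot>\<^bsub>H.\<Omega>\<^esub> Omega_map A K H \<phi> w) = (h \<otimes>\<^bsub>H\<^esub> \<phi> u) \<odot>\<^bsub>E.E\<^esub> E.tn \<one>\<^bsub>H\<^esub> (K.form \<one>\<^bsub>K\<^esub> v)"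
      using h uv by (simp add: w Omega_map_form H.smult_form rf D(2))
    also have "\<dots> = E.tn (\<phi> u \<otimes>\<^bsub>H\<^esub> h) (K.form \<one>\<^bsub>K\<^esub> v)"
      using h uv by (simp add: E.smult_extend_tens H.H.m_comm)
    also have "\<dots> = E.tn h (u \<odot>\<^bsub>K.\<Omega>\<^esub> K.form \<one>\<^bsub>K\<^esub> v)"
      using h uv by (intro E.tn_balanced(1)) auto
    finally show "r (h \<odot>\<^bsub>H.\<Omega>\<^esub> Omega_map A K H \<phi> w) = E.tn h w"
      using uv by (simp add: w K.smult_form)
  qed
  have "r (Omega_ext_map A K H \<phi> X) = X" if "X \<in> carrier E.E" for X
    by (rule add_hom_eqI[OF E.abelian_group_extend E.abelian_group_extend E.add_generated_extend
          add_hom_compose[OF mod_hom_add_hom[OF Omega_ext_map_hom] mod_hom_add_hom[OF r]] add_hom_ident _ that])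
      (auto simp: Omega_ext_map_tens retract)
  then show ?thesis unfolding split_injective_def using Omega_ext_map_hom r by blast
qed

text \<open>
  A derivation \<open>\<delta>\<close> of \<open>\<K>\<close> is a linear map on \<open>\<Omega>\<^sup>s(\<K>)\<close>, hence on \<open>\<H> \<otimes>\<^sub>\<K> \<Omega>\<^sup>s(\<K>)\<close>; composed with the retraction
  \<open>r\<close> it becomes a linear map on \<open>\<Omega>\<^sup>s(\<H>)\<close>, that is, a derivation of \<open>\<H>\<close>.
\<close>

lemma Der_s_surj_if_split_Omega:
  assumes split: "split_injective H E.E H.\<Omega> (Omega_ext_map A K H \<phi>)" and M: "module H M"
  shows "Der_s_surj k A K H \<phi> M"
proof (rule Der_s_surjI[OF M])
  interpret M: module H M by fact
  fix \<delta> assume \<delta>: "s_derivation A K (restrict_scalars \<phi> M) \<delta>"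
  note M' = module_restrict[OF M]
  obtain r where r: "r \<in> mod_hom H H.\<Omega> E.E" "\<And>X. X \<in> carrier E.E \<Longrightarrow> r (Omega_ext_map A K H \<phi> X) = X"
    using split by (auto simp: split_injective_def)
  define g where "g = pres_lift (add_monoid (restrict_scalars \<phi> M)) (\<lambda>(u, v). u \<odot>\<^bsub>restrict_scalars \<phi> M\<^esub> \<delta> v)"
  have g: "g \<in> mod_hom K K.\<Omega> (restrict_scalars \<phi> M)" unfolding g_def by (rule K.Omega_lift_hom[OF M' \<delta>])
  have gf: "g (K.form \<one>\<^bsub>K\<^esub> v) = \<delta> v" if "v \<in> carrier K" for v
    unfolding g_def using K.Omega_lift_form[OF M' \<delta> _ that, of "\<one>\<^bsub>K\<^esub>"] s_derivationD(2)[OF \<delta> that] by simp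
  define F where "F = tensor_lift M (\<lambda>b y. b \<odot>\<^bsub>M\<^esub> g y)"
  have F: "F \<in> mod_hom H E.E M" unfolding F_def by (rule E.extend_lift_hom[OF M g])
  have Ft: "F (E.tn b y) = b \<odot>\<^bsub>M\<^esub> g y" if "b \<in> carrier H" "y \<in> carrier K.\<Omega>" for b y
    unfolding F_def by (rule E.extend_lift_tens[OF M g that])
  have Fr: "(\<lambda>w. F (r w)) \<in> mod_hom H H.\<Omega> M" by (rule mod_hom_compose[OF r(1) F])
  define D where "D u = F (r (H.form \<one>\<^bsub>H\<^esub> u))" for u
  have "F (r \<zero>\<^bsub>H.\<Omega>\<^esub>) = \<zero>\<^bsub>M\<^esub>"
    by (rule add_hom_zero[OF H.Omega.abelian_group_axioms M.abelian_group_axioms mod_hom_add_hom[OF Fr]])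
  then have "s_derivation A H M D"
    using add_hom_closed[OF mod_hom_add_hom[OF Fr]] add_hom_add[OF mod_hom_add_hom[OF Fr]] mod_hom_smult[OF Fr]
      s_derivationD[OF H.s_derivation_form]
    by (auto simp: D_def s_derivation_def add_hom_def)
  moreover have "D (\<phi> v) = \<delta> v" if v: "v \<in> carrier K" for v
  proof -
    have "H.form \<one>\<^bsub>H\<^esub> (\<phi> v) = Omega_ext_map A K H \<phi> (E.tn \<one>\<^bsub>H\<^esub> (K.form \<one>\<^bsub>K\<^esub> v))"
      using v by (simp add: Omega_ext_map_tens Omega_map_form H.smult_form)
    then show ?thesis using v r(2)[of "E.tn \<one>\<^bsub>H\<^esub> (K.form \<one>\<^bsub>K\<^esub> v)"] s_derivationD(2)[OF \<delta> v]
      by (simp add: D_def Ft gf)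
  qed
  ultimately show "\<exists>D. s_derivation A H M D \<and> (\<forall>v\<in>carrier K. D (\<phi> v) = \<delta> v)" by blast
qed

end

theorem theoremC:
  fixes k :: "('k, 'w) ring_scheme"
    and A :: "('k, 'a, 'x) module_scheme"
    and K :: "('k, 'a, 'kk, 'y) hopf_algebroid_scheme"
    and H :: "('k, 'a, 'h, 'z) hopf_algebroid_scheme"
    and \<phi> :: "'kk \<Rightarrow> 'h"
  assumes "commutative_hopf_algebroid k A K"
    and "commutative_hopf_algebroid k A H"
    and "\<phi> \<in> hopf_algebroid_hom k A K H"
    and "finitely_generated A (Q_module A H)" and "projective A (Q_module A H)"
    and "finitely_generated A (Q_module A K)" and "projective A (Q_module A K)"
  shows
    "(split_injective A (Q_module A K) (Q_module A H) (Q_map A K H \<phi>) \<longleftrightarrow>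
       LR_map K \<phi> ` LR k A H = LR k A K) \<and>
     (split_injective A (Q_module A K) (Q_module A H) (Q_map A K H \<phi>) \<longleftrightarrow>
       (\<forall>M :: ('h, 'h) module. module H M \<longrightarrow> Der_s_surj k A K H \<phi> M) \<and>
       (\<forall>M :: ('h, 'm) module. module H M \<longrightarrow> Der_s_surj k A K H \<phi> M)) \<and>
     (split_injective A (Q_module A K) (Q_module A H) (Q_map A K H \<phi>) \<longleftrightarrow>
       Der_s_surj k A K H \<phi> (ring_via (\<lambda>h. h) H)) \<and>
     (split_injective A (Q_module A K) (Q_module A H) (Q_map A K H \<phi>) \<longleftrightarrow>
       split_injective H (extend_scalars K H \<phi> (Omega_s A K)) (Omega_s A H)
         (Omega_ext_map A K H \<phi>))"
proof -
  interpret K: commutative_hopf_algebroid k A K by fact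
  interpret H: commutative_hopf_algebroid k A H by fact
  interpret hopf_morphism k A K H \<phi> by unfold_locales fact
  let ?a = "split_injective A (Q_module A K) (Q_module A H) (Q_map A K H \<phi>)"
  have regular: "module H (ring_via (\<lambda>h. h) H)" by (rule module_regular[OF H.H.is_cring])
  have "?a" if "LR_map K \<phi> ` LR k A H = LR k A K"
    using assms(6,7) that by (rule split_if_LR_surj)
  moreover have "LR_map K \<phi> ` LR k A H = LR k A K" if "Der_s_surj k A K H \<phi> (ring_via (\<lambda>h. h) H)"
    using that by (rule LR_surj_if_Der_s_surj_regular)
  moreover have "Der_s_surj k A K H \<phi> M" if ?a "module H M" for M :: "('h, 'h) module"
    using that by (rule Der_s_surj_if_split)
  moreover have "Der_s_surj k A K H \<phi> M" if ?a "module H M" for M :: "('h, 'm) module"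
    using that by (rule Der_s_surj_if_split)
  moreover have "split_injective H (extend_scalars K H \<phi> (Omega_s A K)) (Omega_s A H) (Omega_ext_map A K H \<phi>)" if ?a
    using that by (rule split_Omega_if_split)
  moreover have "Der_s_surj k A K H \<phi> (ring_via (\<lambda>h. h) H)"
    if "split_injective H (extend_scalars K H \<phi> (Omega_s A K)) (Omega_s A H) (Omega_ext_map A K H \<phi>)"
    using that regular by (rule Der_s_surj_if_split_Omega)
  ultimately show ?thesis using regular by blast
qed

end
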